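(* Let $m,n\in\mathbb{N}_0$ with $0\le m\le n$, $\sigma,\sigma'\in(0,\infty)$, and $\theta'\in(0,\pi)$. Then \[ \int_0^\pi Q_{m-1/2}(\chi)\,\mathrm{P}^m_n(\cos\theta)\sqrt{\sin\theta}\,d\theta =2\pi i(-1)^m\frac{(n-m)!}{(n+m)!}\sqrt{\cosh\sigma\cosh\sigma'\sin\theta'}\;\mathrm{P}^m_n(\cos\theta')\,P^m_n(i\sinh\sigma_<)\,Q^m_n(i\sinh\sigma_>), \] where \[ \chi=\frac{\sinh^2\sigma+\sinh^2\sigma'+\sin^2\theta+\sin^2\theta'-2\sinh\sigma\sinh\sigma'\cos\theta\cos\theta'}{2\cosh\sigma\cosh\sigma'\sin\theta\sin\theta'} \] and $\sigma_<=\min\{\sigma,\sigma'\}$, $\sigma_>=\max\{\sigma,\sigma'\}$.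
   Context: For $z\in\mathbb{C}\setminus(-\infty,1]$ (principal branches, $\mathbf{F}={}_2F_1/\Gamma(c)$ regularized hypergeometric function): the associated Legendre functions are $P^\mu_\nu(z)=\left(\frac{z+1}{z-1}\right)^{\mu/2}\mathbf{F}\!\left(\nu+1,-\nu;1-\mu;\frac{1-z}{2}\right)$ and $Q^\mu_\nu(z)=e^{\mu\pi i}\frac{\sqrt{\pi}\,\Gamma(\nu+\mu+1)(z^2-1)^{\mu/2}}{2^{\nu+1}z^{\nu+\mu+1}}\,\mathbf{F}\!\left(\frac{\nu+\mu}{2}+1,\frac{\nu+\mu+1}{2};\nu+\frac32;\frac{1}{z^2}\right)$, and $Q_\nu=Q^0_\nu$. $\mathrm{P}^m_n$ is the Ferrers function of the first kind: for integers $0\le m\le n$ and $x\in(-1,1)$, $\mathrm{P}^m_n(x)=(-1)^m(1-x^2)^{m/2}\frac{d^m}{dx^m}P_n(x)$ with $P_n$ the Legendre polynomial. *)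

theory Defs
  imports "HOL-Analysis.Analysis" "HOL-Computational_Algebra.Polynomial"
begin

text \<open>Power series of the regularized Gauss hypergeometric function
  F(a,b;c;z) = 2F1(a,b;c;z)/Gamma(c) = sum_k (a)_k (b)_k / (Gamma(c+k) k!) z^k,
  with 1/Gamma given by rGamma (entire, vanishing at nonpositive integers).\<close>
definition hyp2F1_reg_series :: "complex \<Rightarrow> complex \<Rightarrow> complex \<Rightarrow> complex \<Rightarrow> complex" where
  "hyp2F1_reg_series a b c z =
     (\<Sum>k. pochhammer a k * pochhammer b k * rGamma (c + of_nat k) / fact k * z ^ k)"

text \<open>Principal branch: the analytic continuation of the series (from the unit disk)
  to the cut plane C minus [1,infinity).\<close>
definition hyp_domain :: "complex set" where
  "hyp_domain = - (complex_of_real ` {1..})"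

definition hyp2F1_reg :: "complex \<Rightarrow> complex \<Rightarrow> complex \<Rightarrow> complex \<Rightarrow> complex" where
  "hyp2F1_reg a b c z =
     (THE v. \<exists>f. f holomorphic_on hyp_domain \<and>
                 (\<forall>w. norm w < 1 \<longrightarrow> f w = hyp2F1_reg_series a b c w) \<and>
                 f z = v)"

text \<open>Associated Legendre functions of the first and second kind (principal branches,
  z in C minus (-infinity,1]).\<close>
definition legendreP :: "complex \<Rightarrow> complex \<Rightarrow> complex \<Rightarrow> complex" where
  "legendreP mu nu z =
     ((z + 1) / (z - 1)) powr (mu / 2) * hyp2F1_reg (nu + 1) (- nu) (1 - mu) ((1 - z) / 2)"

definition legendreQ :: "complex \<Rightarrow> complex \<Rightarrow> complex \<Rightarrow> complex" where
  "legendreQ mu nu z =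
     exp (mu * of_real pi * \<i>) * complex_of_real (sqrt pi) * Gamma (nu + mu + 1)
       * (z\<^sup>2 - 1) powr (mu / 2) / (2 powr (nu + 1) * z powr (nu + mu + 1))
       * hyp2F1_reg ((nu + mu) / 2 + 1) ((nu + mu + 1) / 2) (nu + 3 / 2) (1 / z\<^sup>2)"

text \<open>Legendre polynomial via Rodrigues' formula.\<close>
definition legendre_poly :: "nat \<Rightarrow> real poly" where
  "legendre_poly n = smult (1 / (2 ^ n * fact n)) ((pderiv ^^ n) ([:-1, 0, 1:] ^ n))"

definition ferrersP :: "nat \<Rightarrow> nat \<Rightarrow> real \<Rightarrow> real" where
  "ferrersP m n x = (-1) ^ m * sqrt (1 - x\<^sup>2) ^ m * poly ((pderiv ^^ m) (legendre_poly n)) x"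

end

theory Submission
  imports Defs "HOL-Complex_Analysis.Complex_Analysis" "HOL-Real_Asymp.Real_Asymp"
begin

text \<open>
  Write \<open>v(\<sigma>, \<theta>) = Q(\<chi>)\<close> for the half-integer Legendre function and
  \<open>w(\<theta>) = sqrt (sin \<theta>) * P(cos \<theta>)\<close>, up to sign.
  As \<open>\<chi>\<close> is the hyperbolic cosine of a distance in a metric conformal to \<open>(\<sigma>, \<theta>)\<close>,
  \<open>v\<close> satisfies \<open>v\<^sub>\<sigma>\<^sub>\<sigma> + v\<^sub>\<theta>\<^sub>\<theta> = (m\<^sup>2 - 1/4) (1/sin\<^sup>2 \<theta> - 1/cosh\<^sup>2 \<sigma>) v\<close>
  away from the source \<open>(\<sigma>', \<theta>')\<close>.
  Green's identity in \<open>\<theta>\<close> against \<open>w\<close> turns this into the ordinary differential equation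
  \<open>K'' = ((n + 1/2)\<^sup>2 - (m\<^sup>2 - 1/4)/cosh\<^sup>2 \<sigma>) K\<close> for \<open>K(\<sigma>) = \<integral> v w d\<theta>\<close>, which is also solved by
  \<open>sqrt (cosh \<sigma>)\<close> times \<open>P(i sinh \<sigma>)\<close> and \<open>Q(i sinh \<sigma>)\<close>.
  By parity \<open>K\<close> is a multiple of the former on \<open>\<bar>\<sigma>\<bar> < \<sigma>'\<close>, by decay it is a multiple of the latter on
  \<open>\<sigma> > \<sigma>'\<close>. The logarithmic singularity of \<open>Q\<close> at 1 makes \<open>K\<close> continuous at \<open>\<sigma>'\<close>, while
  \<open>\<chi> - 1 = (cosh (\<sigma> - \<sigma>') - cos (\<theta> - \<theta>')) * smooth\<close> exhibits the singular part of \<open>K'\<close> as a Poisson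
  integral, so that \<open>K'\<close> jumps by \<open>- 2 \<pi> w(\<theta>')\<close>. Together with the Wronskian this determines \<open>K\<close>.

  The continuation of the hypergeometric series that defines \<open>Q\<close> is supplied by the quadratic
  transformation with argument \<open>(1 - sqrt (1 - w)) / (1 + sqrt (1 - w))\<close>, which maps the cut plane into the unit disc.
\<close>

subsection \<open>The regularized hypergeometric function\<close>

text \<open>Put \<open>z + \<i> * R = sinh (\<sigma> + \<i> * \<theta>)\<close>, that is
  \<open>R = cosh \<sigma> * sin \<theta>\<close> and
  \<open>z = sinh \<sigma> * cos \<theta>\<close>. Then \<chi> is
  \<open>(R^2 + R'^2 + (z - z')^2) / (2 * R * R')\<close>, the usual expression for the hyperbolic
  distance in the half-plane R > 0. This map takes equal values at
  \<open>(\<sigma>, \<theta>)\<close> and \<open>(- \<sigma>, pi - \<theta>)\<close>. Hence the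
  parity of K, and hence a second image of the source on the line
  \<open>\<sigma> = - \<sigma>'\<close>, which is excluded together with
  \<open>\<sigma> = \<sigma>'\<close>. At the ends of the interval \<chi> becomes infinite. The
  integrand is therefore written through a homogeneous series in \<open>sin \<theta>\<close> and
  \<open>\<chi> * sin \<theta>\<close>, which stays regular there; the powers of the sine collect
  into \<open>sin \<theta> ^ (2 * m + 1)\<close>, and this factor also removes the boundary terms.
  The jump \<open>- 2 * pi\<close> is \<open>- 4 * pi\<close> times 1/2, and 1/2 is the coefficient
  of the logarithm in Q at 1, the same for every degree.\<close>

definition hyp_coeff :: "real \<Rightarrow> real \<Rightarrow> real \<Rightarrow> nat \<Rightarrow> real" where
  "hyp_coeff a b c k = pochhammer a k * pochhammer b k * rGamma (c + real k) / fact k"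

lemma hyp_coeff_0: "hyp_coeff a b c 0 = rGamma c"
  by (simp add: hyp_coeff_def)

text \<open>The recurrence is kept free of quotients: \<open>rGamma x = x * rGamma (x + 1)\<close>
  holds at every real x, also at the zeros of \<open>rGamma\<close>.\<close>

lemma hyp_coeff_Suc:
  "(real k + 1) * (real k + c) * hyp_coeff a b c (Suc k) = (real k + a) * (real k + b) * hyp_coeff a b c k"
proof -
  have "rGamma (c + real k) = (c + real k) * rGamma (c + real (Suc k))"
    using rGamma_plus1[of "c + real k"] by (simp add: add_ac)
  moreover have "hyp_coeff a b c (Suc k) * (real k + 1) =
      (a + real k) * (b + real k) * (pochhammer a k * pochhammer b k / fact k) * rGamma (c + real (Suc k))"
    unfolding hyp_coeff_def pochhammer_rec' fact_Suc by (simp add: divide_simps)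
  moreover have "(real k + 1) * (real k + c) * hyp_coeff a b c (Suc k) =
      (c + real k) * (hyp_coeff a b c (Suc k) * (real k + 1))"
    by (simp add: mult_ac add_ac)
  ultimately have "(real k + 1) * (real k + c) * hyp_coeff a b c (Suc k) =
      (a + real k) * (b + real k) * (pochhammer a k * pochhammer b k / fact k) * rGamma (c + real k)"
    by (simp only: mult_ac) 
  then show ?thesis
    unfolding hyp_coeff_def by (simp add: field_simps)
qed

lemma hyp_coeff_pos:
  assumes "a > 0" "b > 0" "c > 0"
  shows "hyp_coeff a b c k > 0"
  unfolding hyp_coeff_def using assms
  by (auto intro!: mult_pos_pos divide_pos_pos pochhammer_pos simp: rGamma_inverse_Gamma)

lemma summable_hyp_coeff:
  fixes z :: "'a :: {real_normed_field, banach}"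
  assumes "a > 0" "b > 0" "c > 0" "norm z < 1"
  shows "summable (\<lambda>k. of_real (hyp_coeff a b c k) * z ^ k)"
proof -
  have pos: "hyp_coeff a b c k > 0" for k
    using assms by (intro hyp_coeff_pos)
  have "norm (of_real (hyp_coeff a b c k) :: 'a) / norm (of_real (hyp_coeff a b c (Suc k)) :: 'a) =
          ((real k + 1) * (real k + c)) / ((real k + a) * (real k + b))" for k
  proof -
    have "(real k + a) * (real k + b) \<noteq> 0" using assms by (simp add: add_nonneg_eq_0_iff)
    then show ?thesis
      using hyp_coeff_Suc[of k c a b] pos[of k] pos[of "Suc k"]
      by (simp add: frac_eq_eq mult_ac del: mult_eq_0_iff)
  qed
  moreover have "(\<lambda>k. ((real k + 1) * (real k + c)) / ((real k + a) * (real k + b))) \<longlonglongrightarrow> 1"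
    by real_asymp
  ultimately have "conv_radius (\<lambda>k. of_real (hyp_coeff a b c k) :: 'a) = ereal 1"
    by (intro conv_radius_ratio_limit_nonzero) (use pos in \<open>auto simp: less_imp_neq[THEN not_sym]\<close>)
  then show ?thesis
    using assms by (intro summable_in_conv_radius) auto
qed

text \<open>The coefficient of z^k is \<open>(k + 1) * (k + c)\<close> times the next coefficient on
  the left and \<open>(k + a) * (k + b)\<close> times the current one on the right, so the equation
  is the recurrence \<open>hyp_coeff_Suc\<close> summed over k. It is stated for real and complex
  arguments at once because both are needed later.\<close>

lemma hyp_series_ode:
  fixes z :: "'a :: {real_normed_field, banach}"
  assumes "a > 0" "b > 0" "c > 0" "norm z < 1"
  defines "t \<equiv> (\<lambda>k. of_real (hyp_coeff a b c k) :: 'a)"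
  defines "S \<equiv> (\<lambda>z. \<Sum>k. t k * z ^ k)" and "S' \<equiv> (\<lambda>z. \<Sum>k. diffs t k * z ^ k)"
    and "S'' \<equiv> (\<lambda>z. \<Sum>k. diffs (diffs t) k * z ^ k)"
  shows "(S has_field_derivative S' z) (at z)" "(S' has_field_derivative S'' z) (at z)"
    and "z * S'' z + of_real c * S' z =
           z\<^sup>2 * S'' z + of_real (a + b + 1) * z * S' z + of_real (a * b) * S z"
proof -
  have s0: "summable (\<lambda>k. t k * w ^ k)" if "norm w < 1" for w
    unfolding t_def using assms(1-3) that by (rule summable_hyp_coeff)
  have s1: "summable (\<lambda>k. diffs t k * w ^ k)" if "norm w < 1" for w
    by (rule termdiff_converges[where K = 1]) (use that s0 in auto)
  have s2: "summable (\<lambda>k. diffs (diffs t) k * w ^ k)" if "norm w < 1" for w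
    by (rule termdiff_converges[where K = 1]) (use that s1 in auto)
  show "(S has_field_derivative S' z) (at z)"
    unfolding S_def S'_def using s0 \<open>norm z < 1\<close> by (intro termdiffs_strong'[where K = 1]) auto
  show "(S' has_field_derivative S'' z) (at z)"
    unfolding S'_def S''_def using s1 \<open>norm z < 1\<close> by (intro termdiffs_strong'[where K = 1]) auto
  have e0: "(\<lambda>k. t k * z ^ k) sums S z"
    unfolding S_def using s0 \<open>norm z < 1\<close> by (auto intro: summable_sums)
  have e1: "(\<lambda>k. diffs t k * z ^ k) sums S' z"
    unfolding S'_def using s1 \<open>norm z < 1\<close> by (auto intro: summable_sums)
  have e2: "(\<lambda>k. diffs (diffs t) k * z ^ k) sums S'' z"
    unfolding S''_def using s2 \<open>norm z < 1\<close> by (auto intro: summable_sums)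
  \<comment> \<open>Multiplication by z shifts the index by one. The term gained at index 0 carries
    the factor \<open>of_nat 0\<close>, so the shift needs no correction; the same holds for the
    next two sums.\<close>
  have z1: "(\<lambda>k. of_nat k * t k * z ^ k) sums (z * S' z)"
  proof -
    have "(\<lambda>k. of_nat (Suc k) * t (Suc k) * z ^ Suc k) sums (z * S' z)"
      using sums_mult[OF e1, of z] by (simp add: diffs_def mult_ac)
    then show ?thesis by (subst (asm) sums_Suc_iff) simp
  qed
  have z2: "(\<lambda>k. of_nat k * diffs t k * z ^ k) sums (z * S'' z)"
  proof -
    have "(\<lambda>k. of_nat (Suc k) * diffs t (Suc k) * z ^ Suc k) sums (z * S'' z)"
      using sums_mult[OF e2, of z] by (simp add: diffs_def mult_ac)
    then show ?thesis by (subst (asm) sums_Suc_iff) simp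
  qed
  have z3: "(\<lambda>k. of_nat k * (of_nat k - 1) * t k * z ^ k) sums (z\<^sup>2 * S'' z)"
  proof -
    have "(\<lambda>k. of_nat (Suc k) * (of_nat (Suc k) - 1) * t (Suc k) * z ^ Suc k) sums (z\<^sup>2 * S'' z)"
      using sums_mult[OF z2, of z] by (simp add: diffs_def mult_ac power2_eq_square)
    then show ?thesis by (subst (asm) sums_Suc_iff) simp
  qed
  have "(\<lambda>k. of_nat k * diffs t k * z ^ k + of_real c * (diffs t k * z ^ k)) sums
          (z * S'' z + of_real c * S' z)"
    by (intro sums_add sums_mult z2 e1)
  moreover have "(\<lambda>k. of_nat k * (of_nat k - 1) * t k * z ^ k + of_real (a + b + 1) * (of_nat k * t k * z ^ k)
       + of_real (a * b) * (t k * z ^ k)) sums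
          (z\<^sup>2 * S'' z + of_real (a + b + 1) * (z * S' z) + of_real (a * b) * S z)"
    by (intro sums_add sums_mult z3 z1 e0)
  moreover have "of_nat k * (of_nat k - 1) * t k * z ^ k + of_real (a + b + 1) * (of_nat k * t k * z ^ k)
       + of_real (a * b) * (t k * z ^ k) = of_nat k * diffs t k * z ^ k + of_real c * (diffs t k * z ^ k)" for k
  proof -
    have "of_nat k * (of_nat k - 1) * t k + of_real (a + b + 1) * (of_nat k * t k) + of_real (a * b) * t k
        = of_real ((real k + a) * (real k + b) * hyp_coeff a b c k)"
      by (simp add: t_def algebra_simps)
    also have "\<dots> = of_nat k * diffs t k + of_real c * diffs t k"
      by (subst hyp_coeff_Suc[symmetric]) (simp add: t_def diffs_def algebra_simps)
    finally have "(of_nat k * (of_nat k - 1) * t k + of_real (a + b + 1) * (of_nat k * t k) + of_real (a * b) * t k) * z ^ k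
       = (of_nat k * diffs t k + of_real c * diffs t k) * z ^ k" by simp
    then show ?thesis by (simp add: algebra_simps)
  qed
  ultimately show "z * S'' z + of_real c * S' z =
           z\<^sup>2 * S'' z + of_real (a + b + 1) * z * S' z + of_real (a * b) * S z"
    by (simp add: sums_iff mult.assoc)
qed

lemma hyp2F1_reg_series_of_real:
  "hyp2F1_reg_series (of_real a) (of_real b) (of_real c) z = (\<Sum>k. of_real (hyp_coeff a b c k) * z ^ k)"
  unfolding hyp2F1_reg_series_def hyp_coeff_def
  by (simp add: pochhammer_of_real flip: rGamma_complex_of_real)

section \<open>Uniqueness of the continuation to the cut plane\<close>

lemma mem_hyp_domain_iff: "w \<in> hyp_domain \<longleftrightarrow> 1 - w \<notin> \<real>\<^sub>\<le>\<^sub>0"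
proof -
  have "w \<in> complex_of_real ` {1..} \<longleftrightarrow> 1 - w \<in> \<real>\<^sub>\<le>\<^sub>0"
    by (auto simp: complex_nonpos_Reals_iff image_iff complex_eq_iff intro!: bexI[of _ "Re w"])
  then show ?thesis by (simp add: hyp_domain_def)
qed

lemma open_hyp_domain: "open hyp_domain"
proof -
  have "hyp_domain = (\<lambda>w. 1 - w) -` (- \<real>\<^sub>\<le>\<^sub>0)" by (auto simp: mem_hyp_domain_iff)
  then show ?thesis
    using open_vimage[of "- \<real>\<^sub>\<le>\<^sub>0" "\<lambda>w::complex. 1 - w"] closed_nonpos_Reals_complex
    by (simp add: open_Compl continuous_on_diff)
qed

lemma connected_hyp_domain: "connected hyp_domain"
  unfolding hyp_domain_def by (intro starlike_imp_connected starlike_slotted_complex_plane_right)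

text \<open>Makes the definite description computable: two candidates agree on the unit disc, hence
  on the whole cut plane by the identity theorem, as the cut plane is open and starlike.\<close>

lemma hyp2F1_reg_eqI:
  assumes holo: "f holomorphic_on hyp_domain"
    and series: "\<And>w. norm w < 1 \<Longrightarrow> f w = hyp2F1_reg_series a b c w"
    and z: "z \<in> hyp_domain"
  shows "hyp2F1_reg a b c z = f z"
  unfolding hyp2F1_reg_def
proof (rule the_equality)
  show "\<exists>g. g holomorphic_on hyp_domain \<and> (\<forall>w. norm w < 1 \<longrightarrow> g w = hyp2F1_reg_series a b c w) \<and> g z = f z"
    using holo series by blast
next
  fix v assume "\<exists>g. g holomorphic_on hyp_domain \<and> (\<forall>w. norm w < 1 \<longrightarrow> g w = hyp2F1_reg_series a b c w) \<and> g z = v"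
  then obtain g where g: "g holomorphic_on hyp_domain"
      "\<And>w. norm w < 1 \<Longrightarrow> g w = hyp2F1_reg_series a b c w" "g z = v" by blast
  have sub: "ball 0 1 \<subseteq> hyp_domain" by (auto simp: hyp_domain_def)
  have "g z - f z = 0"
  proof (rule analytic_continuation[of "\<lambda>z. g z - f z" hyp_domain "ball 0 1" 0])
    show "(\<lambda>z. g z - f z) holomorphic_on hyp_domain" using g(1) holo by (intro holomorphic_intros)
    show "(0::complex) islimpt ball 0 1" by (simp add: islimpt_ball)
  qed (use open_hyp_domain connected_hyp_domain sub g(2) series z in auto)
  with g show "v = f z" by simp
qed

text \<open>The differential equation forces the recurrence of the hypergeometric coefficients on
  the Taylor coefficients of f, and \<open>c > 0\<close> keeps \<open>k + c\<close> away from zero,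
  so \<open>f 0\<close> determines all of them. A candidate for the continuation is thus recognised
  by its equation, without expanding it.\<close>

lemma hyp_ode_fps_unique:
  fixes a b c :: real
  assumes pos: "c > 0"
    and holo: "f holomorphic_on ball 0 1" and f0: "f 0 = of_real (rGamma c)"
    and ode: "\<And>w. norm w < 1 \<Longrightarrow>
      w * (1 - w) * deriv (deriv f) w + (of_real c - of_real (a + b + 1) * w) * deriv f w - of_real (a * b) * f w = 0"
    and w: "norm w < 1"
  shows "f w = hyp2F1_reg_series (of_real a) (of_real b) (of_real c) w"
proof -
  define F where "F = fps_expansion f 0"
  have F: "f has_fps_expansion F"
    unfolding F_def using holo by (intro has_fps_expansion_fps_expansion[of "ball 0 1"]) auto
  have F1: "deriv f has_fps_expansion fps_deriv F" using F by (rule has_fps_expansion_deriv)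
  have F2: "deriv (deriv f) has_fps_expansion fps_deriv (fps_deriv F)" using F1 by (rule has_fps_expansion_deriv)
  have "(\<lambda>w. w * (1 - w) * deriv (deriv f) w + (of_real c - of_real (a + b + 1) * w) * deriv f w - of_real (a * b) * f w)
     has_fps_expansion (fps_X * (1 - fps_X) * fps_deriv (fps_deriv F) +
       (fps_const (of_real c) - fps_const (of_real (a + b + 1)) * fps_X) * fps_deriv F - fps_const (of_real (a * b)) * F)"
    by (intro fps_expansion_intros F F1 F2)
  moreover have "(\<lambda>w. w * (1 - w) * deriv (deriv f) w + (of_real c - of_real (a + b + 1) * w) * deriv f w - of_real (a * b) * f w)
     has_fps_expansion 0"
  proof -
    have "eventually (\<lambda>w::complex. w \<in> ball 0 1) (nhds 0)"
      by (intro eventually_nhds_in_open) auto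
    then have "eventually (\<lambda>w. w * (1 - w) * deriv (deriv f) w + (of_real c - of_real (a + b + 1) * w) * deriv f w - of_real (a * b) * f w = 0) (nhds 0)"
      by eventually_elim (use ode in auto)
    then show ?thesis by (subst has_fps_expansion_cong[OF _ refl]) auto
  qed
  ultimately have fps: "fps_X * (1 - fps_X) * fps_deriv (fps_deriv F) +
       (fps_const (of_real c) - fps_const (of_real (a + b + 1)) * fps_X) * fps_deriv F - fps_const (of_real (a * b)) * F = 0"
    using fps_expansion_unique_complex by blast
  have rec: "of_nat (k + 1) * (of_nat k + of_real c) * fps_nth F (Suc k) =
      (of_nat k + of_real a) * (of_nat k + of_real b) * fps_nth F k" for k
  proof -
    \<comment> \<open>The products are expanded until each is a multiplication by
      \<open>fps_X\<close> or by a constant, whose coefficients are explicit; the case splits below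
      treat the low indices where a shifted coefficient is absent.\<close>
    have "fps_nth (fps_X * fps_deriv (fps_deriv F) - fps_X * (fps_X * fps_deriv (fps_deriv F)) +
       fps_const (of_real c) * fps_deriv F - fps_const (of_real (a + b + 1)) * (fps_X * fps_deriv F) - fps_const (of_real (a * b)) * F) k = fps_nth 0 k"
      by (subst fps[symmetric]) (simp add: algebra_simps)
    then show ?thesis
      by (cases k; cases "k - 1") (simp_all add: algebra_simps)
  qed
  have coeff: "fps_nth F k = of_real (hyp_coeff a b c k)" for k
  proof (induction k)
    case 0
    then show ?case using f0 F by (simp add: hyp_coeff_0 has_fps_expansion_imp_0_eq_fps_nth_0)
  next
    case (Suc k)
    have nz: "(of_nat k + of_real c :: complex) \<noteq> 0"
    proof -
      have "real k + c \<noteq> 0" using pos by linarith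
      then have "complex_of_real (real k + c) \<noteq> 0" unfolding of_real_eq_0_iff .
      then show ?thesis by simp
    qed
    have "of_nat (k + 1) * (of_nat k + of_real c) * fps_nth F (Suc k) =
       complex_of_real ((real k + a) * (real k + b) * hyp_coeff a b c k)"
      unfolding rec Suc by simp
    also have "\<dots> = of_nat (k + 1) * (of_nat k + of_real c) * of_real (hyp_coeff a b c (Suc k))"
      by (subst hyp_coeff_Suc[symmetric]) (simp add: algebra_simps)
    finally show ?case using nz by (simp del: of_nat_Suc of_nat_add)
  qed
  have "((\<lambda>n. (deriv ^^ n) f 0 / fact n * (w - 0) ^ n) sums f w)"
    using holo w by (intro holomorphic_power_series[of f 0 1]) auto
  then have "(\<lambda>n. fps_nth F n * w ^ n) sums f w" by (simp add: F_def fps_expansion_def)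
  then show ?thesis unfolding hyp2F1_reg_series_of_real coeff by (simp add: sums_iff)
qed

text \<open>The chain-rule computation behind the quadratic transformation, with the common factor
  \<open>((1 + r) / 2) powr (- 2 * b)\<close> divided out. Here \<open>r = sqrt (1 - w)\<close>, and
  S, S1, S2 stand for the inner series and its derivatives at
  \<open>\<zeta> = (1 - r) / (1 + r)\<close>. The hypothesis is the hypergeometric equation at
  \<zeta> multiplied by \<open>(1 + r)^2\<close>.\<close>

lemma quadratic_transformation_algebra:
  fixes r b c S S1 S2 :: "'a::field_char_0"
  assumes r: "r \<noteq> 0" "1 + r \<noteq> 0"
    and ode: "2 * r * (1 - r) * S2 + (c * (1 + r)\<^sup>2 - (4 * b - c + 2) * (1 - r) * (1 + r)) * S1
                - 2 * b * (2 * b - c + 1) * (1 + r)\<^sup>2 * S = 0"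
  shows "(1 - r\<^sup>2) * r\<^sup>2 * (b / (r * (1 + r)) * (b / (r * (1 + r)) * S + 1 / (r * (1 + r)\<^sup>2) * S1)
            + (b * (1 + 2 * r) / (2 * r ^ 3 * (1 + r)\<^sup>2) * S + b / (r\<^sup>2 * (1 + r) ^ 3) * S1
               + (1 + 3 * r) / (2 * r ^ 3 * (1 + r) ^ 3) * S1 + 1 / (r\<^sup>2 * (1 + r) ^ 4) * S2))
          + (c - (2 * b + 3 / 2) * (1 - r\<^sup>2)) * (b / (r * (1 + r)) * S + 1 / (r * (1 + r)\<^sup>2) * S1)
          - b * (b + 1 / 2) * S = 0" (is "?L = 0")
proof -
  \<comment> \<open>With the reciprocals as new unknowns the claim is a polynomial identity modulo
    \<open>r * u = 1\<close> and \<open>(1 + r) * v = 1\<close>; doubling it clears the remaining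
    halves.\<close>
  define u v where "u = 1 / r" and "v = 1 / (1 + r)"
  have uv: "r * u = 1" "(1 + r) * v = 1" using r by (auto simp: u_def v_def)
  have "2 * ?L = 2 * ((1 - r\<^sup>2) * r\<^sup>2 * (b * u * v * (b * u * v * S + u * v\<^sup>2 * S1)
            + (b * u ^ 2 * v\<^sup>2 * S + b * u\<^sup>2 * v ^ 3 * S1 + u\<^sup>2 * v ^ 4 * S2))
          + c * (b * u * v * S + u * v\<^sup>2 * S1)
          - b * b * S)
       + (1 - r\<^sup>2) * r\<^sup>2 * (b * u ^ 3 * v\<^sup>2 * S + (1 + 3 * r) * u ^ 3 * v ^ 3 * S1)
       - (4 * b + 3) * (1 - r\<^sup>2) * (b * u * v * S + u * v\<^sup>2 * S1) - b * S"
    unfolding u_def v_def using r by (simp add: power2_eq_square power3_eq_cube divide_simps) (simp add: algebra_simps)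
  also have "\<dots> = 0"
    using ode uv by algebra
  finally show ?thesis by (metis mult_eq_0_iff zero_neq_numeral)
qed

text \<open>The squared norms of \<open>1 + r\<close> and \<open>1 - r\<close> differ by
  \<open>4 * Re r\<close>.\<close>

lemma norm_moebius_less_1:
  fixes r :: complex
  assumes "Re r > 0"
  shows "norm ((1 - r) / (1 + r)) < 1"
proof -
  have "1 + r \<noteq> 0" using assms by (auto simp: complex_eq_iff)
  moreover have "(norm (1 - r))\<^sup>2 < (norm (1 + r))\<^sup>2"
    using assms unfolding cmod_power2 by (simp add: power2_eq_square algebra_simps)
  then have "norm (1 - r) < norm (1 + r)" by (rule power_less_imp_less_base) auto
  ultimately show ?thesis by (simp add: norm_divide)
qed

text \<open>On the cut plane \<open>csqrt (1 - z)\<close> has positive real part, so the argument of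
  the inner series stays in the unit disc and F is holomorphic there. Near 0, F is recognised
  through its differential equation and its value \<open>rGamma c\<close>. The parameter condition
  makes all three parameters of the inner series positive.\<close>

lemma hyp2F1_quadratic_continuation:
  fixes b c :: real
  assumes b: "b > 0" and c: "c > 0" "2 * b - c + 1 > 0"
  defines "F \<equiv> (\<lambda>z. ((1 + csqrt (1 - z)) / 2) powr (- 2 * of_real b) *
    (\<Sum>k. of_real (hyp_coeff (2 * b) (2 * b - c + 1) c k) * ((1 - csqrt (1 - z)) / (1 + csqrt (1 - z))) ^ k))"
  shows "F holomorphic_on hyp_domain"
    and "norm w < 1 \<Longrightarrow> F w = hyp2F1_reg_series (of_real (b + 1 / 2)) (of_real b) (of_real c) w"
proof -
  define t :: "nat \<Rightarrow> complex" where "t = (\<lambda>k. of_real (hyp_coeff (2 * b) (2 * b - c + 1) c k))"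
  define S S1 S2 where "S = (\<lambda>z. \<Sum>k. t k * z ^ k)" and "S1 = (\<lambda>z. \<Sum>k. diffs t k * z ^ k)"
    and "S2 = (\<lambda>z. \<Sum>k. diffs (diffs t) k * z ^ k)"
  note defs = t_def S_def S1_def S2_def
  have S: "(S has_field_derivative S1 w) (at w)" "(S1 has_field_derivative S2 w) (at w)"
    and S_ode: "w * S2 w + of_real c * S1 w =
      w\<^sup>2 * S2 w + of_real (2 * b + (2 * b - c + 1) + 1) * w * S1 w + of_real (2 * b * (2 * b - c + 1)) * S w"
    if "norm w < 1" for w
    using hyp_series_ode[of "2 * b" "2 * b - c + 1" c w] b c that unfolding defs by auto
  define r where "r = (\<lambda>w. csqrt (1 - w))"
  define \<zeta> where "\<zeta> = (\<lambda>w. (1 - r w) / (1 + r w))"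
  define E where "E = (\<lambda>w. exp (- 2 * of_real b * Ln ((1 + r w) / 2)))"
  define f where "f = (\<lambda>w. E w * S (\<zeta> w))"
  \<comment> \<open>\<open>f1\<close> and \<open>f2\<close> are the first two derivatives of f,
    built from \<open>E' = E * b / (r * (1 + r))\<close> and
    \<open>\<zeta>' = 1 / (r * (1 + r)^2)\<close>.\<close>
  define f1 where "f1 = (\<lambda>w. E w * (of_real b / (r w * (1 + r w)) * S (\<zeta> w) + 1 / (r w * (1 + r w)\<^sup>2) * S1 (\<zeta> w)))"
  define f2 where "f2 = (\<lambda>w. E w * (of_real b / (r w * (1 + r w)) * (of_real b / (r w * (1 + r w)) * S (\<zeta> w) + 1 / (r w * (1 + r w)\<^sup>2) * S1 (\<zeta> w))
            + (of_real b * (1 + 2 * r w) / (2 * r w ^ 3 * (1 + r w)\<^sup>2) * S (\<zeta> w) + of_real b / ((r w)\<^sup>2 * (1 + r w) ^ 3) * S1 (\<zeta> w)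
               + (1 + 3 * r w) / (2 * r w ^ 3 * (1 + r w) ^ 3) * S1 (\<zeta> w) + 1 / ((r w)\<^sup>2 * (1 + r w) ^ 4) * S2 (\<zeta> w))))"
  have Re_r: "Re (r w) > 0" if "w \<in> hyp_domain" for w
  proof -
    have "Re (r w) \<noteq> 0"
    proof
      assume "Re (r w) = 0"
      then have "Re ((r w)\<^sup>2) \<le> 0" "Im ((r w)\<^sup>2) = 0" by (auto simp: Re_power2 Im_power2)
      then have "1 - w \<in> \<real>\<^sub>\<le>\<^sub>0" by (simp add: r_def complex_nonpos_Reals_iff)
      with that show False by (simp add: mem_hyp_domain_iff)
    qed
    then show ?thesis using Re_csqrt[of "1 - w"] by (auto simp: r_def)
  qed
  have r0: "r w \<noteq> 0" "1 + r w \<noteq> 0" if "w \<in> hyp_domain" for w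
    using Re_r[OF that] by (auto simp: complex_eq_iff)
  have r_deriv: "(r has_field_derivative - 1 / (2 * r w)) (at w)" if "w \<in> hyp_domain" for w
    unfolding r_def using that
    by (auto intro!: derivative_eq_intros simp: mem_hyp_domain_iff)
  have zeta_norm: "norm (\<zeta> w) < 1" if "w \<in> hyp_domain" for w
    unfolding \<zeta>_def by (rule norm_moebius_less_1[OF Re_r[OF that]])
  have zeta_deriv: "(\<zeta> has_field_derivative 1 / (r w * (1 + r w)\<^sup>2)) (at w)" if "w \<in> hyp_domain" for w
  proof -
    have "(\<zeta> has_field_derivative ((0 - (- 1 / (2 * r w))) * (1 + r w) - (1 - r w) * (0 + (- 1 / (2 * r w)))) / ((1 + r w) * (1 + r w))) (at w)"
      unfolding \<zeta>_def using r_deriv[OF that] r0[OF that] by (intro derivative_intros)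
    also have "((0 - (- 1 / (2 * r w))) * (1 + r w) - (1 - r w) * (0 + (- 1 / (2 * r w)))) / ((1 + r w) * (1 + r w)) = 1 / (r w * (1 + r w)\<^sup>2)"
      using r0[OF that] by (simp add: field_simps power2_eq_square)
    finally show ?thesis .
  qed
  have E_deriv: "(E has_field_derivative E w * (of_real b / (r w * (1 + r w)))) (at w)" if "w \<in> hyp_domain" for w
  proof -
    have "(1 + r w) / 2 \<notin> \<real>\<^sub>\<le>\<^sub>0" using Re_r[OF that] by (auto simp: complex_nonpos_Reals_iff)
    then show ?thesis
      unfolding E_def using r0[OF that]
      by (auto intro!: derivative_eq_intros r_deriv[OF that])
  qed
  have Sz: "((\<lambda>w. S (\<zeta> w)) has_field_derivative S1 (\<zeta> w) * (1 / (r w * (1 + r w)\<^sup>2))) (at w)"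
           "((\<lambda>w. S1 (\<zeta> w)) has_field_derivative S2 (\<zeta> w) * (1 / (r w * (1 + r w)\<^sup>2))) (at w)" if "w \<in> hyp_domain" for w
    using DERIV_chain2[OF S(1)[OF zeta_norm[OF that]] zeta_deriv[OF that]]
      DERIV_chain2[OF S(2)[OF zeta_norm[OF that]] zeta_deriv[OF that]] by auto
  have f_deriv: "(f has_field_derivative f1 w) (at w)" if "w \<in> hyp_domain" for w
    unfolding f_def f1_def
    by (rule derivative_eq_intros E_deriv[OF that] Sz[OF that] refl)+ (simp add: algebra_simps)
  have f1_deriv: "(f1 has_field_derivative f2 w) (at w)" if "w \<in> hyp_domain" for w
  proof -
    \<comment> \<open>Nonvanishing of \<open>4 * (1 + r w)\<close> in distributed form, for clearing
      denominators below.\<close>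
    have r4: "4 + r w * 4 \<noteq> 0"
    proof -
      have "4 + r w * 4 = 4 * (1 + r w)" by (simp add: algebra_simps)
      then show ?thesis using r0(2)[OF that] by (metis mult_eq_0_iff zero_neq_numeral)
    qed
    have c1: "((\<lambda>w. of_real b / (r w * (1 + r w))) has_field_derivative
        of_real b * (1 + 2 * r w) / (2 * r w ^ 3 * (1 + r w)\<^sup>2)) (at w)"
      using r0[OF that] r4
      by (auto intro!: derivative_eq_intros r_deriv[OF that])
         (simp add: divide_simps power2_eq_square power3_eq_cube, simp add: algebra_simps)
    have c2: "((\<lambda>w. 1 / (r w * (1 + r w)\<^sup>2)) has_field_derivative
        (1 + 3 * r w) / (2 * r w ^ 3 * (1 + r w) ^ 3)) (at w)"
      using r0[OF that] r4
      by (auto intro!: derivative_eq_intros r_deriv[OF that])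
         (simp add: divide_simps power2_eq_square power3_eq_cube, simp add: algebra_simps)
    show ?thesis
      unfolding f1_def f2_def
      by (rule DERIV_cong[OF DERIV_mult[OF E_deriv[OF that] DERIV_add[OF DERIV_mult[OF c1 Sz(1)[OF that]]
              DERIV_mult[OF c2 Sz(2)[OF that]]]]])
        (use r0[OF that] in \<open>simp add: divide_simps power2_eq_square power3_eq_cube power4_eq_xxxx, simp add: algebra_simps\<close>)
  qed
  have holo: "f holomorphic_on hyp_domain"
    using f_deriv open_hyp_domain by (auto simp: holomorphic_on_open)
  have sub: "w \<in> hyp_domain" if "norm w < 1" for w using that by (auto simp: hyp_domain_def)
  have deriv1: "deriv f w = f1 w" if "w \<in> hyp_domain" for w using f_deriv[OF that] by (rule DERIV_imp_deriv)
  have deriv2: "deriv (deriv f) w = f2 w" if "w \<in> hyp_domain" for w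
  proof -
    have "eventually (\<lambda>w. deriv f w = f1 w) (nhds w)"
      using eventually_nhds_in_open[OF open_hyp_domain that] by eventually_elim (rule deriv1)
    then have "deriv (deriv f) w = deriv f1 w" by (rule deriv_cong_ev) simp
    then show ?thesis using f1_deriv[OF that] by (simp add: DERIV_imp_deriv)
  qed
  have series: "f w = hyp2F1_reg_series (of_real (b + 1 / 2)) (of_real b) (of_real c) w" if w: "norm w < 1" for w
  proof (rule hyp_ode_fps_unique[OF c(1) _ _ _ w])
    show "f holomorphic_on ball 0 1" using holo by (rule holomorphic_on_subset) (use sub in auto)
    show "f 0 = of_real (rGamma c)"
      by (simp add: f_def E_def \<zeta>_def r_def S_def t_def hyp_coeff_0)
  next
    fix w :: complex assume "norm w < 1"
    then have w: "w \<in> hyp_domain" by (rule sub)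
    have rsq: "(r w)\<^sup>2 = 1 - w" by (simp add: r_def)
    have ode: "2 * r w * (1 - r w) * S2 (\<zeta> w) + (of_real c * (1 + r w)\<^sup>2 - (4 * of_real b - of_real c + 2) * (1 - r w) * (1 + r w)) * S1 (\<zeta> w)
                - 2 * of_real b * (2 * of_real b - of_real c + 1) * (1 + r w)\<^sup>2 * S (\<zeta> w) = 0"
    proof -
      have z1: "\<zeta> w * (1 + r w) = 1 - r w" using r0[OF w] by (simp add: \<zeta>_def)
      have "(\<zeta> w * S2 (\<zeta> w) + of_real c * S1 (\<zeta> w)) * (1 + r w)\<^sup>2 =
        ((\<zeta> w)\<^sup>2 * S2 (\<zeta> w) + of_real (2 * b + (2 * b - c + 1) + 1) * \<zeta> w * S1 (\<zeta> w) + of_real (2 * b * (2 * b - c + 1)) * S (\<zeta> w)) * (1 + r w)\<^sup>2"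
        using S_ode[OF zeta_norm[OF w]] by simp
      then have "(\<zeta> w * S2 (\<zeta> w) + of_real c * S1 (\<zeta> w)) * (1 + r w)\<^sup>2 =
        ((\<zeta> w)\<^sup>2 * S2 (\<zeta> w) + (4 * of_real b - of_real c + 2) * \<zeta> w * S1 (\<zeta> w) + 2 * of_real b * (2 * of_real b - of_real c + 1) * S (\<zeta> w)) * (1 + r w)\<^sup>2"
        by (simp add: algebra_simps)
      with z1 show ?thesis by algebra
    qed
    have "(1 - (r w)\<^sup>2) * (r w)\<^sup>2 * f2 w + (of_real c - (2 * of_real b + 3 / 2) * (1 - (r w)\<^sup>2)) * f1 w - of_real b * (of_real b + 1 / 2) * f w = 0"
    proof -
      have "E w * ((1 - (r w)\<^sup>2) * (r w)\<^sup>2 * (of_real b / (r w * (1 + r w)) * (of_real b / (r w * (1 + r w)) * S (\<zeta> w) + 1 / (r w * (1 + r w)\<^sup>2) * S1 (\<zeta> w))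
            + (of_real b * (1 + 2 * r w) / (2 * r w ^ 3 * (1 + r w)\<^sup>2) * S (\<zeta> w) + of_real b / ((r w)\<^sup>2 * (1 + r w) ^ 3) * S1 (\<zeta> w)
               + (1 + 3 * r w) / (2 * r w ^ 3 * (1 + r w) ^ 3) * S1 (\<zeta> w) + 1 / ((r w)\<^sup>2 * (1 + r w) ^ 4) * S2 (\<zeta> w)))
          + (of_real c - (2 * of_real b + 3 / 2) * (1 - (r w)\<^sup>2)) * (of_real b / (r w * (1 + r w)) * S (\<zeta> w) + 1 / (r w * (1 + r w)\<^sup>2) * S1 (\<zeta> w))
          - of_real b * (of_real b + 1 / 2) * S (\<zeta> w)) = 0"
        unfolding quadratic_transformation_algebra[OF r0[OF w] ode] by simp
      then show ?thesis unfolding f_def f1_def f2_def by (simp only: distrib_left right_diff_distrib mult_ac)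
    qed
    then show "w * (1 - w) * deriv (deriv f) w + (of_real c - of_real (b + 1 / 2 + b + 1) * w) * deriv f w
        - of_real ((b + 1 / 2) * b) * f w = 0"
      unfolding deriv2[OF w] deriv1[OF w]
      unfolding rsq by (simp add: algebra_simps)
  qed
  have F_eq: "F w = f w" if "w \<in> hyp_domain" for w
    unfolding F_def f_def using r0[OF that] by (simp add: E_def S_def t_def \<zeta>_def r_def powr_def)
  show "F holomorphic_on hyp_domain" using holo by (rule holomorphic_transform) (simp add: F_eq)
  show "F w = hyp2F1_reg_series (of_real (b + 1 / 2)) (of_real b) (of_real c) w" if "norm w < 1"
    using series[OF that] F_eq[OF sub[OF that]] by simp
qed

lemma hyp2F1_reg_quadratic:
  fixes b c :: real
  assumes "b > 0" "c > 0" "2 * b - c + 1 > 0" and "z \<in> hyp_domain"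
  shows "hyp2F1_reg (of_real (b + 1 / 2)) (of_real b) (of_real c) z =
    ((1 + csqrt (1 - z)) / 2) powr (- 2 * of_real b) *
    (\<Sum>k. of_real (hyp_coeff (2 * b) (2 * b - c + 1) c k) * ((1 - csqrt (1 - z)) / (1 + csqrt (1 - z))) ^ k)"
  using hyp2F1_reg_eqI[OF hyp2F1_quadratic_continuation[OF assms(1-3)] assms(4)] .

text \<open>Even inside the disc the description \<open>hyp2F1_reg\<close> has a value only through
  a function on the whole cut plane; the quadratic continuation supplies one.\<close>

lemma hyp2F1_reg_eq_series:
  fixes b c :: real
  assumes "b > 0" "c > 0" "2 * b - c + 1 > 0" and z: "norm z < 1"
  shows "hyp2F1_reg (of_real (b + 1 / 2)) (of_real b) (of_real c) z =
           hyp2F1_reg_series (of_real (b + 1 / 2)) (of_real b) (of_real c) z"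
proof -
  have "z \<in> hyp_domain" using z by (auto simp: hyp_domain_def)
  then show ?thesis
    using hyp2F1_reg_eqI[OF hyp2F1_quadratic_continuation[OF assms(1-3)]]
      hyp2F1_quadratic_continuation(2)[OF assms] by simp
qed

subsection \<open>Legendre polynomials and the first solution on the imaginary axis\<close>

abbreviation legendre_deriv :: "nat \<Rightarrow> nat \<Rightarrow> real poly" where
  "legendre_deriv m n \<equiv> (pderiv ^^ m) (legendre_poly n)"

lemma pderiv_funpow_smult: "(pderiv ^^ k) (smult c p) = smult c ((pderiv ^^ k) (p :: real poly))"
  by (induction k) (simp_all add: pderiv_smult)

lemma legendre_deriv_conv_pderiv:
  "legendre_deriv m n = smult (1 / (2 ^ n * fact n)) ((pderiv ^^ (m + n)) ([:-1, 0, 1:] ^ n))"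
  by (simp add: legendre_poly_def pderiv_funpow_smult funpow_add)

text \<open>Repeated differentiation of the first-order equation
  \<open>(x^2 - 1) * D' = 2 * n * x * D\<close> for \<open>D = (x^2 - 1)^n\<close>.\<close>

lemma rodrigues_ode:
  fixes n k :: nat
  defines "D \<equiv> (\<lambda>k. (pderiv ^^ k) ([:-1, 0, 1:] ^ n :: real poly))"
  shows "[:-1, 0, 1:] * D (k + 2) + smult (2 * (real k + 1 - real n)) ([:0, 1:] * D (k + 1))
           + smult ((real k + 1) * (real k - 2 * real n)) (D k) = 0"
proof (induction k)
  case 0
  have D1: "[:-1, 0, 1:] * D 1 = smult (2 * real n) ([:0, 1:] * D 0)"
  proof (cases n)
    case (Suc l)
    have "pderiv ([:-1, 0, 1:] ^ n :: real poly) = smult (real n) ([:-1, 0, 1:] ^ l) * [:0, 2:]"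
      unfolding Suc pderiv_power_Suc by (simp add: pderiv_pCons)
    then have "D 1 = smult (real n) ([:-1, 0, 1:] ^ l) * [:0, 2:]" by (simp add: D_def)
    moreover have "D 0 = [:-1, 0, 1:] * [:-1, 0, 1:] ^ l" by (simp add: D_def Suc)
    ultimately have D01: "D 1 = smult (real n) ([:-1, 0, 1:] ^ l) * [:0, 2:]" "D 0 = [:-1, 0, 1:] * [:-1, 0, 1:] ^ l"
      by auto
    show ?thesis
      unfolding D01 poly_eq_poly_eq_iff[symmetric] fun_eq_iff by (simp add: algebra_simps)
  qed (simp add: D_def)
  have "poly (pderiv ([:-1, 0, 1:] * D 1 - smult (2 * real n) ([:0, 1:] * D 0))) x = 0" for x
    unfolding D1 by simp
  moreover have D2: "pderiv (D 1) = D 2" "pderiv (D 0) = D 1" by (simp_all add: D_def numeral_2_eq_2)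
  ultimately have "poly ([:-1, 0, 1:] * D 2 + smult (2 * (1 - real n)) ([:0, 1:] * D 1)
           + smult (- 2 * real n) (D 0)) x = 0" for x
    unfolding pderiv_mult pderiv_diff pderiv_smult D2 by (simp add: pderiv_pCons algebra_simps)
  then have "[:-1, 0, 1:] * D 2 + smult (2 * (1 - real n)) ([:0, 1:] * D 1)
           + smult (- 2 * real n) (D 0) = 0"
    unfolding poly_eq_poly_eq_iff[symmetric] fun_eq_iff by simp
  then show ?case by (simp add: numeral_2_eq_2)
next
  case (Suc k)
  have "poly (pderiv ([:-1, 0, 1:] * D (k + 2) + smult (2 * (real k + 1 - real n)) ([:0, 1:] * D (k + 1))
           + smult ((real k + 1) * (real k - 2 * real n)) (D k))) x = 0" for x
    unfolding Suc.IH by simp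
  moreover have D': "pderiv (D j) = D (Suc j)" for j by (simp add: D_def)
  ultimately have "poly ([:-1, 0, 1:] * D (Suc k + 2) + smult (2 * (real (Suc k) + 1 - real n)) ([:0, 1:] * D (Suc k + 1))
           + smult ((real (Suc k) + 1) * (real (Suc k) - 2 * real n)) (D (Suc k))) x = 0" for x
    unfolding pderiv_mult pderiv_add pderiv_smult D' by (simp add: pderiv_pCons algebra_simps)
  then show ?case
    unfolding poly_eq_poly_eq_iff[symmetric] fun_eq_iff by simp
qed

text \<open>The case \<open>k = m + n\<close> of the preceding identity; equivalently, the Legendre
  equation differentiated m times.\<close>

lemma legendre_deriv_ode:
  assumes "m \<le> n"
  defines "Y \<equiv> legendre_deriv m n"
  shows "[:-1, 0, 1:] * pderiv (pderiv Y) + smult (2 * (real m + 1)) ([:0, 1:] * pderiv Y)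
           = smult ((real n - real m) * (real n + real m + 1)) Y"
proof -
  define c :: real where "c = 1 / (2 ^ n * fact n)"
  define D :: "real poly" where "D = (pderiv ^^ (m + n)) ([:-1, 0, 1:] ^ n)"
  have Y: "Y = smult c D" unfolding Y_def legendre_deriv_conv_pderiv c_def D_def ..
  have "[:-1, 0, 1:] * pderiv (pderiv D) + smult (2 * (real (m + n) + 1 - real n)) ([:0, 1:] * pderiv D)
      + smult ((real (m + n) + 1) * (real (m + n) - 2 * real n)) D = 0"
    using rodrigues_ode[of "m + n" n] unfolding D_def by simp
  then have "poly (smult c ([:-1, 0, 1:] * pderiv (pderiv D) + smult (2 * (real (m + n) + 1 - real n)) ([:0, 1:] * pderiv D)
      + smult ((real (m + n) + 1) * (real (m + n) - 2 * real n)) D)) x = 0" for x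
    by simp
  then show ?thesis
    unfolding Y pderiv_smult poly_eq_poly_eq_iff[symmetric] fun_eq_iff
    by (simp add: algebra_simps)
qed

lemma coeff_legendre_deriv_rec:
  assumes "m \<le> n"
  shows "(real k + 1) * (real k + 2) * coeff (legendre_deriv m n) (k + 2) =
           (real k - real (n - m)) * (real k + real n + real m + 1) * coeff (legendre_deriv m n) k"
proof -
  define Y where "Y = legendre_deriv m n"
  have "coeff ([:-1, 0, 1:] * pderiv (pderiv Y) + smult (2 * (real m + 1)) ([:0, 1:] * pderiv Y)) k
       = coeff (smult ((real n - real m) * (real n + real m + 1)) Y) k"
    unfolding Y_def legendre_deriv_ode[OF assms] ..
  then show ?thesis
    unfolding Y_def[symmetric] using assms
    by (cases k; cases "k - 1") (simp_all add: coeff_pderiv of_nat_diff algebra_simps)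
qed

lemma coeff_pderiv_funpow:
  "coeff ((pderiv ^^ k) p) j = (fact (j + k) / fact j) * coeff (p :: real poly) (j + k)"
proof (induction k arbitrary: j)
  case (Suc k)
  have "real (Suc j) * (fact (Suc j + k) / fact (Suc j)) = fact (j + Suc k) / fact j"
    unfolding fact_Suc[of j] by (simp del: of_nat_Suc fact_Suc)
  then have "real (Suc j) * (fact (Suc j + k) / fact (Suc j) * coeff p (Suc j + k)) =
      fact (j + Suc k) / fact j * coeff p (j + Suc k)"
    by (metis add_Suc_shift mult.assoc)
  then show ?case
    using Suc[of "Suc j"] by (simp only: funpow.simps o_apply coeff_pderiv)
qed auto

lemma degree_legendre_deriv_le: "degree (legendre_deriv m n) \<le> n - m"
  unfolding legendre_deriv_conv_pderiv
proof (rule degree_le, intro allI impI)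
  fix i assume "i > n - m"
  have "degree ([:-1, 0, 1:] ^ n :: real poly) = 2 * n" by (simp add: degree_power_eq)
  then show "coeff (smult (1 / (2 ^ n * fact n)) ((pderiv ^^ (m + n)) ([:-1, 0, 1:] ^ n))) i = (0::real)"
    using \<open>i > n - m\<close> by (simp add: coeff_pderiv_funpow coeff_eq_0)
qed

lemma coeff_legendre_deriv_top:
  assumes "m \<le> n"
  shows "coeff (legendre_deriv m n) (n - m) = fact (2 * n) / (2 ^ n * fact n * fact (n - m))"
proof -
  have "lead_coeff ([:-1, 0, 1:] ^ n :: real poly) = 1" by (simp add: lead_coeff_power)
  moreover have "degree ([:-1, 0, 1:] ^ n :: real poly) = 2 * n" by (simp add: degree_power_eq)
  ultimately have top: "coeff ([:-1, 0, 1:] ^ n :: real poly) (2 * n) = 1" by simp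
  have eq: "n - m + (m + n) = 2 * n" using assms by simp
  show ?thesis
    unfolding legendre_deriv_conv_pderiv coeff_smult coeff_pderiv_funpow eq top by simp
qed

text \<open>The recurrence links coefficients two apart. Read downwards from the positive leading
  coefficient, each step multiplies by a negative number, since \<open>k - (n - m) < 0\<close>; the
  other parity class starts from the coefficient above the degree, which is zero.\<close>

lemma coeff_legendre_deriv_signs:
  assumes "m \<le> n" "j \<le> n - m"
  shows "(odd j \<longrightarrow> coeff (legendre_deriv m n) (n - m - j) = 0) \<and>
         (even j \<longrightarrow> (-1) ^ (j div 2) * coeff (legendre_deriv m n) (n - m - j) > 0)"
  using assms(2)
proof (induction j rule: less_induct)
  case (less j)
  define a where "a = coeff (legendre_deriv m n)"
  have rec: "(real k + 1) * (real k + 2) * a (k + 2) =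
      (real k - real (n - m)) * (real k + real n + real m + 1) * a k" for k
    unfolding a_def by (rule coeff_legendre_deriv_rec[OF assms(1)])
  consider "j = 0" | "j = 1" | i where "j = i + 2" by (metis add_2_eq_Suc' not0_implies_Suc One_nat_def)
  then show ?case
  proof cases
    case 1
    then show ?thesis using coeff_legendre_deriv_top[OF assms(1)] by simp
  next
    case 2
    have "a (n - m - 1 + 2) = 0"
      unfolding a_def using degree_legendre_deriv_le[of m n] by (intro coeff_eq_0) linarith
    moreover have "real (n - m - 1) + real n + real m + 1 \<noteq> 0" "real (n - m - 1) - real (n - m) \<noteq> 0"
      using less.prems 2 by linarith+
    ultimately have "a (n - m - 1) = 0"
      using rec[of "n - m - 1"] by (metis mult_eq_0_iff)
    then show ?thesis using 2 by (simp add: a_def)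
  next
    case 3
    define k where "k = n - m - j"
    have k2: "n - m - i = k + 2" using less.prems 3 by (simp add: k_def)
    have neg: "real k - real (n - m) < 0" using less.prems 3 by (simp add: k_def)
    have IH: "(odd i \<longrightarrow> a (k + 2) = 0) \<and> (even i \<longrightarrow> (-1) ^ (i div 2) * a (k + 2) > 0)"
      using less.IH[of i] less.prems 3 unfolding k2 a_def by auto
    have pos: "real k + real n + real m + 1 > 0" by simp
    have ak: "a k = - ((real k + 1) * (real k + 2) / ((real (n - m) - real k) * (real k + real n + real m + 1))) * a (k + 2)"
    proof -
      have "a k = (real k - real (n - m)) * (real k + real n + real m + 1) * a k / ((real k - real (n - m)) * (real k + real n + real m + 1))"
        using neg pos by simp
      also have "\<dots> = (real k + 1) * (real k + 2) * a (k + 2) / ((real k - real (n - m)) * (real k + real n + real m + 1))"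
        unfolding rec ..
      also have "(real k - real (n - m)) * (real k + real n + real m + 1) = - ((real (n - m) - real k) * (real k + real n + real m + 1))"
        by (simp add: algebra_simps)
      finally show ?thesis by (simp only: divide_minus_right) simp
    qed
    have cpos: "(real k + 1) * (real k + 2) / ((real (n - m) - real k) * (real k + real n + real m + 1)) > 0"
      using neg pos by (intro divide_pos_pos mult_pos_pos) auto
    then obtain C where C: "C > 0" "a k = - C * a (k + 2)" using ak by blast
    have "(-1) ^ (j div 2) * a k = C * ((-1) ^ (i div 2) * a (k + 2))"
      unfolding C using 3 by simp
    moreover have "C * ((-1) ^ (i div 2) * a (k + 2)) > 0" if "even i"
      by (rule mult_pos_pos[OF C(1)]) (use that IH in blast)
    moreover have "a k = 0" if "odd i" using that IH C by simp
    ultimately show ?thesis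
      unfolding k_def[symmetric] a_def[symmetric] using 3 by auto
  qed
qed

text \<open>Since the nonzero coefficients alternate in sign, taking absolute values amounts to the
  substitution of \<open>\<i> * x\<close> for x, up to the factor \<open>\<i> ^ (n - m)\<close>. The
  result is a real polynomial, positive for x > 0.\<close>

definition legendre_abs :: "nat \<Rightarrow> nat \<Rightarrow> real poly" where
  "legendre_abs m n = map_poly abs (legendre_deriv m n)"

lemma coeff_legendre_abs: "coeff (legendre_abs m n) k = \<bar>coeff (legendre_deriv m n) k\<bar>"
  by (simp add: legendre_abs_def coeff_map_poly)

lemma coeff_legendre_deriv_parity:
  assumes "m \<le> n" "coeff (legendre_deriv m n) k \<noteq> 0"
  obtains i where "n - m = k + 2 * i" "coeff (legendre_deriv m n) k = (-1) ^ i * coeff (legendre_abs m n) k"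
proof -
  have k: "k \<le> n - m" using assms le_degree degree_legendre_deriv_le order_trans by blast
  define j where "j = n - m - k"
  have kj: "k = n - m - j" "j \<le> n - m" using k by (auto simp: j_def)
  from coeff_legendre_deriv_signs[OF assms(1) kj(2)] assms(2) have ev: "even j" by (auto simp: kj(1))
  then obtain i where i: "j = 2 * i" by (elim evenE)
  have pos: "(-1) ^ i * coeff (legendre_deriv m n) k > 0"
    using coeff_legendre_deriv_signs[OF assms(1) kj(2)] ev i kj(1) by simp
  then have "\<bar>coeff (legendre_deriv m n) k\<bar> = (-1) ^ i * coeff (legendre_deriv m n) k"
    by (cases "even i") (auto simp: abs_if)
  then have "coeff (legendre_deriv m n) k = (-1) ^ i * coeff (legendre_abs m n) k"
    by (simp add: coeff_legendre_abs)
  with that[of i] show ?thesis using k i by (simp add: j_def)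
qed

lemma degree_legendre_abs: "degree (legendre_abs m n) \<le> n - m"
  unfolding legendre_abs_def using degree_legendre_deriv_le order_trans map_poly_degree_leq by blast

lemma poly_altdef_le:
  fixes p :: "'a::comm_semiring_1 poly"
  assumes "degree p \<le> N"
  shows "poly p x = (\<Sum>k\<le>N. coeff p k * x ^ k)"
  unfolding poly_altdef using assms
  by (intro sum.mono_neutral_left) (auto simp: coeff_eq_0)

text \<open>For an index k with \<open>n - m = k + 2 * i\<close>, the alternating sign
  \<open>(-1) ^ i\<close> is exactly the quotient of \<open>\<i> ^ (n - m)\<close> by
  \<open>\<i> ^ k\<close>.\<close>

lemma poly_legendre_deriv_imaginary:
  assumes "m \<le> n"
  shows "poly (map_poly of_real (legendre_deriv m n)) (\<i> * of_real s) = \<i> ^ (n - m) * of_real (poly (legendre_abs m n) s)"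
proof -
  have deg: "degree (map_poly complex_of_real (legendre_deriv m n)) \<le> n - m"
    using degree_legendre_deriv_le order_trans map_poly_degree_leq by blast
  have "of_real (coeff (legendre_deriv m n) k) * (\<i> * of_real s) ^ k
       = \<i> ^ (n - m) * (of_real (coeff (legendre_abs m n) k) * of_real s ^ k)" for k
  proof (cases "coeff (legendre_deriv m n) k = 0")
    case False
    then obtain i where i: "n - m = k + 2 * i" "coeff (legendre_deriv m n) k = (-1) ^ i * coeff (legendre_abs m n) k"
      using coeff_legendre_deriv_parity assms by blast
    have "\<i> ^ (n - m) = \<i> ^ k * (-1) ^ i" unfolding i(1) by (simp add: power_add power_mult)
    then show ?thesis unfolding i(2) by (simp add: power_mult_distrib)
  qed (simp add: coeff_legendre_abs)
  then show ?thesis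
    unfolding poly_altdef_le[OF deg] poly_altdef_le[OF degree_legendre_abs]
    by (simp add: coeff_map_poly sum_distrib_left)
qed

lemma poly_legendre_deriv_minus:
  assumes "m \<le> n"
  shows "poly (legendre_deriv m n) (- x) = (-1) ^ (n - m) * poly (legendre_deriv m n) x"
proof -
  have "coeff (legendre_deriv m n) k * (- x) ^ k = (-1) ^ (n - m) * (coeff (legendre_deriv m n) k * x ^ k)" for k
  proof (cases "coeff (legendre_deriv m n) k = 0")
    case False
    then obtain i where i: "n - m = k + 2 * i"
      using coeff_legendre_deriv_parity assms by blast
    have "(- x) ^ k = (-1) ^ (n - m) * x ^ k"
      unfolding i power_add power_mult power_minus[of x] by simp
    then show ?thesis by simp
  qed simp
  then show ?thesis
    unfolding poly_altdef_le[OF degree_legendre_deriv_le] sum_distrib_left by (intro sum.cong refl)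
qed

lemma poly_legendre_abs_minus:
  assumes "m \<le> n"
  shows "poly (legendre_abs m n) (- x) = (-1) ^ (n - m) * poly (legendre_abs m n) x"
proof -
  have "coeff (legendre_abs m n) k * (- x) ^ k = (-1) ^ (n - m) * (coeff (legendre_abs m n) k * x ^ k)" for k
  proof (cases "coeff (legendre_deriv m n) k = 0")
    case False
    then obtain i where i: "n - m = k + 2 * i"
      using coeff_legendre_deriv_parity assms by blast
    have "(- x) ^ k = (-1) ^ (n - m) * x ^ k"
      unfolding i power_add power_mult power_minus[of x] by simp
    then show ?thesis by simp
  qed (simp add: coeff_legendre_abs)
  then show ?thesis
    unfolding poly_altdef_le[OF degree_legendre_abs] sum_distrib_left by (intro sum.cong refl)
qed

lemma coeff_legendre_abs_top:
  assumes "m \<le> n"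
  shows "coeff (legendre_abs m n) (n - m) = fact (2 * n) / (2 ^ n * fact n * fact (n - m))"
  using coeff_legendre_deriv_top[OF assms] by (simp add: coeff_legendre_abs)

text \<open>The leading coefficient is positive and no other is negative. This is what later permits
  division by the regular solution.\<close>

lemma poly_legendre_abs_pos:
  assumes "m \<le> n" "x > 0"
  shows "poly (legendre_abs m n) x > 0"
proof -
  have "0 < coeff (legendre_abs m n) (n - m) * x ^ (n - m)"
    using coeff_legendre_abs_top[OF assms(1)] assms(2) by simp
  also have "\<dots> \<le> (\<Sum>k\<le>n - m. coeff (legendre_abs m n) k * x ^ k)"
    using assms(2) by (intro member_le_sum) (auto simp: coeff_legendre_abs)
  finally show ?thesis unfolding poly_altdef_le[OF degree_legendre_abs] .
qed

lemma coeff_legendre_abs_rec: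
  assumes "m \<le> n"
  shows "(real k + 1) * (real k + 2) * coeff (legendre_abs m n) (k + 2) =
           (real (n - m) - real k) * (real k + real n + real m + 1) * coeff (legendre_abs m n) k"
proof (cases "k \<le> n - m")
  case True
  have "\<bar>(real k + 1) * (real k + 2) * coeff (legendre_deriv m n) (k + 2)\<bar> =
           \<bar>(real k - real (n - m)) * (real k + real n + real m + 1) * coeff (legendre_deriv m n) k\<bar>"
    unfolding coeff_legendre_deriv_rec[OF assms] ..
  then show ?thesis using True unfolding abs_mult coeff_legendre_abs by simp
next
  case False
  then have "coeff (legendre_abs m n) k = 0" "coeff (legendre_abs m n) (k + 2) = 0"
    using degree_legendre_abs[of m n] by (auto intro!: coeff_eq_0)
  then show ?thesis by simp
qed

text \<open>Under the substitution of \<open>\<i> * x\<close> for x the equation keeps its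
  eigenvalue, while \<open>x^2 - 1\<close> turns into \<open>x^2 + 1\<close>.\<close>

lemma legendre_abs_ode:
  assumes "m \<le> n"
  defines "y \<equiv> legendre_abs m n"
  shows "[:1, 0, 1:] * pderiv (pderiv y) + smult (2 * (real m + 1)) ([:0, 1:] * pderiv y)
           = smult ((real n - real m) * (real n + real m + 1)) y"
proof (rule poly_eqI)
  fix k
  show "coeff ([:1, 0, 1:] * pderiv (pderiv y) + smult (2 * (real m + 1)) ([:0, 1:] * pderiv y)) k
     = coeff (smult ((real n - real m) * (real n + real m + 1)) y) k"
    using coeff_legendre_abs_rec[OF assms(1), of k, folded y_def] assms(1)
    by (cases k; cases "k - 1") (simp_all add: coeff_pderiv of_nat_diff algebra_simps)
qed

text \<open>Expansion at 1 in the variable \<open>w = (1 - x) / 2\<close> of the hypergeometric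
  form. Both sides obey the same first-order recurrence, and they are matched at the top index,
  where the coefficient is already known from the leading term; the induction runs downwards because
  \<open>k - (n - m)\<close> is nonzero below the top.\<close>

lemma legendre_deriv_shifted_coeff:
  assumes "m \<le> n" "k \<le> n - m"
  shows "coeff (pcompose (legendre_deriv m n) [:1, -2:]) k =
           (-1 / 2) ^ m * (pochhammer (real n + 1) (k + m) * pochhammer (- real n) (k + m) / (fact k * fact (k + m)))"
proof -
  define Y where "Y = legendre_deriv m n"
  define h where "h = pcompose Y [:1, -2:]"
  define G where "G = (\<lambda>k. pochhammer (real n + 1) (k + m) * pochhammer (- real n) (k + m) / (fact k * fact (k + m)))"
  have rec_h: "(real k + 1) * (real k + real m + 1) * coeff h (Suc k) =
      (real k - real (n - m)) * (real k + real n + real m + 1) * coeff h k" for k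
  proof -
    have h': "pderiv h = smult (-2) (pcompose (pderiv Y) [:1, -2:])"
      unfolding h_def pderiv_pcompose by (simp add: pderiv_pCons)
    have h'': "pderiv (pderiv h) = smult 4 (pcompose (pderiv (pderiv Y)) [:1, -2:])"
      unfolding h' pderiv_smult pderiv_pcompose by (simp add: pderiv_pCons)
    have "poly ([:0, 1, -1:] * pderiv (pderiv h) + smult (real m + 1) ([:1, -2:] * pderiv h)
             + smult ((real n - real m) * (real n + real m + 1)) h) x = 0" for x
    proof -
      have "poly ([:-1, 0, 1:] * pderiv (pderiv Y) + smult (2 * (real m + 1)) ([:0, 1:] * pderiv Y)) (1 - 2 * x)
         = poly (smult ((real n - real m) * (real n + real m + 1)) Y) (1 - 2 * x)"
        unfolding Y_def legendre_deriv_ode[OF assms(1)] ..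
      then show ?thesis
        unfolding h'' unfolding h' unfolding h_def by (simp add: poly_pcompose algebra_simps)
    qed
    then have "[:0, 1, -1:] * pderiv (pderiv h) + smult (real m + 1) ([:1, -2:] * pderiv h)
             + smult ((real n - real m) * (real n + real m + 1)) h = 0"
      unfolding poly_eq_poly_eq_iff[symmetric] fun_eq_iff by simp
    then have "coeff ([:0, 1, -1:] * pderiv (pderiv h) + smult (real m + 1) ([:1, -2:] * pderiv h)
             + smult ((real n - real m) * (real n + real m + 1)) h) k = 0"
      by simp
    then show ?thesis using assms(1)
      by (cases k; cases "k - 1") (simp_all add: coeff_pderiv of_nat_diff algebra_simps)
  qed
  have rec_G: "(real k + 1) * (real k + real m + 1) * G (Suc k) =
      (real k - real (n - m)) * (real k + real n + real m + 1) * G k" for k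
  proof -
    define A B where "A = pochhammer (real n + 1) (k + m)" and "B = pochhammer (- real n) (k + m)"
    have G1: "G (Suc k) = A * (real n + 1 + real (k + m)) * (B * (- real n + real (k + m))) / ((real k + 1) * fact k * ((real k + real m + 1) * fact (k + m)))"
      unfolding G_def A_def B_def by (simp add: pochhammer_Suc algebra_simps)
    have G0: "G k = A * B / (fact k * fact (k + m))" unfolding G_def A_def B_def ..
    have nz: "real k + 1 \<noteq> 0" "real k + real m + 1 \<noteq> 0" by linarith+
    show ?thesis
      unfolding G0 G1 using assms(1) nz by (simp add: divide_simps of_nat_diff) (simp add: algebra_simps)
  qed
  have top: "coeff h (n - m) = (-1 / 2) ^ m * G (n - m)"
  proof -
    have p1: "pochhammer (- real n) n = (-1) ^ n * fact n"
      using pochhammer_minus[of "real n" n] by (simp add: pochhammer_fact)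
    have "pochhammer 1 (n + n) = pochhammer 1 n * pochhammer (1 + real n) n"
      by (rule pochhammer_product')
    then have p2: "pochhammer (real n + 1) n = fact (2 * n) / fact n"
      unfolding pochhammer_fact[symmetric] by (simp add: mult_2 add_ac)
    have G: "G (n - m) = (-1) ^ n * fact (2 * n) / (fact (n - m) * fact n)"
      unfolding G_def using assms(1) p1 p2 by simp
    have "degree Y = n - m"
    proof (rule antisym)
      show "degree Y \<le> n - m" unfolding Y_def by (rule degree_legendre_deriv_le)
      show "n - m \<le> degree Y"
        unfolding Y_def using coeff_legendre_deriv_top[OF assms(1)] by (intro le_degree) simp
    qed
    then have "coeff h (n - m) = coeff Y (n - m) * (-2) ^ (n - m)"
      using lead_coeff_comp[of "[:1, -2:]" Y] degree_pcompose[of Y "[:1, -2:]"] unfolding h_def by simp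
    also have "\<dots> = fact (2 * n) / (2 ^ n * fact n * fact (n - m)) * (-2) ^ (n - m)"
      unfolding Y_def coeff_legendre_deriv_top[OF assms(1)] ..
    also have "(-2 :: real) ^ (n - m) = (-1) ^ n * 2 ^ n * (-1 / 2) ^ m"
    proof -
      have "(-2 :: real) ^ n = (-2) ^ (n - m) * (-2) ^ m" using assms(1) by (simp flip: power_add)
      moreover have "(-2 :: real) ^ m * (-1 / 2) ^ m = 1" by (simp flip: power_mult_distrib)
      moreover have "(-2 :: real) ^ n = (-1) ^ n * 2 ^ n" by (simp flip: power_mult_distrib)
      ultimately show ?thesis by (metis mult.assoc mult.right_neutral)
    qed
    finally show ?thesis unfolding G by (simp add: mult_ac)
  qed
  have "coeff h k = (-1 / 2) ^ m * G k" using assms(2)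
  proof (induction rule: inc_induct)
    case base
    show ?case by (rule top)
  next
    case (step k)
    have nz: "(real k - real (n - m)) * (real k + real n + real m + 1) \<noteq> 0"
      using step.hyps by simp
    have "(real k - real (n - m)) * (real k + real n + real m + 1) * coeff h k =
        (real k - real (n - m)) * (real k + real n + real m + 1) * ((-1 / 2) ^ m * G k)"
      unfolding rec_h[symmetric] step.IH
      using arg_cong[OF rec_G[of k], of "\<lambda>x. (-1 / 2) ^ m * x"] by (simp only: mult_ac)
    with nz show ?case by (simp only: mult_cancel_left) blast
  qed
  then show ?thesis unfolding h_def Y_def G_def .
qed

text \<open>The series is finite at both ends: \<open>rGamma (1 - m + k)\<close> vanishes for k < m
  and the Pochhammer symbol of \<open>- n\<close> vanishes for k > n. Shifting the index by m gives
  the expansion just found, and the resulting polynomial is its own continuation.\<close>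

lemma hyp2F1_reg_series_legendre:
  assumes "m \<le> n"
  shows "hyp2F1_reg_series (of_nat n + 1) (- of_nat n) (1 - of_nat m) w =
           (- 2 * w) ^ m * poly (map_poly of_real (legendre_deriv m n)) (1 - 2 * w)"
proof -
  define h where "h = pcompose (legendre_deriv m n) [:1, -2:]"
  define T :: "nat \<Rightarrow> complex" where "T = (\<lambda>k. pochhammer (of_nat n + 1) k * pochhammer (- of_nat n) k *
     rGamma (1 - of_nat m + of_nat k) / fact k * w ^ k)"
  have T_high: "T k = 0" if "k > n" for k
    using that by (simp add: T_def pochhammer_of_nat_eq_0_iff)
  have T_low: "T k = 0" if "k < m" for k
  proof -
    have "(1 - of_nat m + of_nat k :: complex) = - of_nat (m - Suc k)"
      using that by (simp add: of_nat_diff)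
    then have "rGamma (1 - of_nat m + of_nat k :: complex) = 0"
      by (simp add: rGamma_eq_zero_iff)
    then show ?thesis by (simp add: T_def)
  qed
  have T_mid: "T (k + m) = (-2 * w) ^ m * (of_real (coeff h k) * w ^ k)" if "k \<le> n - m" for k
  proof -
    have rG: "rGamma (1 - of_nat m + of_nat (k + m) :: complex) = 1 / fact k"
      by (simp add: rGamma_inverse_Gamma Gamma_fact inverse_eq_divide)
    have "complex_of_real (coeff h k) = (-1 / 2) ^ m *
       (pochhammer (of_nat n + 1) (k + m) * pochhammer (- of_nat n) (k + m) / (fact k * fact (k + m)))"
      unfolding h_def legendre_deriv_shifted_coeff[OF assms that]
      by (simp flip: pochhammer_of_real)
    moreover have "(-2 * w) ^ m * (-1 / 2) ^ m = w ^ m" by (simp flip: power_mult_distrib)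
    ultimately have "(-2 * w) ^ m * (of_real (coeff h k) * w ^ k) = w ^ m *
       (pochhammer (of_nat n + 1) (k + m) * pochhammer (- of_nat n) (k + m) / (fact k * fact (k + m))) * w ^ k"
      by (metis mult.assoc)
    then show ?thesis unfolding T_def rG by (simp add: power_add mult_ac)
  qed
  have "hyp2F1_reg_series (of_nat n + 1) (- of_nat n) (1 - of_nat m) w = (\<Sum>k. T k)"
    unfolding hyp2F1_reg_series_def T_def ..
  also have "\<dots> = (\<Sum>k\<in>{m..n}. T k)"
    by (rule suminf_finite) (use T_low T_high in \<open>auto simp: not_le\<close>)
  also have "\<dots> = (\<Sum>k\<in>{0..n - m}. T (k + m))"
    using sum.shift_bounds_cl_nat_ivl[of T 0 m "n - m"] assms by simp
  also have "\<dots> = (-2 * w) ^ m * (\<Sum>k\<le>n - m. of_real (coeff h k) * w ^ k)"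
    using T_mid by (simp add: sum_distrib_left atLeast0AtMost)
  also have "(\<Sum>k\<le>n - m. of_real (coeff h k) * w ^ k) = poly (map_poly of_real h) w"
  proof -
    have "degree (map_poly complex_of_real h) \<le> degree h" by (rule map_poly_degree_leq)
    also have "\<dots> \<le> n - m" using degree_legendre_deriv_le by (simp add: h_def degree_pcompose)
    finally show ?thesis by (simp add: poly_altdef_le coeff_map_poly)
  qed
  also have "\<dots> = poly (map_poly of_real (legendre_deriv m n)) (1 - 2 * w)"
  proof -
    have "poly (map_poly complex_of_real (pcompose p [:1, -2:])) w = poly (map_poly of_real p) (1 - 2 * w)" for p
    proof (induction p)
      case (pCons c p)
      have add: "map_poly complex_of_real (p + q) = map_poly of_real p + map_poly of_real q"
        and smult: "map_poly complex_of_real (smult a p) = smult (of_real a) (map_poly of_real p)"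
        and minus: "map_poly complex_of_real (- p) = - map_poly of_real p" for p q a
        by (rule poly_eqI, simp add: coeff_map_poly)+
      have "pcompose (pCons c p) [:1, -2:] = [:c:] + (pcompose p [:1, -2:] + pCons 0 (smult (-2) (pcompose p [:1, -2:])))"
        by (simp add: pcompose_pCons)
      then show ?case
        using pCons.IH by (simp add: add smult minus map_poly_pCons algebra_simps)
    qed simp
    then show ?thesis unfolding h_def .
  qed
  finally show ?thesis by simp
qed

text \<open>Only the branch of the power needs care. The principal root of
  \<open>(z + 1) / (z - 1)\<close> is \<open>(sinh s - \<i>) / cosh s\<close>, and its product with
  \<open>z - 1\<close> is \<open>\<i> * cosh s\<close>, so the m-th powers combine without
  ambiguity.\<close>

lemma legendreP_imaginary:
  assumes "m \<le> n" "s > 0"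
  shows "legendreP (of_nat m) (of_nat n) (\<i> * of_real (sinh s)) =
           \<i> ^ n * of_real (cosh s ^ m * poly (legendre_abs m n) (sinh s))"
proof -
  define z where "z = \<i> * complex_of_real (sinh s)"
  define C S where "C = complex_of_real (cosh s)" and "S = complex_of_real (sinh s)"
  have CS: "C\<^sup>2 = 1 + S\<^sup>2"
    unfolding C_def S_def using cosh_square_eq[of s] by (metis of_real_add of_real_power of_real_1 add.commute)
  have C0: "C \<noteq> 0" by (simp add: C_def)
  have z1: "z - 1 \<noteq> 0" by (auto simp: z_def complex_eq_iff)
  have mem: "(1 - z) / 2 \<in> hyp_domain"
    by (auto simp: mem_hyp_domain_iff complex_nonpos_Reals_iff z_def)
  have "hyp2F1_reg (of_nat n + 1) (- of_nat n) (1 - of_nat m) ((1 - z) / 2) =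
      (- 2 * ((1 - z) / 2)) ^ m * poly (map_poly of_real (legendre_deriv m n)) (1 - 2 * ((1 - z) / 2))"
    by (rule hyp2F1_reg_eqI[where f = "\<lambda>w. (- 2 * w) ^ m * poly (map_poly of_real (legendre_deriv m n)) (1 - 2 * w)"])
       (use mem hyp2F1_reg_series_legendre[OF assms(1)] in \<open>auto intro!: holomorphic_intros\<close>)
  also have "- 2 * ((1 - z) / 2) = z - 1" by (simp add: field_simps)
  also have "1 - 2 * ((1 - z) / 2) = z" by (simp add: field_simps)
  also have "(z - 1) ^ m * poly (map_poly of_real (legendre_deriv m n)) z =
      (z - 1) ^ m * (\<i> ^ (n - m) * of_real (poly (legendre_abs m n) (sinh s)))"
    unfolding poly_legendre_deriv_imaginary[OF assms(1), symmetric] z_def ..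
  finally have hyp: "hyp2F1_reg (of_nat n + 1) (- of_nat n) (1 - of_nat m) ((1 - z) / 2) =
      (z - 1) ^ m * (\<i> ^ (n - m) * of_real (poly (legendre_abs m n) (sinh s)))" .
  define \<beta> where "\<beta> = (S - \<i>) / C"
  have "\<beta>\<^sup>2 = (z + 1) / (z - 1)"
  proof -
    have "(S - \<i>)\<^sup>2 * (z - 1) = (z + 1) * C\<^sup>2"
      unfolding CS z_def S_def[symmetric] by (simp add: power2_eq_square algebra_simps)
    then show ?thesis using z1 C0 by (simp add: \<beta>_def power_divide frac_eq_eq)
  qed
  \<comment> \<open>Positivity of the real part selects the principal root; this is where
    \<open>s > 0\<close> enters.\<close>
  moreover have "Re \<beta> > 0"
  proof -
    have "\<beta> = Complex (sinh s / cosh s) (- 1 / cosh s)"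
      by (simp add: \<beta>_def S_def C_def complex_eq_iff)
    then show ?thesis using assms(2) by simp
  qed
  ultimately have csq: "csqrt ((z + 1) / (z - 1)) = \<beta>" by (metis csqrt_unique)
  have \<beta>0: "(z + 1) / (z - 1) \<noteq> 0" using \<open>\<beta>\<^sup>2 = _\<close> \<open>Re \<beta> > 0\<close> by (metis less_irrefl power_zero_numeral power2_eq_iff zero_complex.simps(1) zero_eq_power2)
  have "((z + 1) / (z - 1)) powr (of_nat m / 2) = csqrt ((z + 1) / (z - 1)) ^ m"
    using \<beta>0 by (simp add: csqrt_exp_Ln powr_def flip: exp_of_nat_mult)
  also have "\<dots> = \<beta> ^ m" by (simp only: csq)
  finally have "legendreP (of_nat m) (of_nat n) z = (\<beta> * (z - 1)) ^ m * (\<i> ^ (n - m) * of_real (poly (legendre_abs m n) (sinh s)))"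
    unfolding legendreP_def hyp by (simp add: power_mult_distrib mult_ac)
  also have "\<beta> * (z - 1) = \<i> * C"
  proof -
    have "(S - \<i>) * (z - 1) = \<i> * C\<^sup>2"
      unfolding CS z_def S_def[symmetric] by (simp add: power2_eq_square algebra_simps)
    then show ?thesis using C0 by (simp add: \<beta>_def field_simps power2_eq_square)
  qed
  also have "(\<i> * C) ^ m * (\<i> ^ (n - m) * of_real (poly (legendre_abs m n) (sinh s))) =
     (\<i> ^ m * \<i> ^ (n - m)) * of_real (cosh s ^ m * poly (legendre_abs m n) (sinh s))"
    by (simp add: C_def power_mult_distrib)
  also have "\<i> ^ m * \<i> ^ (n - m) = \<i> ^ n" using assms(1) by (simp flip: power_add)
  finally show ?thesis unfolding z_def .
qed

subsection \<open>The second solution on the imaginary axis\<close>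

lemma csqrt_powr: "z \<noteq> 0 \<Longrightarrow> z powr (of_nat m / 2) = csqrt z ^ m"
  by (simp add: csqrt_exp_Ln powr_def flip: exp_of_nat_mult)

text \<open>The second solution at \<open>\<i> * sinh s\<close> after the quadratic transformation,
  whose variable becomes \<open>- exp (- 2 * s)\<close>, without its elementary constants and the
  factor \<open>cosh s ^ m\<close>.\<close>

definition oblateQ :: "nat \<Rightarrow> nat \<Rightarrow> real \<Rightarrow> real" where
  "oblateQ m n s = exp (- (real n + real m + 1) * s) *
     (\<Sum>k. hyp_coeff (real n + real m + 1) (real m + 1 / 2) (real n + 3 / 2) k * (- exp (- 2 * s)) ^ k)"

text \<open>The argument \<open>1 / z^2 = - 1 / (sinh s)^2\<close> leaves the unit disc for small s,
  so the defining series does not suffice. The quadratic transformation applies for all s > 0, with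
  \<open>csqrt (1 - 1 / z^2) = cosh s / sinh s\<close>. The power of \<i> on the left is the one
  that makes the value real.\<close>

lemma legendreQ_imaginary:
  assumes "m \<le> n" "s > 0"
  shows "\<i> ^ (n + 1) * legendreQ (of_nat m) (of_nat n) (\<i> * of_real (sinh s)) =
           of_real ((-1) ^ m * sqrt pi * fact (n + m) * 2 ^ m * (cosh s ^ m * oblateQ m n s))"
proof -
  define z where "z = \<i> * complex_of_real (sinh s)"
  \<comment> \<open>N / 2 plays the part of the parameter b in the quadratic transformation, so that
    \<open>2 * b = N\<close> and \<open>2 * b - c + 1 = m + 1/2\<close>.\<close>
  define N where "N = n + m + 1"
  have sh: "sinh s > 0" using assms by simp
  have z2: "z\<^sup>2 = - of_real ((sinh s)\<^sup>2)" by (simp add: z_def power_mult_distrib)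
  have z0: "z \<noteq> 0" using sh by (simp add: z_def)
  have w: "1 / z\<^sup>2 = of_real (- 1 / (sinh s)\<^sup>2)" unfolding z2 by simp
  have one_w: "1 - 1 / z\<^sup>2 = of_real ((cosh s / sinh s)\<^sup>2)"
  proof -
    have "1 + 1 / (sinh s)\<^sup>2 = (cosh s / sinh s)\<^sup>2"
      using sh cosh_square_eq[of s] by (simp add: field_simps)
    moreover have "1 - 1 / z\<^sup>2 = of_real (1 + 1 / (sinh s)\<^sup>2)" unfolding w by simp
    ultimately show ?thesis by simp
  qed
  have mem: "1 / z\<^sup>2 \<in> hyp_domain"
    unfolding mem_hyp_domain_iff one_w using sh by (simp add: complex_nonpos_Reals_iff del: of_real_power of_real_divide)
  have r: "csqrt (1 - 1 / z\<^sup>2) = of_real (cosh s / sinh s)"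
    unfolding one_w using sh by (subst csqrt_of_real_nonneg) auto
  have e: "sinh s + cosh s = exp s" "cosh s - sinh s = exp (- s)"
    by (simp_all add: sinh_plus_cosh cosh_minus_sinh)
  have "(1 + complex_of_real (cosh s / sinh s)) / 2 = of_real ((sinh s + cosh s) / (2 * sinh s))"
    using sh by (simp add: field_simps)
  then have half: "(1 + csqrt (1 - 1 / z\<^sup>2)) / 2 = of_real (exp s / (2 * sinh s))" unfolding r e .
  have zeta: "(1 - csqrt (1 - 1 / z\<^sup>2)) / (1 + csqrt (1 - 1 / z\<^sup>2)) = of_real (- exp (- 2 * s))"
  proof -
    have "(1 - cosh s / sinh s) / (1 + cosh s / sinh s) = - ((cosh s - sinh s) / (sinh s + cosh s))"
      using sh by (simp add: divide_simps)
    also have "\<dots> = - exp (- 2 * s)" unfolding e by (simp flip: exp_diff)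
    finally have "complex_of_real ((1 - cosh s / sinh s) / (1 + cosh s / sinh s)) = of_real (- exp (- 2 * s))"
      by (rule arg_cong)
    then show ?thesis unfolding r by (simp only: of_real_diff of_real_add of_real_divide of_real_1)
  qed
  have "hyp2F1_reg ((of_nat n + of_nat m) / 2 + 1) ((of_nat n + of_nat m + 1) / 2) (of_nat n + 3 / 2) (1 / z\<^sup>2) =
      hyp2F1_reg (of_real (real N / 2 + 1 / 2)) (of_real (real N / 2)) (of_real (real n + 3 / 2)) (1 / z\<^sup>2)"
    by (simp add: N_def field_simps)
  also have "\<dots> = (of_real (exp s / (2 * sinh s))) powr (- of_nat N) *
     (\<Sum>k. of_real (hyp_coeff (real N) (real m + 1 / 2) (real n + 3 / 2) k) * (of_real (- exp (- 2 * s))) ^ k)"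
  proof -
    have eq: "2 * (real N / 2) = real N" "real N - (real n + 3 / 2) + 1 = real m + 1 / 2"
        "- 2 * complex_of_real (real N / 2) = - of_nat N"
      by (simp_all add: N_def)
    have "real N / 2 > 0" "real n + 3 / 2 > 0" "2 * (real N / 2) - (real n + 3 / 2) + 1 > 0"
      unfolding eq by (simp_all add: N_def)
    from hyp2F1_reg_quadratic[OF this mem] show ?thesis unfolding half zeta eq .
  qed
  also have "(complex_of_real (exp s / (2 * sinh s))) powr (- of_nat N) = of_real ((2 * sinh s * exp (- s)) ^ N)"
    using sh by (simp add: powr_minus powr_nat' exp_minus field_simps)
  also have "(\<Sum>k. complex_of_real (hyp_coeff (real N) (real m + 1 / 2) (real n + 3 / 2) k) * (of_real (- exp (- 2 * s))) ^ k) =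
     of_real (\<Sum>k. hyp_coeff (real N) (real m + 1 / 2) (real n + 3 / 2) k * (- exp (- 2 * s)) ^ k)"
    (is "_ = of_real ?S")
  proof -
    have "summable (\<lambda>k. hyp_coeff (real N) (real m + 1 / 2) (real n + 3 / 2) k * (- exp (- 2 * s)) ^ k)"
      using summable_hyp_coeff[of "real N" "real m + 1 / 2" "real n + 3 / 2" "- exp (- 2 * s)"] assms by (simp add: N_def)
    from suminf_of_real[OF this, where 'a = complex] show ?thesis by simp
  qed
  finally have hyp: "hyp2F1_reg ((of_nat n + of_nat m) / 2 + 1) ((of_nat n + of_nat m + 1) / 2) (of_nat n + 3 / 2) (1 / z\<^sup>2) =
     of_real ((2 * sinh s * exp (- s)) ^ N * ?S)" by simp
  have pw1: "(z\<^sup>2 - 1) powr (of_nat m / 2) = (\<i> * of_real (cosh s)) ^ m"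
  proof -
    have zc: "z\<^sup>2 - 1 = of_real (- ((cosh s)\<^sup>2))" unfolding z2 cosh_square_eq by simp
    then have "z\<^sup>2 - 1 \<noteq> 0" by simp
    moreover have "csqrt (z\<^sup>2 - 1) = \<i> * of_real (cosh s)"
      unfolding zc by (subst csqrt_of_real_nonpos) auto
    ultimately show ?thesis by (simp add: csqrt_powr)
  qed
  have pw2: "z powr (of_nat n + of_nat m + 1) = z ^ N"
    using z0 powr_nat'[of z N] by (simp add: N_def add_ac)
  have pw3: "(2::complex) powr (of_nat n + 1) = 2 ^ (n + 1)"
    using powr_nat'[of "2::complex" "n + 1"] by (simp add: add_ac)
  have G: "Gamma (of_nat n + of_nat m + 1 :: complex) = fact (n + m)"
    using Gamma_fact[of "n + m", where 'a = complex] by (simp add: add_ac)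
  have ex: "exp (of_nat m * of_real pi * \<i>) = (-1) ^ m"
    using exp_of_nat_mult[of m "of_real pi * \<i>"] by (simp add: mult_ac)
  have "\<i> ^ (n + 1) * legendreQ (of_nat m) (of_nat n) z = \<i> ^ (n + 1) * ((-1) ^ m * of_real (sqrt pi) * fact (n + m)
      * (\<i> * of_real (cosh s)) ^ m / (2 ^ (n + 1) * z ^ N) * of_real ((2 * sinh s * exp (- s)) ^ N * ?S))"
    unfolding legendreQ_def hyp pw1 pw2 pw3 G ex ..
  also have "\<dots> = (\<i> ^ (n + 1) * \<i> ^ m / \<i> ^ N) *
     of_real ((-1) ^ m * sqrt pi * fact (n + m) * (2 ^ N / 2 ^ (n + 1)) * (cosh s ^ m * (exp (- s) ^ N * ?S)))"
    using sh by (simp add: z_def power_mult_distrib mult_ac)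
  also have "\<i> ^ (n + 1) * \<i> ^ m / \<i> ^ N = 1" by (simp add: N_def power_add)
  also have "(2 :: real) ^ N / 2 ^ (n + 1) = 2 ^ m" by (simp add: N_def power_add)
  also have "exp (- s) ^ N * ?S = oblateQ m n s"
  proof -
    have "exp (- s) ^ N = exp (- (real n + real m + 1) * s)"
      unfolding exp_of_nat_mult[symmetric] by (simp add: N_def algebra_simps)
    then show ?thesis unfolding oblateQ_def by (simp add: N_def add_ac)
  qed
  finally show ?thesis unfolding z_def by simp
qed

text \<open>The hypergeometric equation in the variable \<open>- exp (- 2 * s)\<close>, brought to
  the form in which the first-order term can be removed by a power of cosh. The two limits record
  the leading decay, from which the Wronskian is computed.\<close>

lemma oblateQ_ode:
  obtains g1 g2 where
    "\<And>s. s > 0 \<Longrightarrow> (oblateQ m n has_real_derivative g1 s) (at s)"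
    "\<And>s. s > 0 \<Longrightarrow> (g1 has_real_derivative g2 s) (at s)"
    "\<And>s. s > 0 \<Longrightarrow> g2 s + 2 * (real m + 1 / 2) * tanh s * g1 s + (real m + 1 / 2)\<^sup>2 * oblateQ m n s
        = (real n + 1 / 2)\<^sup>2 * oblateQ m n s"
    "((\<lambda>s. exp ((real n + real m + 1) * s) * oblateQ m n s) \<longlongrightarrow> rGamma (real n + 3 / 2)) at_top"
    "((\<lambda>s. exp ((real n + real m + 1) * s) * g1 s) \<longlongrightarrow> - (real n + real m + 1) * rGamma (real n + 3 / 2)) at_top"
proof -
  define \<alpha> \<beta> c where "\<alpha> = real n + real m + 1" and "\<beta> = real m + 1 / 2" and "c = real n + 3 / 2"
  define t where "t = hyp_coeff \<alpha> \<beta> c"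
  define S S1 S2 where "S = (\<lambda>z::real. \<Sum>k. t k * z ^ k)" and "S1 = (\<lambda>z. \<Sum>k. diffs t k * z ^ k)"
    and "S2 = (\<lambda>z. \<Sum>k. diffs (diffs t) k * z ^ k)"
  note defs = t_def S_def S1_def S2_def
  have S: "(S has_real_derivative S1 w) (at w)" "(S1 has_real_derivative S2 w) (at w)"
    and S_ode: "w * S2 w + c * S1 w = w\<^sup>2 * S2 w + (\<alpha> + \<beta> + 1) * w * S1 w + \<alpha> * \<beta> * S w"
    if "norm w < 1" for w
    using hyp_series_ode[of \<alpha> \<beta> c w] that unfolding defs by (auto simp: \<alpha>_def \<beta>_def c_def)
  define E where "E = (\<lambda>s::real. - exp (- 2 * s))"
  have E: "norm (E s) < 1" if "s > 0" for s using that by (simp add: E_def)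
  have E': "(E has_real_derivative - 2 * E s) (at s)" for s
    unfolding E_def by (auto intro!: derivative_eq_intros)
  have X': "((\<lambda>s. exp (- \<alpha> * s)) has_real_derivative - \<alpha> * exp (- \<alpha> * s)) (at s)" for s
    by (auto intro!: derivative_eq_intros)
  have g: "oblateQ m n = (\<lambda>s. exp (- \<alpha> * s) * S (E s))"
    by (simp add: oblateQ_def fun_eq_iff S_def t_def E_def \<alpha>_def \<beta>_def c_def)
  define g1 where "g1 = (\<lambda>s. exp (- \<alpha> * s) * (- \<alpha> * S (E s) - 2 * E s * S1 (E s)))"
  define g2 where "g2 = (\<lambda>s. exp (- \<alpha> * s) * (\<alpha>\<^sup>2 * S (E s) + 4 * (\<alpha> + 1) * E s * S1 (E s) + 4 * (E s)\<^sup>2 * S2 (E s)))"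
  have SE: "((\<lambda>s. S (E s)) has_real_derivative S1 (E s) * (- 2 * E s)) (at s)"
    "((\<lambda>s. S1 (E s)) has_real_derivative S2 (E s) * (- 2 * E s)) (at s)" if "s > 0" for s
    using DERIV_chain2[OF S(1)[OF E[OF that]] E'] DERIV_chain2[OF S(2)[OF E[OF that]] E'] by auto
  show ?thesis
  proof (rule that[of g1 g2])
    fix s :: real assume s: "s > 0"
    show "(oblateQ m n has_real_derivative g1 s) (at s)"
      unfolding g g1_def by (rule DERIV_cong[OF DERIV_mult[OF X' SE(1)[OF s]]]) (simp add: algebra_simps)
    show "(g1 has_real_derivative g2 s) (at s)"
      unfolding g1_def g2_def
      by (rule DERIV_cong[OF DERIV_mult[OF X' DERIV_diff[OF DERIV_cmult[OF SE(1)[OF s], of "- \<alpha>"]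
             DERIV_mult[OF DERIV_cmult[OF E', of 2] SE(2)[OF s]]]]])
         (simp add: algebra_simps power2_eq_square)
    have ode: "(1 - E s) * (\<alpha>\<^sup>2 * S (E s) + 4 * (\<alpha> + 1) * E s * S1 (E s) + 4 * (E s)\<^sup>2 * S2 (E s))
        + 2 * \<beta> * (1 + E s) * (- \<alpha> * S (E s) - 2 * E s * S1 (E s))
        + (\<beta>\<^sup>2 - (real n + 1 / 2)\<^sup>2) * (1 - E s) * S (E s) = 0"
    proof -
      \<comment> \<open>Expressing n and c through \<alpha> and \<beta> makes the claim a polynomial
        consequence of the hypergeometric equation.\<close>
      have ab: "real n + 1 / 2 = \<alpha> - \<beta>" "c = \<alpha> - \<beta> + 1" by (simp_all add: \<alpha>_def \<beta>_def c_def)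
      show ?thesis using S_ode[OF E[OF s]] unfolding ab by algebra
    qed
    have th: "tanh s * (1 - E s) = 1 + E s"
    proof -
      have "exp s + exp (- s) \<noteq> 0" using add_pos_pos[OF exp_gt_zero exp_gt_zero, of s "- s"] by simp
      then show ?thesis unfolding tanh_altdef[of s] E_def
        by (simp add: divide_simps algebra_simps flip: exp_add)
    qed
    have "(1 - E s) * (g2 s + 2 * \<beta> * tanh s * g1 s + (\<beta>\<^sup>2 - (real n + 1 / 2)\<^sup>2) * oblateQ m n s) = 
      exp (- \<alpha> * s) * ((1 - E s) * (\<alpha>\<^sup>2 * S (E s) + 4 * (\<alpha> + 1) * E s * S1 (E s) + 4 * (E s)\<^sup>2 * S2 (E s))
        + 2 * \<beta> * (tanh s * (1 - E s)) * (- \<alpha> * S (E s) - 2 * E s * S1 (E s))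
        + (\<beta>\<^sup>2 - (real n + 1 / 2)\<^sup>2) * (1 - E s) * S (E s))"
      unfolding g g1_def g2_def by (simp add: algebra_simps)
    also have "\<dots> = 0" unfolding th ode by simp
    finally have "g2 s + 2 * \<beta> * tanh s * g1 s + (\<beta>\<^sup>2 - (real n + 1 / 2)\<^sup>2) * oblateQ m n s = 0"
      using E[OF s] by auto
    then show "g2 s + 2 * (real m + 1 / 2) * tanh s * g1 s + (real m + 1 / 2)\<^sup>2 * oblateQ m n s
        = (real n + 1 / 2)\<^sup>2 * oblateQ m n s"
      unfolding \<beta>_def by (simp add: algebra_simps)
  next
    have E0: "(E \<longlongrightarrow> 0) at_top" unfolding E_def by real_asymp
    have "isCont S 0" "isCont S1 0" using DERIV_isCont[OF S(1)[of 0]] DERIV_isCont[OF S(2)[of 0]] by simp_all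
    then have SE0: "((\<lambda>s. S (E s)) \<longlongrightarrow> S 0) at_top" "((\<lambda>s. S1 (E s)) \<longlongrightarrow> S1 0) at_top"
      using isCont_tendsto_compose[OF _ E0] by blast+
    have S0: "S 0 = rGamma (real n + 3 / 2)" by (simp add: S_def t_def hyp_coeff_0 c_def)
    have ee: "exp (\<alpha> * s) * (exp (- \<alpha> * s) * x) = x" for s x
      by (simp add: exp_minus field_simps)
    show "((\<lambda>s. exp ((real n + real m + 1) * s) * oblateQ m n s) \<longlongrightarrow> rGamma (real n + 3 / 2)) at_top"
      using SE0 unfolding g \<alpha>_def[symmetric] ee S0 by auto
    have "((\<lambda>s. - \<alpha> * S (E s) - 2 * E s * S1 (E s)) \<longlongrightarrow> - \<alpha> * S 0 - 2 * 0 * S1 0) at_top"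
      by (intro tendsto_intros SE0 E0)
    then show "((\<lambda>s. exp ((real n + real m + 1) * s) * g1 s) \<longlongrightarrow> - (real n + real m + 1) * rGamma (real n + 3 / 2)) at_top"
      unfolding g1_def \<alpha>_def[symmetric] ee S0 by simp
  qed
qed

subsection \<open>Legendre functions of half-integer degree\<close>

text \<open>Since \<open>(1 - x) * (\<Sum>k. L * x ^ k) = L\<close>, only the deviations
  \<open>e k - L\<close> matter: a finite head is killed by the factor \<open>1 - x\<close>, and a
  uniformly small tail stays small. It turns the asymptotics of coefficients into the strength of a
  singularity at 1.\<close>

lemma abelian_limit:
  fixes e :: "nat \<Rightarrow> real"
  assumes "e \<longlonglongrightarrow> L"
  shows "((\<lambda>x. (1 - x) * (\<Sum>k. e k * x ^ k)) \<longlongrightarrow> L) (at_left 1)"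
proof -
  obtain B where B: "\<And>k. \<bar>e k - L\<bar> \<le> B"
  proof -
    have "Bseq (\<lambda>k. e k - L)"
      by (intro convergent_imp_Bseq convergentI[of _ "L - L"] tendsto_intros assms)
    then show ?thesis using that by (auto simp: Bseq_def)
  qed
  have sd: "summable (\<lambda>k. \<bar>e k - L\<bar> * x ^ k)" if "0 \<le> x" "x < 1" for x
  proof (rule summable_comparison_test')
    show "summable (\<lambda>k. B * x ^ k)" using that by (intro summable_mult summable_geometric) auto
    show "norm (\<bar>e k - L\<bar> * x ^ k) \<le> B * x ^ k" for k
      using B[of k] that by (simp add: abs_mult mult_right_mono)
  qed
  have se: "summable (\<lambda>k. e k * x ^ k)" if "0 \<le> x" "x < 1" for x
  proof -
    have "summable (\<lambda>k. (e k - L) * x ^ k)"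
      by (rule summable_norm_cancel) (use sd[OF that] that in \<open>simp add: abs_mult\<close>)
    then have "summable (\<lambda>k. (e k - L) * x ^ k + L * x ^ k)"
      using that by (intro summable_add summable_mult summable_geometric) auto
    then show ?thesis by (simp add: algebra_simps)
  qed
  have main: "\<bar>(1 - x) * (\<Sum>k. e k * x ^ k) - L\<bar> \<le> (1 - x) * (\<Sum>k<N. \<bar>e k - L\<bar>) + \<epsilon>"
    if x: "0 \<le> x" "x < 1" and N: "\<And>k. k \<ge> N \<Longrightarrow> \<bar>e k - L\<bar> \<le> \<epsilon>" for x N \<epsilon>
  proof -
    have geo: "(\<Sum>k. x ^ k) = 1 / (1 - x)" "summable (\<lambda>k. x ^ k)"
      using x by (auto simp: suminf_geometric summable_geometric)
    have "(1 - x) * (\<Sum>k. e k * x ^ k) - L = (1 - x) * ((\<Sum>k. e k * x ^ k) - (\<Sum>k. L * x ^ k))"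
      using x by (simp add: suminf_mult geo field_simps)
    also have "\<dots> = (1 - x) * (\<Sum>k. (e k - L) * x ^ k)"
      using se[OF x] geo by (subst suminf_diff) (auto intro!: summable_mult simp: algebra_simps)
    finally have eq: "\<bar>(1 - x) * (\<Sum>k. e k * x ^ k) - L\<bar> = (1 - x) * \<bar>\<Sum>k. (e k - L) * x ^ k\<bar>"
      using x by (simp add: abs_mult)
    have "\<bar>\<Sum>k. (e k - L) * x ^ k\<bar> \<le> (\<Sum>k. \<bar>e k - L\<bar> * x ^ k)"
      using summable_rabs[of "\<lambda>k. (e k - L) * x ^ k"] sd[OF x] x by (simp add: abs_mult)
    also have "\<dots> \<le> (\<Sum>k. (if k < N then \<bar>e k - L\<bar> else 0) + \<epsilon> * x ^ k)"
    proof (rule suminf_le)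
      fix k
      have "0 \<le> \<epsilon>" using N[of N] by linarith
      moreover have "\<bar>e k - L\<bar> * x ^ k \<le> \<bar>e k - L\<bar>"
        using x by (simp add: mult_left_le power_le_one)
      ultimately show "\<bar>e k - L\<bar> * x ^ k \<le> (if k < N then \<bar>e k - L\<bar> else 0) + \<epsilon> * x ^ k"
        using N[of k] x by (auto intro!: mult_right_mono add_increasing2)
      show "summable (\<lambda>k. (if k < N then \<bar>e k - L\<bar> else 0) + \<epsilon> * x ^ k)"
        by (rule summable_add[OF summable_finite[of "{..<N}"] summable_mult[OF geo(2)]]) auto
    qed (rule sd[OF x])
    also have "\<dots> = (\<Sum>k. if k < N then \<bar>e k - L\<bar> else 0) + (\<Sum>k. \<epsilon> * x ^ k)"
      by (rule suminf_add[symmetric, OF summable_finite[of "{..<N}"] summable_mult[OF geo(2)]]) auto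
    also have "(\<Sum>k. if k < N then \<bar>e k - L\<bar> else 0) = (\<Sum>k<N. \<bar>e k - L\<bar>)"
      by (subst suminf_finite[of "{..<N}"]) auto
    also have "(\<Sum>k. \<epsilon> * x ^ k) = \<epsilon> / (1 - x)" using geo by (simp add: suminf_mult)
    finally have "(1 - x) * \<bar>\<Sum>k. (e k - L) * x ^ k\<bar> \<le> (1 - x) * ((\<Sum>k<N. \<bar>e k - L\<bar>) + \<epsilon> / (1 - x))"
      using x by (intro mult_left_mono) auto
    also have "\<dots> = (1 - x) * (\<Sum>k<N. \<bar>e k - L\<bar>) + \<epsilon>" using x by (simp add: distrib_left)
    finally show ?thesis unfolding eq .
  qed
  show ?thesis
  proof (rule tendstoI)
    fix \<epsilon> :: real assume \<epsilon>: "\<epsilon> > 0"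
    then obtain N where N: "\<And>k. k \<ge> N \<Longrightarrow> \<bar>e k - L\<bar> < \<epsilon> / 2"
      using assms unfolding LIMSEQ_iff real_norm_def by (meson half_gt_zero)
    have "((\<lambda>x. (1 - x) * (\<Sum>k<N. \<bar>e k - L\<bar>) + \<epsilon> / 2) \<longlongrightarrow> (1 - 1) * (\<Sum>k<N. \<bar>e k - L\<bar>) + \<epsilon> / 2) (at_left 1)"
      by (intro tendsto_intros)
    then have "eventually (\<lambda>x. (1 - x) * (\<Sum>k<N. \<bar>e k - L\<bar>) + \<epsilon> / 2 < \<epsilon>) (at_left 1)"
      by (rule order_tendstoD(2)) (use \<epsilon> in simp)
    moreover have "eventually (\<lambda>x::real. x \<in> {0<..<1}) (at_left 1)"
      by (rule eventually_at_leftI[of 0]) auto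
    ultimately show "eventually (\<lambda>x. dist ((1 - x) * (\<Sum>k. e k * x ^ k)) L < \<epsilon>) (at_left 1)"
    proof eventually_elim
      case (elim x)
      then show ?case using main[of x N "\<epsilon> / 2"] N by (force simp: dist_real_def less_imp_le)
    qed
  qed
qed

text \<open>A series in \<open>1 / x^2\<close> made homogeneous of degree \<open>- \<mu>\<close> in
  (s, x). At s = 1 it is the Legendre function; with \<open>s = sin \<theta>\<close> and
  \<open>x = \<chi> * sin \<theta>\<close> it remains regular where s vanishes.\<close>

definition qser :: "real \<Rightarrow> (nat \<Rightarrow> real) \<Rightarrow> real \<Rightarrow> real \<Rightarrow> real" where
  "qser \<mu> e s x = x powr (- \<mu>) * (\<Sum>k. e k * ((s / x)\<^sup>2) ^ k)"

lemma qser_scale: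
  assumes "s > 0" "x > 0"
  shows "s powr (- \<mu>) * qser \<mu> e 1 (x / s) = qser \<mu> e s x"
  using assms by (simp add: qser_def powr_divide flip: powr_add mult.assoc)

definition conv1 :: "(nat \<Rightarrow> real) \<Rightarrow> bool" where
  "conv1 e \<longleftrightarrow> (\<forall>x::real. \<bar>x\<bar> < 1 \<longrightarrow> summable (\<lambda>k. e k * x ^ k))"

lemma conv1_sums: "conv1 e \<Longrightarrow> \<bar>x\<bar> < 1 \<Longrightarrow> (\<lambda>k. e k * x ^ k) sums (\<Sum>k. e k * x ^ k)"
  by (auto simp: conv1_def intro: summable_sums)

lemma conv1_diffs: "conv1 e \<Longrightarrow> conv1 (diffs e)"
  unfolding conv1_def by (auto intro!: termdiff_converges[where K = 1])

lemma conv1_deriv: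
  assumes "conv1 e" "\<bar>x\<bar> < 1"
  shows "((\<lambda>x. \<Sum>k. e k * x ^ k) has_real_derivative (\<Sum>k. diffs e k * x ^ k)) (at x)"
  using assms by (intro termdiffs_strong'[where K = 1]) (auto simp: conv1_def)

lemma conv1_mult_nat:
  assumes "conv1 e" "\<bar>x\<bar> < 1"
  shows "(\<lambda>k. real k * e k * x ^ k) sums (x * (\<Sum>k. diffs e k * x ^ k))"
proof -
  have "(\<lambda>k. of_nat (Suc k) * e (Suc k) * x ^ Suc k) sums (x * (\<Sum>k. diffs e k * x ^ k))"
    using sums_mult[OF conv1_sums[OF conv1_diffs[OF assms(1)] assms(2)], of x] by (simp add: diffs_def mult_ac)
  then show ?thesis by (subst (asm) sums_Suc_iff) simp
qed

text \<open>Differentiation of \<open>x powr (- \<mu> - 2 * k)\<close> brings down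
  \<open>- (\<mu> + 2 * k)\<close> and raises \<mu> by one, so derivatives of \<open>qser\<close>
  are again of the form \<open>qser\<close>.\<close>

definition qshift :: "real \<Rightarrow> (nat \<Rightarrow> real) \<Rightarrow> nat \<Rightarrow> real" where
  "qshift \<mu> e = (\<lambda>k. - (\<mu> + 2 * real k) * e k)"

lemma qshift_sums:
  assumes "conv1 e" "\<bar>x\<bar> < 1"
  shows "(\<lambda>k. qshift \<mu> e k * x ^ k) sums (- \<mu> * (\<Sum>k. e k * x ^ k) - 2 * x * (\<Sum>k. diffs e k * x ^ k))"
proof -
  have "(\<lambda>k. - \<mu> * (e k * x ^ k) - 2 * (real k * e k * x ^ k)) sums
      (- \<mu> * (\<Sum>k. e k * x ^ k) - 2 * (x * (\<Sum>k. diffs e k * x ^ k)))"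
    by (intro sums_diff sums_mult conv1_sums conv1_mult_nat assms)
  then show ?thesis by (simp add: qshift_def algebra_simps)
qed

lemma conv1_qshift: "conv1 e \<Longrightarrow> conv1 (qshift \<mu> e)"
  using qshift_sums unfolding conv1_def by (blast intro: sums_summable)

lemma quotient_square_less_1:
  fixes s x :: real
  assumes "\<bar>s\<bar> < x"
  shows "\<bar>(s / x)\<^sup>2\<bar> < 1"
proof -
  have "\<bar>s / x\<bar> < 1" using assms by (auto simp: abs_divide)
  then show ?thesis by (simp only: abs_square_less_1 abs_power2)
qed

lemma qser_deriv:
  assumes "conv1 e" "\<bar>s\<bar> < x"
  shows "(qser \<mu> e s has_real_derivative qser (\<mu> + 1) (qshift \<mu> e) s x) (at x)"
proof -
  have x: "x > 0" using assms by linarith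
  have less: "\<bar>(s / x)\<^sup>2\<bar> < 1" using assms(2) by (rule quotient_square_less_1)
  define S S1 where "S = (\<lambda>x. \<Sum>k. e k * x ^ k)" and "S1 = (\<lambda>x. \<Sum>k. diffs e k * x ^ k)"
  have d1: "((\<lambda>x. (s / x)\<^sup>2) has_real_derivative - 2 * (s / x)\<^sup>2 / x) (at x)"
    using x by (auto intro!: derivative_eq_intros simp: field_simps power2_eq_square)
  have d2: "((\<lambda>x. S ((s / x)\<^sup>2)) has_real_derivative S1 ((s / x)\<^sup>2) * (- 2 * (s / x)\<^sup>2 / x)) (at x)"
    unfolding S_def S1_def by (rule DERIV_chain2[OF conv1_deriv[OF assms(1) less] d1])
  have d3: "((\<lambda>x. x powr (- \<mu>)) has_real_derivative - \<mu> * x powr (- \<mu> - 1)) (at x)"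
    using x by (auto intro!: derivative_eq_intros)
  have "((\<lambda>x. x powr (- \<mu>) * S ((s / x)\<^sup>2)) has_real_derivative
      - \<mu> * x powr (- \<mu> - 1) * S ((s / x)\<^sup>2) + S1 ((s / x)\<^sup>2) * (- 2 * (s / x)\<^sup>2 / x) * x powr (- \<mu>)) (at x)"
    by (rule DERIV_mult[OF d3 d2])
  also have "- \<mu> * x powr (- \<mu> - 1) * S ((s / x)\<^sup>2) + S1 ((s / x)\<^sup>2) * (- 2 * (s / x)\<^sup>2 / x) * x powr (- \<mu>) =
     x powr (- \<mu> - 1) * (- \<mu> * S ((s / x)\<^sup>2) - 2 * (s / x)\<^sup>2 * S1 ((s / x)\<^sup>2))"
    using x by (simp add: powr_diff algebra_simps)
  also have "- \<mu> * S ((s / x)\<^sup>2) - 2 * (s / x)\<^sup>2 * S1 ((s / x)\<^sup>2) = (\<Sum>k. qshift \<mu> e k * ((s / x)\<^sup>2) ^ k)"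
    using qshift_sums[OF assms(1) less, of \<mu>] unfolding S_def S1_def by (simp add: sums_iff)
  also have "- \<mu> - 1 = - (\<mu> + 1)" by simp
  finally show ?thesis unfolding qser_def S_def .
qed

lemma continuous_on_qser [continuous_intros]:
  fixes f g :: "'a :: topological_space \<Rightarrow> real"
  assumes "conv1 e" "continuous_on A f" "continuous_on A g" "\<And>x. x \<in> A \<Longrightarrow> \<bar>f x\<bar> < g x"
  shows "continuous_on A (\<lambda>x. qser \<mu> e (f x) (g x))"
proof -
  have less: "\<bar>(f x / g x)\<^sup>2\<bar> < 1" if "x \<in> A" for x
    using assms(4)[OF that] by (rule quotient_square_less_1)
  have "continuous_on {-1<..<1} (\<lambda>x. \<Sum>k. e k * x ^ k)"
    by (rule DERIV_continuous_on[where D = "\<lambda>x. \<Sum>k. diffs e k * x ^ k"])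
       (rule has_field_derivative_at_within[OF conv1_deriv[OF assms(1)]], auto simp: abs_less_iff)
  then have "continuous_on A (\<lambda>x. \<Sum>k. e k * ((f x / g x)\<^sup>2) ^ k)"
  proof (rule continuous_on_compose2)
    show "continuous_on A (\<lambda>x. (f x / g x)\<^sup>2)" using assms by (force intro!: continuous_intros)
    show "(\<lambda>x. (f x / g x)\<^sup>2) ` A \<subseteq> {-1<..<1}" using less unfolding abs_less_iff by auto
  qed
  then show ?thesis
    unfolding qser_def using assms by (force intro!: continuous_intros)
qed

text \<open>The parameters \<open>\<nu>/2 + 1\<close>, \<open>(\<nu> + 1)/2\<close>,
  \<open>\<nu> + 3/2\<close> of the second-kind function at order 0 and degree
  \<open>\<nu> = m - 1/2\<close>. The third is the sum of the first two, the case of a logarithmic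
  singularity at 1.\<close>

definition ring_coeff :: "nat \<Rightarrow> nat \<Rightarrow> real" where
  "ring_coeff m = hyp_coeff ((real m + 1 / 2) / 2 + 1 / 2) ((real m + 1 / 2) / 2) (real m + 1)"

text \<open>On \<open>x > 1\<close>, \<open>ring_const m * ringQ m x\<close> is the Legendre function of the second kind of degree
  \<open>m - 1/2\<close>; \<open>ringQ1\<close> and \<open>ringQ2\<close> are the derivatives of \<open>ringQ\<close>.\<close>

definition ringQ :: "nat \<Rightarrow> real \<Rightarrow> real" where
  "ringQ m = qser (real m + 1 / 2) (ring_coeff m) 1"

definition ringQ1 :: "nat \<Rightarrow> real \<Rightarrow> real" where
  "ringQ1 m = qser (real m + 1 / 2 + 1) (qshift (real m + 1 / 2) (ring_coeff m)) 1"

definition ringQ2 :: "nat \<Rightarrow> real \<Rightarrow> real" where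
  "ringQ2 m = qser (real m + 1 / 2 + 1 + 1) (qshift (real m + 1 / 2 + 1) (qshift (real m + 1 / 2) (ring_coeff m))) 1"

lemma ring_coeff_parameters_pos: "(real m + 1 / 2) / 2 + 1 / 2 > 0" "(real m + 1 / 2) / 2 > 0" "real m + 1 > 0"
  by (simp_all add: add_pos_pos)

lemma conv1_ring_coeff: "conv1 (ring_coeff m)"
  unfolding conv1_def ring_coeff_def
  using summable_hyp_coeff[where 'a = real, OF ring_coeff_parameters_pos] by simp

lemma ring_coeff_pos: "ring_coeff m k > 0"
  unfolding ring_coeff_def by (rule hyp_coeff_pos[OF ring_coeff_parameters_pos])

lemma ringQ_deriv: "x > 1 \<Longrightarrow> (ringQ m has_real_derivative ringQ1 m x) (at x)"
  unfolding ringQ_def ringQ1_def by (rule qser_deriv[OF conv1_ring_coeff]) simp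

lemma ringQ1_deriv: "x > 1 \<Longrightarrow> (ringQ1 m has_real_derivative ringQ2 m x) (at x)"
  unfolding ringQ1_def ringQ2_def by (rule qser_deriv[OF conv1_qshift[OF conv1_ring_coeff]]) simp

text \<open>The Legendre equation, with \<open>\<nu> * (\<nu> + 1) = m^2 - 1/4\<close>. With
  \<open>y = 1 / x^2\<close>, the contributions of
  \<open>x^2 * Q'' + 2 * x * Q' - \<mu> * (\<mu> - 1) * Q\<close> have coefficients
  \<open>4 * k * (k + m)\<close> times the original ones, and by the hypergeometric recurrence this
  is the shifted series of Q''.\<close>

lemma ringQ_ode:
  assumes "x > 1"
  shows "(x\<^sup>2 - 1) * ringQ2 m x + 2 * x * ringQ1 m x = ((real m)\<^sup>2 - 1 / 4) * ringQ m x"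
proof -
  define \<mu> where "\<mu> = real m + 1 / 2"
  define t e1 e2 where "t = ring_coeff m" and "e1 = qshift \<mu> t" and "e2 = qshift (\<mu> + 1) e1"
  define y where "y = (1 / x)\<^sup>2"
  define T E1 E2 where "T = (\<Sum>k. t k * y ^ k)" and "E1 = (\<Sum>k. e1 k * y ^ k)" and "E2 = (\<Sum>k. e2 k * y ^ k)"
  have y: "\<bar>y\<bar> < 1" unfolding y_def using assms by (intro quotient_square_less_1) simp
  have c0: "conv1 t" unfolding t_def by (rule conv1_ring_coeff)
  have c1: "conv1 e1" unfolding e1_def by (rule conv1_qshift[OF c0])
  have c2: "conv1 e2" unfolding e2_def by (rule conv1_qshift[OF c1])
  have "(\<lambda>k. e2 k * y ^ k + 2 * (e1 k * y ^ k) - (\<mu> * (\<mu> - 1)) * (t k * y ^ k)) sums (E2 + 2 * E1 - (\<mu> * (\<mu> - 1)) * T)"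
    unfolding T_def E1_def E2_def by (intro sums_add sums_diff sums_mult conv1_sums c0 c1 c2 y)
  also have "(\<lambda>k. e2 k * y ^ k + 2 * (e1 k * y ^ k) - (\<mu> * (\<mu> - 1)) * (t k * y ^ k)) =
      (\<lambda>k. 4 * real k * (real k + real m) * t k * y ^ k)"
    by (rule ext) (simp add: e2_def e1_def qshift_def \<mu>_def algebra_simps)
  finally have s1: "(\<lambda>k. 4 * real k * (real k + real m) * t k * y ^ k) sums (E2 + 2 * E1 - (\<mu> * (\<mu> - 1)) * T)" .
  have "4 * real (Suc k) * (real (Suc k) + real m) * t (Suc k) * y ^ Suc k = y * (e2 k * y ^ k)" for k
  proof -
    have "4 * real (Suc k) * (real (Suc k) + real m) * t (Suc k) =
       4 * ((real k + 1) * (real k + (real m + 1)) * t (Suc k))" by (simp add: algebra_simps)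
    also have "\<dots> = 4 * ((real k + (\<mu> / 2 + 1 / 2)) * (real k + \<mu> / 2) * t k)"
      unfolding t_def ring_coeff_def hyp_coeff_Suc \<mu>_def ..
    also have "\<dots> = e2 k" by (simp add: e2_def e1_def qshift_def algebra_simps)
    finally show ?thesis by (simp add: mult_ac)
  qed
  then have "(\<lambda>k. 4 * real (Suc k) * (real (Suc k) + real m) * t (Suc k) * y ^ Suc k) sums (y * E2)"
    using sums_mult[OF conv1_sums[OF c2 y], of y] by (simp add: E2_def del: of_nat_Suc power_Suc)
  then have "(\<lambda>k. 4 * real k * (real k + real m) * t k * y ^ k) sums (y * E2)"
    by (subst (asm) sums_Suc_iff) simp
  with s1 have eq: "E2 + 2 * E1 - (\<mu> * (\<mu> - 1)) * T = y * E2" by (rule sums_unique2)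
  have yx: "y * x\<^sup>2 = 1" using assms by (simp add: y_def power_divide)
  have p1: "x powr (- (\<mu> + 1)) * x = x powr (- \<mu>)" "x powr (- (\<mu> + 1 + 1)) * x\<^sup>2 = x powr (- \<mu>)"
    using assms powr_add[of x "- (\<mu> + 1)" 1] powr_add[of x "- (\<mu> + 1 + 1)" 2] by (simp_all add: powr_numeral)
  have "(x\<^sup>2 - 1) * ringQ2 m x + 2 * x * ringQ1 m x = (x powr (- (\<mu> + 1 + 1)) * x\<^sup>2) * (1 - y) * E2 + 2 * (x powr (- (\<mu> + 1)) * x) * E1"
  proof -
    have "(x\<^sup>2 - 1) = x\<^sup>2 * (1 - y)" using yx by (simp add: algebra_simps)
    then show ?thesis
      unfolding ringQ2_def ringQ1_def qser_def E2_def E1_def e2_def e1_def t_def y_def \<mu>_def by (simp add: mult_ac)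
  qed
  also have "\<dots> = x powr (- \<mu>) * (\<mu> * (\<mu> - 1) * T)"
    unfolding p1 using eq by algebra
  also have "\<dots> = ((real m)\<^sup>2 - 1 / 4) * ringQ m x"
    unfolding ringQ_def qser_def T_def t_def y_def \<mu>_def by (simp add: algebra_simps power2_eq_square)
  finally show ?thesis .
qed

section \<open>The logarithmic singularity at 1\<close>

definition ring_residue :: "nat \<Rightarrow> real" where
  "ring_residue m = rGamma ((real m + 1 / 2) / 2 + 1 / 2) * rGamma ((real m + 1 / 2) / 2)"

text \<open>The coefficients are quotients of Euler's product approximations to 1/Gamma; for c = a +
  b the powers of k in these cancel and exactly one factor k remains.\<close>

lemma hyp_coeff_limit:
  assumes "a > 0" "b > 0"
  shows "(\<lambda>k. real k * hyp_coeff a b (a + b) k) \<longlonglongrightarrow> rGamma a * rGamma b"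
proof -
  have nz: "rGamma (a + b) \<noteq> 0"
  proof -
    have "Gamma (a + b) > 0" using assms by (intro Gamma_real_pos) simp
    then show ?thesis by (simp add: rGamma_inverse_Gamma)
  qed
  have "(\<lambda>k. rGamma_series a k * rGamma_series b k / rGamma_series (a + b) k * rGamma (a + b)) \<longlonglongrightarrow>
     rGamma a * rGamma b / rGamma (a + b) * rGamma (a + b)"
    using nz by (intro tendsto_intros rGamma_series_LIMSEQ)
  also have "rGamma a * rGamma b / rGamma (a + b) * rGamma (a + b) = rGamma a * rGamma b" using nz by simp
  finally have lim: "(\<lambda>k. rGamma_series a k * rGamma_series b k / rGamma_series (a + b) k * rGamma (a + b)) \<longlonglongrightarrow> rGamma a * rGamma b" .
  \<comment> \<open>The approximant at k contains the Pochhammer symbol of length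
    \<open>k + 1\<close>, hence the coefficient with index \<open>Suc k\<close>.\<close>
  have "rGamma_series a k * rGamma_series b k / rGamma_series (a + b) k * rGamma (a + b) =
     real (Suc k) * hyp_coeff a b (a + b) (Suc k)" if "k > 0" for k
  proof -
    have ppos: "pochhammer (a + b) (Suc k) > 0" using assms by (intro pochhammer_pos) simp
    have "rGamma (a + b) = pochhammer (a + b) (Suc k) * rGamma (a + b + real (Suc k))"
      using pochhammer_rGamma[of "a + b" "Suc k"] by simp
    then have "rGamma (a + b + real (Suc k)) = rGamma (a + b) / pochhammer (a + b) (Suc k)"
      using ppos by (simp add: field_simps)
    moreover have "exp ((a + b) * ln (real k)) = exp (a * ln (real k)) * exp (b * ln (real k))"
      by (simp add: distrib_right exp_add)
    ultimately show ?thesis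
      unfolding rGamma_series_def hyp_coeff_def using ppos
      by (simp del: pochhammer_Suc of_nat_Suc add: divide_simps)
  qed
  then have "\<forall>\<^sub>F k in sequentially. rGamma_series a k * rGamma_series b k / rGamma_series (a + b) k * rGamma (a + b) =
     real (Suc k) * hyp_coeff a b (a + b) (Suc k)"
    by (intro eventually_mono[OF eventually_gt_at_top[of 0]]) blast
  from Lim_transform_eventually[OF lim this] show ?thesis by (rule LIMSEQ_imp_Suc)
qed

lemma qshift_ring_coeff_limit: "qshift (real m + 1 / 2) (ring_coeff m) \<longlonglongrightarrow> - 2 * ring_residue m"
proof -
  define \<mu> where "\<mu> = real m + 1 / 2"
  have eq: "\<mu> / 2 + 1 / 2 + \<mu> / 2 = real m + 1" by (simp add: \<mu>_def)
  have lim: "(\<lambda>k. real k * ring_coeff m k) \<longlonglongrightarrow> ring_residue m"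
    unfolding ring_coeff_def ring_residue_def
    using hyp_coeff_limit[OF ring_coeff_parameters_pos(1,2)[of m], folded \<mu>_def] unfolding eq by (simp add: \<mu>_def)
  have "(\<lambda>k. real k * ring_coeff m k * (1 / real k)) \<longlonglongrightarrow> ring_residue m * 0"
    by (intro tendsto_intros lim lim_1_over_n)
  moreover have "\<forall>\<^sub>F k in sequentially. real k * ring_coeff m k * (1 / real k) = ring_coeff m k"
    using eventually_gt_at_top[of 0] by eventually_elim simp
  ultimately have "ring_coeff m \<longlonglongrightarrow> 0" by (simp add: tendsto_cong)
  then have "(\<lambda>k. - \<mu> * ring_coeff m k - 2 * (real k * ring_coeff m k)) \<longlonglongrightarrow> - \<mu> * 0 - 2 * ring_residue m"
    by (intro tendsto_intros lim)
  then show ?thesis unfolding qshift_def \<mu>_def by (simp add: algebra_simps)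
qed

lemma ringQ1_limit: "((\<lambda>x. (x - 1) * ringQ1 m x) \<longlongrightarrow> - ring_residue m) (at_right 1)"
proof -
  define e where "e = qshift (real m + 1 / 2) (ring_coeff m)"
  have "filterlim (\<lambda>x::real. (1 / x)\<^sup>2) (at_left 1) (at_right 1)" by real_asymp
  from filterlim_compose[OF abelian_limit[OF qshift_ring_coeff_limit] this]
  have "((\<lambda>x. (1 - (1 / x)\<^sup>2) * (\<Sum>k. e k * ((1 / x)\<^sup>2) ^ k)) \<longlongrightarrow> - 2 * ring_residue m) (at_right 1)"
    unfolding e_def .
  \<comment> \<open>\<open>x - 1 = (1 - 1 / x^2) * (x^2 / (x + 1))\<close>, and the last factor
    tends to 1/2: this halves the limit \<open>- 2 * ring_residue m\<close> of the
    coefficients.\<close>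
  moreover have "((\<lambda>x. x powr (- (real m + 1 / 2 + 1)) * (x\<^sup>2 / (x + 1))) \<longlongrightarrow> 1 powr (- (real m + 1 / 2 + 1)) * (1\<^sup>2 / (1 + 1))) (at_right 1)"
    by (intro tendsto_intros) auto
  ultimately have "((\<lambda>x. (1 - (1 / x)\<^sup>2) * (\<Sum>k. e k * ((1 / x)\<^sup>2) ^ k) * (x powr (- (real m + 1 / 2 + 1)) * (x\<^sup>2 / (x + 1)))) \<longlongrightarrow>
     - 2 * ring_residue m * (1 powr (- (real m + 1 / 2 + 1)) * (1\<^sup>2 / (1 + 1)))) (at_right 1)"
    by (rule tendsto_mult)
  moreover have "\<forall>\<^sub>F x in at_right 1. (1 - (1 / x)\<^sup>2) * (\<Sum>k. e k * ((1 / x)\<^sup>2) ^ k) * (x powr (- (real m + 1 / 2 + 1)) * (x\<^sup>2 / (x + 1)))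
      = (x - 1) * ringQ1 m x"
  proof -
    have a1: "(1 - (1 / x)\<^sup>2) * (x\<^sup>2 / (x + 1)) = x - 1" if "x > 1" for x :: real
    proof -
      have "1 - (1 / x)\<^sup>2 = (x - 1) * (x + 1) / x\<^sup>2" using that by (simp add: field_simps power2_eq_square)
      then show ?thesis using that by simp
    qed
    have a2: "(1 - (1 / x)\<^sup>2) * (\<Sum>k. e k * ((1 / x)\<^sup>2) ^ k) * (x powr (- (real m + 1 / 2 + 1)) * (x\<^sup>2 / (x + 1)))
      = ((1 - (1 / x)\<^sup>2) * (x\<^sup>2 / (x + 1))) * ringQ1 m x" for x
      unfolding ringQ1_def qser_def e_def by (simp only: mult_ac)
    have "(1 - (1 / x)\<^sup>2) * (\<Sum>k. e k * ((1 / x)\<^sup>2) ^ k) * (x powr (- (real m + 1 / 2 + 1)) * (x\<^sup>2 / (x + 1)))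
      = (x - 1) * ringQ1 m x" if "x > 1" for x
      unfolding a2 a1[OF that] ..
    then show ?thesis by (auto intro: eventually_at_rightI[of _ 2])
  qed
  ultimately show ?thesis by (subst (asm) tendsto_cong) auto
qed

lemma ringQ1_nonpos: "x > 1 \<Longrightarrow> ringQ1 m x \<le> 0"
proof -
  assume x: "x > 1"
  define e where "e = qshift (real m + 1 / 2) (ring_coeff m)"
  have "\<bar>(1 / x)\<^sup>2\<bar> < 1" using x by (intro quotient_square_less_1) simp
  then have s: "summable (\<lambda>k. e k * ((1 / x)\<^sup>2) ^ k)"
    using conv1_qshift[OF conv1_ring_coeff] unfolding e_def conv1_def by blast
  have "e k * ((1 / x)\<^sup>2) ^ k \<le> 0" for k
    using less_imp_le[OF ring_coeff_pos[of m k]] by (simp add: e_def qshift_def mult_nonpos_nonneg mult_nonneg_nonneg)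
  then have "(\<Sum>k. e k * ((1 / x)\<^sup>2) ^ k) \<le> 0" using suminf_le[OF _ s summable_zero] by simp
  then show "ringQ1 m x \<le> 0" unfolding ringQ1_def qser_def e_def by (simp add: mult_nonneg_nonpos)
qed

lemma ringQ_nonneg: "x > 1 \<Longrightarrow> ringQ m x \<ge> 0"
proof -
  assume x: "x > 1"
  have "\<bar>(1 / x)\<^sup>2\<bar> < 1" using x by (intro quotient_square_less_1) simp
  then have s: "summable (\<lambda>k. ring_coeff m k * ((1 / x)\<^sup>2) ^ k)"
    using conv1_ring_coeff unfolding conv1_def by blast
  then have "(\<Sum>k. ring_coeff m k * ((1 / x)\<^sup>2) ^ k) \<ge> 0"
    by (intro suminf_nonneg) (auto intro!: mult_nonneg_nonneg less_imp_le[OF ring_coeff_pos])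
  then show "ringQ m x \<ge> 0" unfolding ringQ_def qser_def by simp
qed

text \<open>The coefficients are bounded because they converge, so comparison with a geometric
  series gives a bound valid on the whole half-line, as required for dominating integrands
  uniformly.\<close>

lemma ringQ1_bound:
  obtains C where "C > 0" "\<And>x. x > 1 \<Longrightarrow> \<bar>(x - 1) * ringQ1 m x\<bar> \<le> C"
proof -
  define \<mu> where "\<mu> = real m + 1 / 2"
  define e where "e = qshift \<mu> (ring_coeff m)"
  have "Bseq e" unfolding e_def \<mu>_def
    by (intro convergent_imp_Bseq convergentI[OF qshift_ring_coeff_limit])
  then obtain B where B: "B > 0" "\<And>k. \<bar>e k\<bar> \<le> B" by (auto simp: Bseq_def)
  show ?thesis
  proof (rule that[of B])
    fix x :: real assume x: "x > 1"
    define y where "y = (1 / x)\<^sup>2"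
    have y: "0 \<le> y" "y < 1" using quotient_square_less_1[of 1 x] x by (auto simp: y_def)
    have s: "summable (\<lambda>k. \<bar>e k * y ^ k\<bar>)"
    proof (rule summable_comparison_test')
      show "summable (\<lambda>k. B * y ^ k)" using y by (intro summable_mult summable_geometric) auto
      show "norm \<bar>e k * y ^ k\<bar> \<le> B * y ^ k" for k using B(2)[of k] y by (simp add: abs_mult mult_right_mono)
    qed
    have "\<bar>\<Sum>k. e k * y ^ k\<bar> \<le> (\<Sum>k. \<bar>e k * y ^ k\<bar>)" by (rule summable_rabs[OF s])
    also have "\<dots> \<le> (\<Sum>k. B * y ^ k)"
      using y B(2) by (intro suminf_le s summable_mult summable_geometric) (auto simp: abs_mult intro!: mult_right_mono)
    also have "\<dots> = B / (1 - y)" using y by (simp add: suminf_mult suminf_geometric summable_geometric)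
    finally have S: "\<bar>\<Sum>k. e k * y ^ k\<bar> \<le> B / (1 - y)" .
    have "x powr (- (\<mu> + 1)) \<le> x powr (- 1)" using x by (intro powr_mono) (auto simp: \<mu>_def)
    then have p: "x powr (- (\<mu> + 1)) \<le> 1 / x" using x by (simp add: powr_minus divide_inverse)
    have "\<bar>(x - 1) * ringQ1 m x\<bar> = (x - 1) * (x powr (- (\<mu> + 1)) * \<bar>\<Sum>k. e k * y ^ k\<bar>)"
      using x unfolding ringQ1_def qser_def e_def \<mu>_def y_def by (simp add: abs_mult)
    also have "\<dots> \<le> (x - 1) * (1 / x * (B / (1 - y)))"
      using x p S y by (intro mult_left_mono mult_mono) auto
    also have "\<dots> = B * (x / (x + 1))"
    proof -
      have 1: "1 - y = (x - 1) * (x + 1) / x\<^sup>2" using x by (simp add: y_def field_simps power2_eq_square)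
      show ?thesis unfolding 1 using x by (simp add: divide_simps power2_eq_square)
    qed
    also have "\<dots> \<le> B * 1" using B x by (intro mult_left_mono) auto
    finally show "\<bar>(x - 1) * ringQ1 m x\<bar> \<le> B" by simp
  qed (use B in auto)
qed

text \<open>The logarithm is weakened to \<open>(x - 1) powr (- 1/4)\<close>. As
  \<open>\<chi> - 1\<close> is at least a multiple of \<open>(\<theta> - \<theta>')^2\<close>, this
  becomes the integrable majorant \<open>1 / sqrt \<bar>\<theta> - \<theta>'\<bar>\<close>.\<close>

lemma ringQ_bound:
  obtains C where "C > 0" "\<And>x. x > 1 \<Longrightarrow> ringQ m x \<le> C + C / sqrt (sqrt (x - 1))"
proof -
  obtain C where C: "C > 0" "\<And>x. x > 1 \<Longrightarrow> \<bar>(x - 1) * ringQ1 m x\<bar> \<le> C" using ringQ1_bound by blast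
  have Q2: "ringQ m 2 \<ge> 0" by (rule ringQ_nonneg) simp
  have far: "ringQ m x \<le> ringQ m 2" if "x \<ge> 2" for x
    by (rule DERIV_nonpos_imp_nonincreasing[OF that]) (use ringQ_deriv ringQ1_nonpos in force)
  \<comment> \<open>By the bound on \<open>(x - 1) * Q'\<close>, the sum
    \<open>Q + C * ln (x - 1)\<close> is nondecreasing; it is compared with its value at 2.\<close>
  have near: "ringQ m x + C * ln (x - 1) \<le> ringQ m 2 + C * ln (2 - 1)" if "1 < x" "x \<le> 2" for x
  proof (rule DERIV_nonneg_imp_nondecreasing[OF that(2)])
    fix y assume y: "x \<le> y" "y \<le> 2"
    have "((\<lambda>x. ringQ m x + C * ln (x - 1)) has_real_derivative ringQ1 m y + C / (y - 1)) (at y)"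
      using y that by (auto intro!: derivative_eq_intros ringQ_deriv)
    moreover have "ringQ1 m y + C / (y - 1) \<ge> 0"
      using C(2)[of y] y that by (simp add: abs_le_iff field_simps)
    ultimately show "\<exists>z. ((\<lambda>x. ringQ m x + C * ln (x - 1)) has_real_derivative z) (at y) \<and> 0 \<le> z" by blast
  qed
  have lnb: "- ln y \<le> 4 / sqrt (sqrt y)" if "y > 0" for y :: real
  proof -
    have "- ln y = 4 * ln (1 / sqrt (sqrt y))" using that by (simp add: ln_div ln_sqrt)
    also have "\<dots> \<le> 4 * (1 / sqrt (sqrt y))"
      using that by (intro mult_left_mono less_imp_le[OF ln_less_self]) auto
    finally show ?thesis by simp
  qed
  show ?thesis
  proof (rule that[of "ringQ m 2 + 4 * C"])
    fix x :: real assume x: "x > 1"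
    have r: "0 \<le> 1 / sqrt (sqrt (x - 1))" using x by simp
    have "ringQ m x \<le> ringQ m 2 + 4 * C * (1 / sqrt (sqrt (x - 1)))"
    proof (cases "x \<ge> 2")
      case True
      then show ?thesis using far[OF True] C(1) r by (simp add: add_increasing2)
    next
      case False
      then have "ringQ m x \<le> ringQ m 2 + C * (- ln (x - 1))" using near[of x] x by simp
      also have "C * (- ln (x - 1)) \<le> C * (4 / sqrt (sqrt (x - 1)))"
        using C(1) lnb[of "x - 1"] x by (intro mult_left_mono) auto
      finally show ?thesis by (simp add: mult_ac)
    qed
    also have "\<dots> \<le> (ringQ m 2 + 4 * C) + (ringQ m 2 + 4 * C) * (1 / sqrt (sqrt (x - 1)))"
      using Q2 C(1) r by (intro add_mono mult_right_mono) auto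
    finally show "ringQ m x \<le> ringQ m 2 + 4 * C + (ringQ m 2 + 4 * C) / sqrt (sqrt (x - 1))" by simp
  qed (use Q2 C(1) in auto)
qed

definition ring_const :: "nat \<Rightarrow> real" where
  "ring_const m = sqrt pi * Gamma (real m + 1 / 2) / 2 powr (real m + 1 / 2)"

text \<open>The duplication formula in disguise. It expresses that the second-kind function behaves
  like \<open>- 1/2 * ln (x - 1)\<close> at 1, independently of m.\<close>

lemma ring_const_residue: "ring_const m * ring_residue m = 1 / 2"
proof -
  define b where "b = (real m + 1 / 2) / 2"
  have "b > 0" by (simp add: b_def)
  then have b: "b > 0" "b \<notin> \<int>\<^sub>\<le>\<^sub>0" "b + 1 / 2 \<notin> \<int>\<^sub>\<le>\<^sub>0"
    using nonpos_Ints_nonpos[of b] nonpos_Ints_nonpos[of "b + 1 / 2"] by auto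
  have G: "Gamma (2 * b) > 0" "Gamma b > 0" "Gamma (b + 1 / 2) > 0" using b by (auto intro!: Gamma_real_pos)
  have dup: "Gamma b * Gamma (b + 1 / 2) = 2 powr (1 - 2 * b) * sqrt pi * Gamma (2 * b)"
  proof -
    have nz: "complex_of_real b \<notin> \<int>\<^sub>\<le>\<^sub>0" "complex_of_real b + 1 / 2 \<notin> \<int>\<^sub>\<le>\<^sub>0"
      using b of_real_in_nonpos_Ints_iff[of b, where 'a = complex] of_real_in_nonpos_Ints_iff[of "b + 1 / 2", where 'a = complex]
      by simp_all
    have "complex_of_real (Gamma b * Gamma (b + 1 / 2)) = of_real (exp ((1 - 2 * b) * ln 2) * sqrt pi * Gamma (2 * b))"
      using Gamma_legendre_duplication[OF nz] Gamma_complex_of_real[of b] Gamma_complex_of_real[of "b + 1 / 2"]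
        Gamma_complex_of_real[of "2 * b"] exp_of_real[of "(1 - 2 * b) * ln 2", where 'a = complex]
      by simp
    then show ?thesis unfolding of_real_eq_iff by (simp add: powr_def)
  qed
  have "ring_const m * ring_residue m = sqrt pi * Gamma (2 * b) / 2 powr (2 * b) / (Gamma b * Gamma (b + 1 / 2))"
  proof -
    have b2: "real m + 1 / 2 = 2 * b" by (simp add: b_def)
    show ?thesis
      unfolding ring_const_def ring_residue_def rGamma_inverse_Gamma b2
      by (simp add: inverse_eq_divide mult.commute)
  qed
  also have "\<dots> = 1 / (2 powr (2 * b) * 2 powr (1 - 2 * b))"
    unfolding dup using G(1) by (simp add: field_simps)
  also have "\<dots> = 1 / 2" by (simp flip: powr_add)
  finally show ?thesis .
qed

lemma legendreQ_half:
  assumes "x > 1"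
  shows "legendreQ 0 (of_nat m - 1 / 2) (of_real x) = of_real (ring_const m * ringQ m x)"
proof -
  define b where "b = (real m + 1 / 2) / 2"
  have y: "\<bar>(1 / x)\<^sup>2\<bar> < 1" using assms by (intro quotient_square_less_1) simp
  have "hyp2F1_reg ((of_nat m - 1 / 2 + 0) / 2 + 1) ((of_nat m - 1 / 2 + 0 + 1) / 2) (of_nat m - 1 / 2 + 3 / 2) (1 / (of_real x)\<^sup>2)
     = hyp2F1_reg (of_real (b + 1 / 2)) (of_real b) (of_real (real m + 1)) (of_real ((1 / x)\<^sup>2))"
  proof -
    have "(of_nat m - 1 / 2 + 0) / 2 + 1 = complex_of_real (b + 1 / 2)"
         "(of_nat m - 1 / 2 + 0 + 1) / 2 = complex_of_real b"
         "of_nat m - 1 / 2 + 3 / 2 = complex_of_real (real m + 1)"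
         "1 / (of_real x)\<^sup>2 = complex_of_real ((1 / x)\<^sup>2)"
      by (simp_all add: b_def field_simps)
    then show ?thesis by (simp only:)
  qed
  also have "\<dots> = hyp2F1_reg_series (of_real (b + 1 / 2)) (of_real b) (of_real (real m + 1)) (of_real ((1 / x)\<^sup>2))"
  proof (rule hyp2F1_reg_eq_series)
    show "norm (complex_of_real ((1 / x)\<^sup>2)) < 1" unfolding norm_of_real by (rule y)
  qed (simp_all add: b_def field_simps)
  also have "\<dots> = (\<Sum>k. of_real (ring_coeff m k * ((1 / x)\<^sup>2) ^ k))"
    unfolding hyp2F1_reg_series_of_real ring_coeff_def b_def by simp
  also have "\<dots> = of_real (\<Sum>k. ring_coeff m k * ((1 / x)\<^sup>2) ^ k)"
    using conv1_ring_coeff y unfolding conv1_def by (intro suminf_of_real[symmetric]) blast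
  finally have hyp: "hyp2F1_reg ((of_nat m - 1 / 2 + 0) / 2 + 1) ((of_nat m - 1 / 2 + 0 + 1) / 2) (of_nat m - 1 / 2 + 3 / 2) (1 / (of_real x)\<^sup>2)
      = complex_of_real (\<Sum>k. ring_coeff m k * ((1 / x)\<^sup>2) ^ k)" .
  \<comment> \<open>\<open>powr\<close> with exponent 0 is 1 only at a nonzero base, so the factor
    with power \<open>mu / 2 = 0\<close> needs this.\<close>
  have x2: "(complex_of_real x)\<^sup>2 - 1 \<noteq> 0"
  proof -
    have "x\<^sup>2 - 1 \<noteq> 0" using assms by (simp add: power2_eq_1_iff)
    then have "complex_of_real (x\<^sup>2 - 1) \<noteq> 0" unfolding of_real_eq_0_iff .
    then show ?thesis by simp
  qed
  have p1: "(2::complex) powr (of_nat m - 1 / 2 + 1) = of_real (2 powr (real m + 1 / 2))"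
    using powr_of_real[of 2 "real m + 1 / 2"] by (simp add: add.commute)
  have p2: "complex_of_real x powr (of_nat m - 1 / 2 + 0 + 1) = of_real (x powr (real m + 1 / 2))"
    using powr_of_real[of x "real m + 1 / 2"] assms by (simp add: add.commute)
  have G: "Gamma (of_nat m - 1 / 2 + 0 + 1 :: complex) = of_real (Gamma (real m + 1 / 2))"
    using Gamma_complex_of_real[of "real m + 1 / 2"] by (simp add: add.commute)
  show ?thesis
    unfolding legendreQ_def hyp p1 p2 G ring_const_def ringQ_def qser_def
    using x2 by (simp add: powr_minus field_simps)
qed

subsection \<open>The kernel in oblate spheroidal coordinates\<close>

lemma tanh_real_deriv: "(tanh has_real_derivative 1 - (tanh s)\<^sup>2) (at (s::real))"
  by (auto intro!: derivative_eq_intros)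

lemma tanh_square_eq: "(tanh (s::real))\<^sup>2 = 1 - 1 / (cosh s)\<^sup>2"
proof -
  have "(cosh s)\<^sup>2 \<noteq> 0" by simp
  then show ?thesis using cosh_square_eq[of s] by (simp add: tanh_def power_divide field_simps)
qed

lemma cosh_powr_deriv:
  "((\<lambda>s. cosh s powr \<beta>) has_real_derivative cosh s powr \<beta> * (\<beta> * tanh s)) (at (s::real))"
proof -
  have "((\<lambda>s. cosh s powr \<beta>) has_real_derivative \<beta> * cosh s powr (\<beta> - 1) * sinh s) (at s)"
    by (auto intro!: derivative_eq_intros)
  also have "\<beta> * cosh s powr (\<beta> - 1) * sinh s = cosh s powr \<beta> * (\<beta> * tanh s)"
    by (simp add: powr_diff tanh_def)
  finally show ?thesis .
qed

text \<open>Multiplication by \<open>cosh\<^sup>\<beta>\<close> removes the first-order term of the equation.\<close>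

lemma liouville_cosh:
  fixes f f1 f2 :: "real \<Rightarrow> real"
  assumes "(f has_real_derivative f1 s) (at s)" "(f1 has_real_derivative f2 s) (at s)"
    and ode: "f2 s + 2 * \<beta> * tanh s * f1 s + \<beta>\<^sup>2 * f s = l * f s"
  shows "((\<lambda>s. cosh s powr \<beta> * f s) has_real_derivative cosh s powr \<beta> * (f1 s + \<beta> * tanh s * f s)) (at s)"
    and "((\<lambda>s. cosh s powr \<beta> * (f1 s + \<beta> * tanh s * f s)) has_real_derivative
           (l - \<beta> * (\<beta> - 1) / (cosh s)\<^sup>2) * (cosh s powr \<beta> * f s)) (at s)"
proof -
  show "((\<lambda>s. cosh s powr \<beta> * f s) has_real_derivative cosh s powr \<beta> * (f1 s + \<beta> * tanh s * f s)) (at s)"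
    by (rule DERIV_cong[OF DERIV_mult[OF cosh_powr_deriv assms(1)]]) (simp add: algebra_simps)
  have "((\<lambda>s. f1 s + \<beta> * tanh s * f s) has_real_derivative
      f2 s + (\<beta> * (1 - (tanh s)\<^sup>2) * f s + f1 s * (\<beta> * tanh s))) (at s)"
    by (intro DERIV_add DERIV_mult DERIV_cmult assms tanh_real_deriv)
  from DERIV_mult[OF cosh_powr_deriv this]
  show "((\<lambda>s. cosh s powr \<beta> * (f1 s + \<beta> * tanh s * f s)) has_real_derivative
           (l - \<beta> * (\<beta> - 1) / (cosh s)\<^sup>2) * (cosh s powr \<beta> * f s)) (at s)"
  proof (rule DERIV_cong)
    define T c where "T = tanh s" and "c = 1 / (cosh s)\<^sup>2"
    have T: "T\<^sup>2 = 1 - c" unfolding T_def c_def by (rule tanh_square_eq)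
    have "\<beta> * T * (f1 s + \<beta> * T * f s) + (f2 s + (\<beta> * (1 - T\<^sup>2) * f s + f1 s * (\<beta> * T))) = (l - \<beta> * (\<beta> - 1) * c) * f s"
      using ode T unfolding T_def[symmetric] by algebra
    then have "cosh s powr \<beta> * (\<beta> * T * (f1 s + \<beta> * T * f s) + (f2 s + (\<beta> * (1 - T\<^sup>2) * f s + f1 s * (\<beta> * T)))) =
       cosh s powr \<beta> * ((l - \<beta> * (\<beta> - 1) * c) * f s)" by simp
    then show "cosh s powr \<beta> * (\<beta> * tanh s) * (f1 s + \<beta> * tanh s * f s) +
      (f2 s + (\<beta> * (1 - (tanh s)\<^sup>2) * f s + f1 s * (\<beta> * tanh s))) * cosh s powr \<beta> =
      (l - \<beta> * (\<beta> - 1) / (cosh s)\<^sup>2) * (cosh s powr \<beta> * f s)"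
      unfolding T_def c_def by (simp add: algebra_simps)
  qed
qed

section \<open>Geometry of the kernel argument\<close>

locale ring_kernel =
  fixes m n :: nat and \<sigma>' \<theta>' :: real
  assumes mn: "m \<le> n" and s': "0 < \<sigma>'" and t': "0 < \<theta>'" "\<theta>' < pi"
begin

definition A where "A = (sinh \<sigma>')\<^sup>2 + (sin \<theta>')\<^sup>2"
definition B where "B = 2 * sinh \<sigma>' * cos \<theta>'"
definition C where "C = 2 * cosh \<sigma>' * sin \<theta>'"

lemma C_pos: "C > 0" unfolding C_def using t' by (simp add: sin_gt_zero)

text \<open>\<open>kap\<close> is \<open>\<chi> * sin \<theta>\<close>, finite at both ends of the
  interval, written with \<open>(sinh \<sigma>)^2 = (cosh \<sigma>)^2 - 1\<close> so that its
  derivatives are short. \<open>kap1\<close> and \<open>kap2\<close> are its \<sigma>-derivatives,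
  \<open>kapt\<close> its \<theta>-derivative; \<open>chit\<close> and \<open>chitt\<close> are the
  \<theta>-derivatives of \<open>chi\<close>.\<close>

definition kap :: "real \<Rightarrow> real \<Rightarrow> real" where
  "kap \<sigma> \<theta> = (cosh \<sigma> + ((sin \<theta>)\<^sup>2 + A - 1) / cosh \<sigma> - B * cos \<theta> * tanh \<sigma>) / C"

definition kap1 :: "real \<Rightarrow> real \<Rightarrow> real" where
  "kap1 \<sigma> \<theta> = (sinh \<sigma> - ((sin \<theta>)\<^sup>2 + A - 1) * sinh \<sigma> / (cosh \<sigma>)\<^sup>2 - B * cos \<theta> / (cosh \<sigma>)\<^sup>2) / C"

definition kap2 :: "real \<Rightarrow> real \<Rightarrow> real" where
  "kap2 \<sigma> \<theta> = (cosh \<sigma> + ((sin \<theta>)\<^sup>2 + A - 1) * (1 / cosh \<sigma> - 2 / cosh \<sigma> ^ 3)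
      + 2 * B * cos \<theta> * sinh \<sigma> / cosh \<sigma> ^ 3) / C"

definition kapt :: "real \<Rightarrow> real \<Rightarrow> real" where
  "kapt \<sigma> \<theta> = (2 * sin \<theta> * cos \<theta> / cosh \<sigma> + B * sin \<theta> * tanh \<sigma>) / C"

definition chi :: "real \<Rightarrow> real \<Rightarrow> real" where
  "chi \<sigma> \<theta> = kap \<sigma> \<theta> / sin \<theta>"

definition chit :: "real \<Rightarrow> real \<Rightarrow> real" where
  "chit \<sigma> \<theta> = (- (cosh \<sigma> + (A - 1) / cosh \<sigma>) * cos \<theta> / (sin \<theta>)\<^sup>2 + cos \<theta> / cosh \<sigma> + B * tanh \<sigma> / (sin \<theta>)\<^sup>2) / C"

definition chitt :: "real \<Rightarrow> real \<Rightarrow> real" where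
  "chitt \<sigma> \<theta> = ((cosh \<sigma> + (A - 1) / cosh \<sigma>) * (2 / sin \<theta> ^ 3 - 1 / sin \<theta>) - sin \<theta> / cosh \<sigma>
      - 2 * B * tanh \<sigma> * cos \<theta> / sin \<theta> ^ 3) / C"

definition num :: "real \<Rightarrow> real \<Rightarrow> real" where
  "num \<sigma> \<theta> = (sinh \<sigma>)\<^sup>2 + (sinh \<sigma>')\<^sup>2 + (sin \<theta>)\<^sup>2 + (sin \<theta>')\<^sup>2 - 2 * sinh \<sigma> * sinh \<sigma>' * cos \<theta> * cos \<theta>'"

lemma kap_num: "kap \<sigma> \<theta> = num \<sigma> \<theta> / (C * cosh \<sigma>)"
proof -
  have h: "cosh \<sigma> \<noteq> 0" by simp
  have "cosh \<sigma> + ((sin \<theta>)\<^sup>2 + A - 1) / cosh \<sigma> - B * cos \<theta> * tanh \<sigma> =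
     ((cosh \<sigma>)\<^sup>2 + ((sin \<theta>)\<^sup>2 + A - 1) - B * cos \<theta> * sinh \<sigma>) / cosh \<sigma>"
    by (simp add: tanh_def field_simps power2_eq_square)
  also have "(cosh \<sigma>)\<^sup>2 + ((sin \<theta>)\<^sup>2 + A - 1) - B * cos \<theta> * sinh \<sigma> = num \<sigma> \<theta>"
    unfolding num_def A_def B_def cosh_square_eq by simp
  finally show ?thesis unfolding kap_def by (simp add: mult.commute)
qed

text \<open>Up to normalisation the left side is the squared modulus of
  \<open>sinh u - sinh u'\<close> with \<open>u = \<sigma> + \<i> * \<theta>\<close>. The
  sum-to-product formula splits it into the squared moduli of \<open>sinh ((u - u') / 2)\<close> and
  \<open>cosh ((u + u') / 2)\<close>: the first vanishes at the source, the second at its mirror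
  image.\<close>

lemma kap_minus_sin:
  "kap \<sigma> \<theta> - sin \<theta> = (cosh (\<sigma> - \<sigma>') - cos (\<theta> - \<theta>')) * (cosh (\<sigma> + \<sigma>') + cos (\<theta> + \<theta>')) / (C * cosh \<sigma>)"
proof -
  have "num \<sigma> \<theta> - 2 * cosh \<sigma> * cosh \<sigma>' * sin \<theta> * sin \<theta>' =
     (cosh (\<sigma> - \<sigma>') - cos (\<theta> - \<theta>')) * (cosh (\<sigma> + \<sigma>') + cos (\<theta> + \<theta>'))"
    unfolding num_def cosh_diff cosh_add cos_diff cos_add
    using cosh_square_eq[of \<sigma>] cosh_square_eq[of \<sigma>'] sin_cos_squared_add[of \<theta>] sin_cos_squared_add[of \<theta>'] by algebra
  moreover have "kap \<sigma> \<theta> - sin \<theta> = (num \<sigma> \<theta> - 2 * cosh \<sigma> * cosh \<sigma>' * sin \<theta> * sin \<theta>') / (C * cosh \<sigma>)"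
    unfolding kap_num using sin_gt_zero[OF t'] by (simp add: C_def diff_divide_distrib)
  ultimately show ?thesis by simp
qed

lemma kap_deriv: "((\<lambda>\<sigma>. kap \<sigma> \<theta>) has_real_derivative kap1 \<sigma> \<theta>) (at \<sigma>)"
proof -
  have h: "cosh \<sigma> \<noteq> 0" by simp
  show ?thesis
    unfolding kap_def kap1_def using C_pos
    by (auto intro!: derivative_eq_intros simp: tanh_square_eq) (simp add: field_simps power2_eq_square)
qed

lemma kap1_deriv: "((\<lambda>\<sigma>. kap1 \<sigma> \<theta>) has_real_derivative kap2 \<sigma> \<theta>) (at \<sigma>)"
proof -
  have d1: "((\<lambda>\<sigma>. sinh \<sigma> / (cosh \<sigma>)\<^sup>2) has_real_derivative 2 / cosh \<sigma> ^ 3 - 1 / cosh \<sigma>) (at \<sigma>)"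
  proof -
    have "(cosh \<sigma> * (cosh \<sigma>)\<^sup>2 - sinh \<sigma> * (2 * cosh \<sigma> * sinh \<sigma>)) / ((cosh \<sigma>)\<^sup>2 * (cosh \<sigma>)\<^sup>2) = 2 / cosh \<sigma> ^ 3 - 1 / cosh \<sigma>"
    proof -
      have "cosh \<sigma> * (cosh \<sigma>)\<^sup>2 - sinh \<sigma> * (2 * cosh \<sigma> * sinh \<sigma>) = cosh \<sigma> * (2 - (cosh \<sigma>)\<^sup>2)"
        using cosh_square_eq[of \<sigma>] by algebra
      then show ?thesis by (simp add: field_simps power2_eq_square power3_eq_cube)
    qed
    then show ?thesis by (auto intro!: derivative_eq_intros simp: mult_ac)
  qed
  have d2: "((\<lambda>\<sigma>. 1 / (cosh \<sigma>)\<^sup>2) has_real_derivative - 2 * sinh \<sigma> / cosh \<sigma> ^ 3) (at \<sigma>)"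
    by (auto intro!: derivative_eq_intros simp: power2_eq_square power3_eq_cube)
  have "((\<lambda>\<sigma>. (sinh \<sigma> - ((sin \<theta>)\<^sup>2 + A - 1) * (sinh \<sigma> / (cosh \<sigma>)\<^sup>2) - B * cos \<theta> * (1 / (cosh \<sigma>)\<^sup>2)) / C) has_real_derivative
      (cosh \<sigma> - ((sin \<theta>)\<^sup>2 + A - 1) * (2 / cosh \<sigma> ^ 3 - 1 / cosh \<sigma>) - B * cos \<theta> * (- 2 * sinh \<sigma> / cosh \<sigma> ^ 3)) / C) (at \<sigma>)"
    by (intro DERIV_cdivide DERIV_diff DERIV_cmult d1 d2) (auto intro!: derivative_eq_intros)
  also have "(cosh \<sigma> - ((sin \<theta>)\<^sup>2 + A - 1) * (2 / cosh \<sigma> ^ 3 - 1 / cosh \<sigma>) - B * cos \<theta> * (- 2 * sinh \<sigma> / cosh \<sigma> ^ 3)) / C = kap2 \<sigma> \<theta>"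
    unfolding kap2_def by (simp add: algebra_simps)
  finally show ?thesis unfolding kap1_def by simp
qed

lemma chi_theta_deriv:
  assumes "sin \<theta> \<noteq> 0"
  shows "((\<lambda>\<theta>. chi \<sigma> \<theta>) has_real_derivative chit \<sigma> \<theta>) (at \<theta>)"
    and "((\<lambda>\<theta>. chit \<sigma> \<theta>) has_real_derivative chitt \<sigma> \<theta>) (at \<theta>)"
proof -
  have i1: "((\<lambda>\<theta>. 1 / sin \<theta>) has_real_derivative - cos \<theta> / (sin \<theta>)\<^sup>2) (at \<theta>)"
    using assms by (auto intro!: derivative_eq_intros simp: power2_eq_square)
  have i2: "((\<lambda>\<theta>. 1 / (sin \<theta>)\<^sup>2) has_real_derivative - 2 * cos \<theta> / sin \<theta> ^ 3) (at \<theta>)"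
    using assms by (auto intro!: derivative_eq_intros simp: power2_eq_square power3_eq_cube)
  have i3: "((\<lambda>\<theta>. cos \<theta> / sin \<theta>) has_real_derivative - 1 / (sin \<theta>)\<^sup>2) (at \<theta>)"
  proof -
    have eq: "- sin \<theta> * sin \<theta> - cos \<theta> * cos \<theta> = - 1"
      using sin_cos_squared_add[of \<theta>] by algebra
    have "((\<lambda>\<theta>. cos \<theta> / sin \<theta>) has_real_derivative (- sin \<theta> * sin \<theta> - cos \<theta> * cos \<theta>) / (sin \<theta> * sin \<theta>)) (at \<theta>)"
      using assms by (intro DERIV_divide DERIV_sin DERIV_cos)
    then show ?thesis unfolding eq by (simp add: power2_eq_square)
  qed
  have i4: "((\<lambda>\<theta>. cos \<theta> / (sin \<theta>)\<^sup>2) has_real_derivative 1 / sin \<theta> - 2 / sin \<theta> ^ 3) (at \<theta>)"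
  proof -
    have eq: "- sin \<theta> * (sin \<theta>)\<^sup>2 - cos \<theta> * (2 * sin \<theta> * cos \<theta>) = sin \<theta> * ((sin \<theta>)\<^sup>2 - 2)"
      using sin_cos_squared_add[of \<theta>] by algebra
    have "(- sin \<theta> * (sin \<theta>)\<^sup>2 - cos \<theta> * (2 * sin \<theta> * cos \<theta>)) / ((sin \<theta>)\<^sup>2 * (sin \<theta>)\<^sup>2) = 1 / sin \<theta> - 2 / sin \<theta> ^ 3"
      unfolding eq using assms by (simp add: field_simps power2_eq_square power3_eq_cube)
    then show ?thesis using assms by (auto intro!: derivative_eq_intros simp: mult_ac)
  qed
  \<comment> \<open>With P constant in \<theta>, \<open>chi\<close> is a combination of 1/sin, sin
    and cot, which can be differentiated term by term.\<close>
  define P where "P = cosh \<sigma> + (A - 1) / cosh \<sigma>"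
  have "((\<lambda>\<theta>. (P * (1 / sin \<theta>) + sin \<theta> / cosh \<sigma> - B * tanh \<sigma> * (cos \<theta> / sin \<theta>)) / C) has_real_derivative
      (P * (- cos \<theta> / (sin \<theta>)\<^sup>2) + cos \<theta> / cosh \<sigma> - B * tanh \<sigma> * (- 1 / (sin \<theta>)\<^sup>2)) / C) (at \<theta>)"
    by (intro DERIV_cdivide DERIV_diff DERIV_add DERIV_cmult i1 i3) (auto intro!: derivative_eq_intros)
  also have "(P * (- cos \<theta> / (sin \<theta>)\<^sup>2) + cos \<theta> / cosh \<sigma> - B * tanh \<sigma> * (- 1 / (sin \<theta>)\<^sup>2)) / C = chit \<sigma> \<theta>"
    unfolding chit_def P_def[symmetric] by simp
  finally have d: "((\<lambda>\<theta>. (P * (1 / sin \<theta>) + sin \<theta> / cosh \<sigma> - B * tanh \<sigma> * (cos \<theta> / sin \<theta>)) / C) has_real_derivative chit \<sigma> \<theta>) (at \<theta>)" .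
  have chi_eq: "chi \<sigma> \<theta> = (P * (1 / sin \<theta>) + sin \<theta> / cosh \<sigma> - B * tanh \<sigma> * (cos \<theta> / sin \<theta>)) / C" if "sin \<theta> \<noteq> 0" for \<theta>
    unfolding chi_def kap_def P_def using that C_pos by (simp add: divide_simps) (simp add: algebra_simps power2_eq_square)
  have ev: "\<forall>\<^sub>F \<theta> in nhds \<theta>. sin \<theta> \<noteq> 0"
  proof -
    have "open {\<theta>::real. sin \<theta> \<noteq> 0}" by (intro open_Collect_neq continuous_intros)
    from eventually_nhds_in_open[OF this] show ?thesis using assms by simp
  qed
  show "((\<lambda>\<theta>. chi \<sigma> \<theta>) has_real_derivative chit \<sigma> \<theta>) (at \<theta>)"
    by (rule iffD2[OF DERIV_cong_ev[OF refl _ refl] d]) (use ev in eventually_elim, rule chi_eq)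
  have "((\<lambda>\<theta>. (- P * (cos \<theta> / (sin \<theta>)\<^sup>2) + cos \<theta> / cosh \<sigma> + B * tanh \<sigma> * (1 / (sin \<theta>)\<^sup>2)) / C) has_real_derivative
      (- P * (1 / sin \<theta> - 2 / sin \<theta> ^ 3) + - sin \<theta> / cosh \<sigma> + B * tanh \<sigma> * (- 2 * cos \<theta> / sin \<theta> ^ 3)) / C) (at \<theta>)"
    by (intro DERIV_cdivide DERIV_diff DERIV_add DERIV_cmult i2 i4) (auto intro!: derivative_eq_intros)
  also have "(- P * (1 / sin \<theta> - 2 / sin \<theta> ^ 3) + - sin \<theta> / cosh \<sigma> + B * tanh \<sigma> * (- 2 * cos \<theta> / sin \<theta> ^ 3)) / C = chitt \<sigma> \<theta>"
    unfolding chitt_def P_def by (simp add: algebra_simps)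
  finally show "((\<lambda>\<theta>. chit \<sigma> \<theta>) has_real_derivative chitt \<sigma> \<theta>) (at \<theta>)"
    unfolding chit_def P_def by simp
qed

lemma chit_kapt:
  assumes "sin \<theta> \<noteq> 0"
  shows "chit \<sigma> \<theta> * (sin \<theta>)\<^sup>2 = kapt \<sigma> \<theta> * sin \<theta> - kap \<sigma> \<theta> * cos \<theta>"
proof -
  have "kapt \<sigma> \<theta> * sin \<theta> - kap \<sigma> \<theta> * cos \<theta> =
    (2 * (sin \<theta>)\<^sup>2 * cos \<theta> / cosh \<sigma> + B * (sin \<theta>)\<^sup>2 * tanh \<sigma> - (cosh \<sigma> + (A - 1) / cosh \<sigma>) * cos \<theta> - (sin \<theta>)\<^sup>2 * cos \<theta> / cosh \<sigma> + B * (cos \<theta>)\<^sup>2 * tanh \<sigma>) / C"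
    unfolding kapt_def kap_def using C_pos by (simp add: divide_simps) (simp add: algebra_simps power2_eq_square)
  also have "\<dots> = (- (cosh \<sigma> + (A - 1) / cosh \<sigma>) * cos \<theta> + (sin \<theta>)\<^sup>2 * cos \<theta> / cosh \<sigma> + B * tanh \<sigma>) / C"
    unfolding cos_squared_eq by (simp add: algebra_simps)
  also have "\<dots> = chit \<sigma> \<theta> * (sin \<theta>)\<^sup>2"
    unfolding chit_def using assms C_pos by (simp add: divide_simps)
  finally show ?thesis ..
qed

text \<open>\<open>chi\<close> is the hyperbolic cosine of the distance in the half-plane metric, which is conformal to
  the coordinates \<open>(\<sigma>, \<theta>)\<close>: this is the source of the next two identities.\<close>

lemma chi_laplacian:
  assumes "sin \<theta> \<noteq> 0"
  shows "kap2 \<sigma> \<theta> / sin \<theta> + chitt \<sigma> \<theta> = 2 * chi \<sigma> \<theta> * (1 / (sin \<theta>)\<^sup>2 - 1 / (cosh \<sigma>)\<^sup>2)"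
proof -
  have h: "cosh \<sigma> \<noteq> 0" by simp
  have e: "(tanh \<sigma>) = sinh \<sigma> / cosh \<sigma>" by (simp add: tanh_def)
  show ?thesis
    unfolding kap2_def chitt_def chi_def kap_def e using assms h C_pos
    by (simp add: divide_simps) (simp add: algebra_simps power2_eq_square power3_eq_cube)
qed

lemma chi_gradient:
  assumes "sin \<theta> \<noteq> 0"
  shows "(kap1 \<sigma> \<theta> / sin \<theta>)\<^sup>2 + (chit \<sigma> \<theta>)\<^sup>2 = ((chi \<sigma> \<theta>)\<^sup>2 - 1) * (1 / (sin \<theta>)\<^sup>2 - 1 / (cosh \<sigma>)\<^sup>2)"
proof -
  define k h s c where "k = sinh \<sigma>" and "h = cosh \<sigma>" and "s = sin \<theta>" and "c = cos \<theta>"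
  define K H S Q where "K = sinh \<sigma>'" and "H = cosh \<sigma>'" and "S = sin \<theta>'" and "Q = cos \<theta>'"
  define N where "N = k\<^sup>2 + K\<^sup>2 + s\<^sup>2 + S\<^sup>2 - 2 * k * K * c * Q"
  have nz: "h \<noteq> 0" "s \<noteq> 0" "H \<noteq> 0" "S \<noteq> 0"
    using assms C_pos by (auto simp: h_def s_def H_def S_def C_def)
  have rel: "h\<^sup>2 = k\<^sup>2 + 1" "H\<^sup>2 = K\<^sup>2 + 1" "s\<^sup>2 + c\<^sup>2 = 1" "S\<^sup>2 + Q\<^sup>2 = 1"
    by (simp_all add: h_def k_def H_def K_def s_def c_def S_def Q_def cosh_square_eq)
  have NN: "num \<sigma> \<theta> = N" unfolding N_def num_def k_def K_def s_def S_def c_def Q_def by simp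
  have CC: "C = 2 * H * S" unfolding C_def H_def S_def ..
  have chi: "chi \<sigma> \<theta> = N / (2 * H * S * h * s)"
    unfolding chi_def kap_num NN CC h_def s_def by simp
  have chis: "kap1 \<sigma> \<theta> / sin \<theta> = ((2 * k - 2 * K * c * Q) * h\<^sup>2 - N * k) / (2 * H * S * h\<^sup>2 * s)"
  proof -
    have "kap1 \<sigma> \<theta> / sin \<theta> = (k * h\<^sup>2 - (s\<^sup>2 + A - 1) * k - B * c) / (2 * H * S * h\<^sup>2 * s)"
      unfolding kap1_def CC h_def[symmetric] k_def[symmetric] s_def[symmetric] c_def[symmetric]
      using nz by (simp add: field_simps)
    also have "k * h\<^sup>2 - (s\<^sup>2 + A - 1) * k - B * c = (2 * k - 2 * K * c * Q) * h\<^sup>2 - N * k"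
      unfolding A_def B_def K_def[symmetric] S_def[symmetric] Q_def[symmetric] N_def using rel(1) by algebra
    finally show ?thesis .
  qed
  have chit: "chit \<sigma> \<theta> = ((2 * s * c + 2 * k * K * s * Q) * s - N * c) / (2 * H * S * h * s\<^sup>2)"
  proof -
    have "chit \<sigma> \<theta> = (kapt \<sigma> \<theta> * s - kap \<sigma> \<theta> * c) / s\<^sup>2"
      using chit_kapt[OF assms, of \<sigma>] nz unfolding s_def c_def by (simp add: field_simps)
    also have "kapt \<sigma> \<theta> = (2 * s * c + 2 * k * K * s * Q) / (2 * H * S * h)"
      unfolding kapt_def CC B_def tanh_def s_def[symmetric] c_def[symmetric] h_def[symmetric] k_def[symmetric] K_def[symmetric] Q_def[symmetric]
      using nz by (simp add: field_simps)
    also have "kap \<sigma> \<theta> = N / (2 * H * S * h)" unfolding kap_num NN CC h_def ..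
    also have "((2 * s * c + 2 * k * K * s * Q) / (2 * H * S * h) * s - N / (2 * H * S * h) * c) / s\<^sup>2 =
        ((2 * s * c + 2 * k * K * s * Q) * s - N * c) / (2 * H * S * h * s\<^sup>2)"
      by (simp add: diff_divide_distrib[symmetric])
    finally show ?thesis .
  qed
  \<comment> \<open>The left side is expanded as a quadratic in N. By a1, a2 and a3 each coefficient
    has the factor \<open>h^2 - s^2\<close>, and a4 turns the linear and constant terms into the
    square of the denominator.\<close>
  have key: "s\<^sup>2 * ((2 * k - 2 * K * c * Q) * h\<^sup>2 - N * k)\<^sup>2 + h\<^sup>2 * ((2 * s * c + 2 * k * K * s * Q) * s - N * c)\<^sup>2
     = (N\<^sup>2 - (2 * H * S * h * s)\<^sup>2) * (h\<^sup>2 - s\<^sup>2)"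
  proof -
    have a1: "k\<^sup>2 * s\<^sup>2 + c\<^sup>2 * h\<^sup>2 = h\<^sup>2 - s\<^sup>2" using rel(1,3) by algebra
    have a2: "k\<^sup>2 + c\<^sup>2 = h\<^sup>2 - s\<^sup>2" using rel(1,3) by algebra
    have a3: "h\<^sup>2 * (k - K * c * Q)\<^sup>2 + s\<^sup>2 * (c + k * K * Q)\<^sup>2 = (h\<^sup>2 - s\<^sup>2) * (k\<^sup>2 + s\<^sup>2 - 2 * k * K * c * Q + K\<^sup>2 * Q\<^sup>2)"
      using rel(1,3) by algebra
    have a4: "N - (k\<^sup>2 + s\<^sup>2 - 2 * k * K * c * Q + K\<^sup>2 * Q\<^sup>2) = H\<^sup>2 * S\<^sup>2"
      unfolding N_def using rel(2,4) by algebra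
    have "s\<^sup>2 * ((2 * k - 2 * K * c * Q) * h\<^sup>2 - N * k)\<^sup>2 + h\<^sup>2 * ((2 * s * c + 2 * k * K * s * Q) * s - N * c)\<^sup>2
      = N\<^sup>2 * (k\<^sup>2 * s\<^sup>2 + c\<^sup>2 * h\<^sup>2) - 4 * N * h\<^sup>2 * s\<^sup>2 * (k\<^sup>2 + c\<^sup>2)
        + 4 * h\<^sup>2 * s\<^sup>2 * (h\<^sup>2 * (k - K * c * Q)\<^sup>2 + s\<^sup>2 * (c + k * K * Q)\<^sup>2)"
      by algebra
    also have "\<dots> = (N\<^sup>2 - 4 * h\<^sup>2 * s\<^sup>2 * (N - (k\<^sup>2 + s\<^sup>2 - 2 * k * K * c * Q + K\<^sup>2 * Q\<^sup>2))) * (h\<^sup>2 - s\<^sup>2)"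
      unfolding a1 a2 a3 by algebra
    also have "\<dots> = (N\<^sup>2 - (2 * H * S * h * s)\<^sup>2) * (h\<^sup>2 - s\<^sup>2)" unfolding a4 by algebra
    finally show ?thesis .
  qed
  define X Y where "X = (2 * k - 2 * K * c * Q) * h\<^sup>2 - N * k" and "Y = (2 * s * c + 2 * k * K * s * Q) * s - N * c"
  have "(kap1 \<sigma> \<theta> / sin \<theta>)\<^sup>2 + (chit \<sigma> \<theta>)\<^sup>2 = (s\<^sup>2 * X\<^sup>2 + h\<^sup>2 * Y\<^sup>2) / ((2 * H * S * h * s)\<^sup>2 * (h\<^sup>2 * s\<^sup>2))"
  proof -
    define D where "D = 2 * H * S * h * s"
    have D: "D \<noteq> 0" "2 * H * S * h\<^sup>2 * s = D * h" "2 * H * S * h * s\<^sup>2 = D * s"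
      using nz by (simp_all add: D_def power2_eq_square mult_ac)
    have "(X / (D * h))\<^sup>2 + (Y / (D * s))\<^sup>2 = (s\<^sup>2 * X\<^sup>2 + h\<^sup>2 * Y\<^sup>2) / (D\<^sup>2 * (h\<^sup>2 * s\<^sup>2))"
      using nz D(1) by (simp add: power_divide power_mult_distrib add_divide_distrib)
    then show ?thesis
      unfolding chis chit X_def[symmetric] Y_def[symmetric] D(2,3) D_def[symmetric] .
  qed
  also have "\<dots> = (N\<^sup>2 - (2 * H * S * h * s)\<^sup>2) * (h\<^sup>2 - s\<^sup>2) / ((2 * H * S * h * s)\<^sup>2 * (h\<^sup>2 * s\<^sup>2))"
    unfolding X_def Y_def key ..
  also have "\<dots> = (N\<^sup>2 - (2 * H * S * h * s)\<^sup>2) / (2 * H * S * h * s)\<^sup>2 * ((h\<^sup>2 - s\<^sup>2) / (h\<^sup>2 * s\<^sup>2))"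
    by simp
  also have "(N\<^sup>2 - (2 * H * S * h * s)\<^sup>2) / (2 * H * S * h * s)\<^sup>2 = (chi \<sigma> \<theta>)\<^sup>2 - 1"
    unfolding chi using nz by (simp add: diff_divide_distrib power_divide)
  also have "(h\<^sup>2 - s\<^sup>2) / (h\<^sup>2 * s\<^sup>2) = 1 / (sin \<theta>)\<^sup>2 - 1 / (cosh \<sigma>)\<^sup>2"
    using nz unfolding h_def s_def by (simp add: diff_divide_distrib)
  finally show ?thesis .
qed

end

lemma powr_minus_shift:
  fixes x a :: real
  assumes "x > 0"
  shows "x powr (- (a + 1)) * x = x powr (- a)" "x powr (- (a + 1 + 1)) * x\<^sup>2 = x powr (- a)"
  using assms powr_add[of x "- (a + 1)" 1] powr_add[of x "- (a + 1 + 1)" 2] by (simp_all add: powr_numeral)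

lemma sin_powr_deriv:
  assumes "sin \<theta> > 0"
  shows "((\<lambda>\<theta>. sin \<theta> powr \<beta>) has_real_derivative sin \<theta> powr \<beta> * (\<beta> * (cos \<theta> / sin \<theta>))) (at \<theta>)"
proof -
  have "((\<lambda>\<theta>. sin \<theta> powr \<beta>) has_real_derivative \<beta> * sin \<theta> powr (\<beta> - 1) * cos \<theta>) (at \<theta>)"
    using assms by (auto intro!: derivative_eq_intros)
  also have "\<beta> * sin \<theta> powr (\<beta> - 1) * cos \<theta> = sin \<theta> powr \<beta> * (\<beta> * (cos \<theta> / sin \<theta>))"
    using assms by (simp add: powr_diff)
  finally show ?thesis .
qed

lemma cosh_gt_1: "x \<noteq> 0 \<Longrightarrow> cosh (x::real) > 1"
  using cosh_real_ge_1[of x] by (auto simp: le_less)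

section \<open>The integrand, its derivatives and Green's identity\<close>

context ring_kernel
begin

abbreviation "\<mu> \<equiv> real m + 1 / 2"
abbreviation "e0 \<equiv> ring_coeff m"
abbreviation "e1 \<equiv> qshift \<mu> e0"
abbreviation "e2 \<equiv> qshift (\<mu> + 1) e1"

definition wpoly :: "real \<Rightarrow> real" where
  "wpoly \<theta> = poly (legendre_deriv m n) (cos \<theta>)"

definition wpoly1 :: "real \<Rightarrow> real" where
  "wpoly1 \<theta> = - sin \<theta> * poly (pderiv (legendre_deriv m n)) (cos \<theta>)"

text \<open>The Ferrers function contributes m of the exponent \<mu> and the weight
  \<open>sqrt (sin \<theta>)\<close> the remaining 1/2; the sign \<open>(-1) ^ m\<close> is left
  out.\<close>

definition wh :: "real \<Rightarrow> real" where
  "wh \<theta> = sin \<theta> powr \<mu> * wpoly \<theta>"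

definition wh1 :: "real \<Rightarrow> real" where
  "wh1 \<theta> = sin \<theta> powr \<mu> * (\<mu> * (cos \<theta> / sin \<theta>) * wpoly \<theta> + wpoly1 \<theta>)"

lemma wpoly_deriv: "(wpoly has_real_derivative wpoly1 \<theta>) (at \<theta>)"
  unfolding wpoly_def wpoly1_def
  by (rule DERIV_cong[OF DERIV_chain2[OF poly_DERIV DERIV_cos]]) simp

lemma wpoly_ode:
  assumes "sin \<theta> > 0"
  obtains w2 where "(wpoly1 has_real_derivative w2) (at \<theta>)"
    "w2 + 2 * \<mu> * (cos \<theta> / sin \<theta>) * wpoly1 \<theta> = - ((real n - real m) * (real n + real m + 1)) * wpoly \<theta>"
proof
  define Y where "Y = legendre_deriv m n"
  define w2 where "w2 = - cos \<theta> * poly (pderiv Y) (cos \<theta>) + (sin \<theta>)\<^sup>2 * poly (pderiv (pderiv Y)) (cos \<theta>)"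
  show "(wpoly1 has_real_derivative w2) (at \<theta>)"
    unfolding wpoly1_def w2_def Y_def[symmetric]
    by (rule DERIV_cong[OF DERIV_mult[OF DERIV_minus[OF DERIV_sin] DERIV_chain2[OF poly_DERIV DERIV_cos]]])
       (simp add: power2_eq_square)
  have "poly ([:-1, 0, 1:] * pderiv (pderiv Y) + smult (2 * (real m + 1)) ([:0, 1:] * pderiv Y)) (cos \<theta>)
       = poly (smult ((real n - real m) * (real n + real m + 1)) Y) (cos \<theta>)"
    unfolding Y_def legendre_deriv_ode[OF mn] ..
  then have ode: "((cos \<theta>)\<^sup>2 - 1) * poly (pderiv (pderiv Y)) (cos \<theta>) + 2 * (real m + 1) * cos \<theta> * poly (pderiv Y) (cos \<theta>)
     = (real n - real m) * (real n + real m + 1) * poly Y (cos \<theta>)"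
    by (simp add: algebra_simps power2_eq_square)
  have "2 * \<mu> * (cos \<theta> / sin \<theta>) * wpoly1 \<theta> = - (2 * real m + 1) * cos \<theta> * poly (pderiv Y) (cos \<theta>)"
    unfolding wpoly1_def Y_def[symmetric] using assms by (simp add: field_simps)
  moreover have "(sin \<theta>)\<^sup>2 = 1 - (cos \<theta>)\<^sup>2" by (rule sin_squared_eq)
  ultimately show "w2 + 2 * \<mu> * (cos \<theta> / sin \<theta>) * wpoly1 \<theta> = - ((real n - real m) * (real n + real m + 1)) * wpoly \<theta>"
    unfolding w2_def wpoly_def Y_def[symmetric] using ode by algebra
qed

text \<open>The power \<open>\<mu> = m + 1/2\<close> of the sine is the one that removes the
  first-order term. The coefficient of \<open>1 / (sin \<theta>)^2\<close> then agrees with that in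
  the equation for the kernel, so the two cancel in Green's identity.\<close>

lemma wh_deriv:
  assumes "sin \<theta> > 0"
  shows "(wh has_real_derivative wh1 \<theta>) (at \<theta>)"
    and "(wh1 has_real_derivative (((real m)\<^sup>2 - 1 / 4) / (sin \<theta>)\<^sup>2 - (real n + 1 / 2)\<^sup>2) * wh \<theta>) (at \<theta>)"
proof -
  show "(wh has_real_derivative wh1 \<theta>) (at \<theta>)"
    unfolding wh_def wh1_def
    by (rule DERIV_cong[OF DERIV_mult[OF sin_powr_deriv[OF assms] wpoly_deriv]]) (simp add: algebra_simps)
  obtain w2 where w2: "(wpoly1 has_real_derivative w2) (at \<theta>)"
    "w2 + 2 * \<mu> * (cos \<theta> / sin \<theta>) * wpoly1 \<theta> = - ((real n - real m) * (real n + real m + 1)) * wpoly \<theta>"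
    using wpoly_ode[OF assms] by blast
  have cot: "((\<lambda>\<theta>. cos \<theta> / sin \<theta>) has_real_derivative - 1 - (cos \<theta> / sin \<theta>)\<^sup>2) (at \<theta>)"
    using assms by (auto intro!: derivative_eq_intros simp: field_simps power2_eq_square)
  have "((\<lambda>\<theta>. \<mu> * (cos \<theta> / sin \<theta>) * wpoly \<theta> + wpoly1 \<theta>) has_real_derivative
      \<mu> * (- 1 - (cos \<theta> / sin \<theta>)\<^sup>2) * wpoly \<theta> + wpoly1 \<theta> * (\<mu> * (cos \<theta> / sin \<theta>)) + w2) (at \<theta>)"
    by (intro DERIV_add DERIV_mult DERIV_cmult cot wpoly_deriv w2)
  from DERIV_mult[OF sin_powr_deriv[OF assms] this]
  show "(wh1 has_real_derivative (((real m)\<^sup>2 - 1 / 4) / (sin \<theta>)\<^sup>2 - (real n + 1 / 2)\<^sup>2) * wh \<theta>) (at \<theta>)"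
    unfolding wh1_def
  proof (rule DERIV_cong)
    define c q where "c = cos \<theta> / sin \<theta>" and "q = 1 / (sin \<theta>)\<^sup>2"
    have cq: "c\<^sup>2 = q - 1"
      using assms unfolding c_def q_def power_divide cos_squared_eq by (simp add: diff_divide_distrib)
    have "\<mu> * c * (\<mu> * c * wpoly \<theta> + wpoly1 \<theta>) + (\<mu> * (- 1 - c\<^sup>2) * wpoly \<theta> + wpoly1 \<theta> * (\<mu> * c) + w2)
        = (\<mu>\<^sup>2 * c\<^sup>2 + \<mu> * (- 1 - c\<^sup>2)) * wpoly \<theta> + (w2 + 2 * \<mu> * c * wpoly1 \<theta>)"
      by (simp add: algebra_simps power2_eq_square)
    also have "\<dots> = (((real m)\<^sup>2 - 1 / 4) * q - (real n + 1 / 2)\<^sup>2) * wpoly \<theta>"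
    proof -
      have coef: "(((real m)\<^sup>2 - 1 / 4) * q - (real n + 1 / 2)\<^sup>2) =
          (\<mu>\<^sup>2 * (q - 1) + \<mu> * (- 1 - (q - 1))) - (real n - real m) * (real n + real m + 1)"
        by (simp add: field_simps power2_eq_square)
      show ?thesis
        unfolding w2(2)[folded c_def] cq coef by (rule trans[OF _ left_diff_distrib[symmetric]]) simp
    qed
    finally have main: "\<mu> * c * (\<mu> * c * wpoly \<theta> + wpoly1 \<theta>) + (\<mu> * (- 1 - c\<^sup>2) * wpoly \<theta> + wpoly1 \<theta> * (\<mu> * c) + w2)
        = (((real m)\<^sup>2 - 1 / 4) * q - (real n + 1 / 2)\<^sup>2) * wpoly \<theta>" .
    have fac: "E * (a * c) * z + u * E = E * (a * c * z + u)" for E a z u :: real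
      by (simp only: distrib_left mult_ac)
    show "sin \<theta> powr \<mu> * (\<mu> * (cos \<theta> / sin \<theta>)) * (\<mu> * (cos \<theta> / sin \<theta>) * wpoly \<theta> + wpoly1 \<theta>) +
        (\<mu> * (- 1 - (cos \<theta> / sin \<theta>)\<^sup>2) * wpoly \<theta> + wpoly1 \<theta> * (\<mu> * (cos \<theta> / sin \<theta>)) + w2) * sin \<theta> powr \<mu> =
        (((real m)\<^sup>2 - 1 / 4) / (sin \<theta>)\<^sup>2 - (real n + 1 / 2)\<^sup>2) * wh \<theta>"
      unfolding c_def[symmetric] wh_def fac main by (simp add: q_def mult_ac)
  qed
qed

text \<open>The integrand and, below, its first two \<sigma>-derivatives, in a form continuous up to
  the end points. The exponent \<open>2 * m + 1 = \<mu> + \<mu>\<close> arises because one \<mu>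
  comes from \<open>wh\<close> and the other from making the kernel homogeneous.\<close>

definition k0 :: "real \<Rightarrow> real \<Rightarrow> real" where
  "k0 \<sigma> \<theta> = sin \<theta> ^ (2 * m + 1) * wpoly \<theta> * qser \<mu> e0 (sin \<theta>) (kap \<sigma> \<theta>)"

definition k1 :: "real \<Rightarrow> real \<Rightarrow> real" where
  "k1 \<sigma> \<theta> = sin \<theta> ^ (2 * m + 1) * wpoly \<theta> * (qser (\<mu> + 1) e1 (sin \<theta>) (kap \<sigma> \<theta>) * kap1 \<sigma> \<theta>)"

definition k2 :: "real \<Rightarrow> real \<Rightarrow> real" where
  "k2 \<sigma> \<theta> = sin \<theta> ^ (2 * m + 1) * wpoly \<theta> *
     (qser (\<mu> + 1 + 1) e2 (sin \<theta>) (kap \<sigma> \<theta>) * kap1 \<sigma> \<theta> * kap1 \<sigma> \<theta> + kap2 \<sigma> \<theta> * qser (\<mu> + 1) e1 (sin \<theta>) (kap \<sigma> \<theta>))"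

definition K0 :: "real \<Rightarrow> real" where "K0 \<sigma> = integral {0..pi} (k0 \<sigma>)"
definition K1 :: "real \<Rightarrow> real" where "K1 \<sigma> = integral {0..pi} (k1 \<sigma>)"
definition K2 :: "real \<Rightarrow> real" where "K2 \<sigma> = integral {0..pi} (k2 \<sigma>)"

text \<open>Both factors of \<open>kap - sin\<close> are positive away from the source and from the
  line carrying its mirror image. The strict inequality is the convergence condition of
  \<open>qser\<close>, and in the interior it says \<open>chi > 1\<close>.\<close>

lemma sin_less_kap:
  assumes "0 \<le> \<theta>" "\<theta> \<le> pi" and "\<sigma> \<noteq> \<sigma>' \<or> \<theta> \<noteq> \<theta>'" "\<sigma> \<noteq> - \<sigma>'"
  shows "\<bar>sin \<theta>\<bar> < kap \<sigma> \<theta>"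
proof -
  have "cos (\<theta> - \<theta>') < cosh (\<sigma> - \<sigma>')"
  proof (cases "\<sigma> = \<sigma>'")
    case True
    with assms have "\<theta> \<noteq> \<theta>'" by simp
    then have "cos \<bar>\<theta> - \<theta>'\<bar> < cos 0" using assms t' by (intro cos_monotone_0_pi) auto
    then show ?thesis using True by simp
  next
    case False
    then show ?thesis using cosh_gt_1[of "\<sigma> - \<sigma>'"] cos_le_one[of "\<theta> - \<theta>'"] by linarith
  qed
  moreover have "cosh (\<sigma> + \<sigma>') + cos (\<theta> + \<theta>') > 0"
    using cosh_gt_1[of "\<sigma> + \<sigma>'"] cos_ge_minus_one[of "\<theta> + \<theta>'"] assms(4) by linarith
  ultimately have "kap \<sigma> \<theta> - sin \<theta> > 0"
    unfolding kap_minus_sin using C_pos by (intro divide_pos_pos mult_pos_pos) auto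
  then show ?thesis using sin_ge_zero[OF assms(1,2)] by simp
qed

lemma chi_gt_1:
  assumes "0 < \<theta>" "\<theta> < pi" and "\<sigma> \<noteq> \<sigma>' \<or> \<theta> \<noteq> \<theta>'" "\<sigma> \<noteq> - \<sigma>'"
  shows "chi \<sigma> \<theta> > 1"
  using sin_less_kap[of \<theta> \<sigma>] assms sin_gt_zero[of \<theta>] by (simp add: chi_def)

lemma qser_chi:
  assumes "0 < \<theta>" "\<theta> < pi" and "\<sigma> \<noteq> \<sigma>' \<or> \<theta> \<noteq> \<theta>'" "\<sigma> \<noteq> - \<sigma>'"
  shows "qser \<nu> e (sin \<theta>) (kap \<sigma> \<theta>) = sin \<theta> powr (- \<nu>) * qser \<nu> e 1 (chi \<sigma> \<theta>)"
proof -
  have "kap \<sigma> \<theta> > 0" using sin_less_kap[of \<theta> \<sigma>] assms by simp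
  then show ?thesis
    unfolding chi_def using sin_gt_zero[OF assms(1,2)] by (subst qser_scale) auto
qed

lemma sin_power_powr:
  assumes "s > 0"
  shows "s ^ (2 * m + 1) * s powr (- \<mu>) = s powr \<mu>"
    and "s ^ (2 * m + 1) * s powr (- (\<mu> + 1)) = s powr \<mu> / s"
    and "s ^ (2 * m + 1) * s powr (- (\<mu> + 1 + 1)) = s powr \<mu> / s\<^sup>2"
proof -
  have "s ^ (2 * m + 1) = s powr (real (2 * m + 1))" using assms by (simp only: powr_realpow)
  also have "real (2 * m + 1) = \<mu> + \<mu>" by simp
  finally have e: "s ^ (2 * m + 1) = s powr \<mu> * s powr \<mu>" by (simp only: powr_add)
  have d: "s powr (- (\<mu> + 1)) = s powr (- \<mu>) / s" "s powr (- (\<mu> + 1 + 1)) = s powr (- \<mu>) / s\<^sup>2"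
    using assms powr_diff[of s "- \<mu>" 1] powr_diff[of s "- \<mu>" 2] by (simp_all add: powr_numeral)
  show "s ^ (2 * m + 1) * s powr (- \<mu>) = s powr \<mu>"
    unfolding e using assms by (simp add: powr_minus field_simps)
  then show "s ^ (2 * m + 1) * s powr (- (\<mu> + 1)) = s powr \<mu> / s"
    "s ^ (2 * m + 1) * s powr (- (\<mu> + 1 + 1)) = s powr \<mu> / s\<^sup>2"
    unfolding d by (simp_all only: times_divide_eq_right)
qed

lemma k_interior:
  assumes "0 < \<theta>" "\<theta> < pi" and "\<sigma> \<noteq> \<sigma>' \<or> \<theta> \<noteq> \<theta>'" "\<sigma> \<noteq> - \<sigma>'"
  shows "k0 \<sigma> \<theta> = wh \<theta> * ringQ m (chi \<sigma> \<theta>)"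
    and "k1 \<sigma> \<theta> = wh \<theta> * (ringQ1 m (chi \<sigma> \<theta>) * (kap1 \<sigma> \<theta> / sin \<theta>))"
    and "k2 \<sigma> \<theta> = wh \<theta> * (ringQ2 m (chi \<sigma> \<theta>) * (kap1 \<sigma> \<theta> / sin \<theta>)\<^sup>2 + ringQ1 m (chi \<sigma> \<theta>) * (kap2 \<sigma> \<theta> / sin \<theta>))"
proof -
  have s: "sin \<theta> > 0" using assms by (simp add: sin_gt_zero)
  note p = sin_power_powr[OF s]
  have "k0 \<sigma> \<theta> = (sin \<theta> ^ (2 * m + 1) * sin \<theta> powr (- \<mu>)) * wpoly \<theta> * ringQ m (chi \<sigma> \<theta>)"
    unfolding k0_def qser_chi[OF assms] ringQ_def by (simp only: mult_ac)
  then show "k0 \<sigma> \<theta> = wh \<theta> * ringQ m (chi \<sigma> \<theta>)" unfolding p wh_def .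
  have "k1 \<sigma> \<theta> = (sin \<theta> ^ (2 * m + 1) * sin \<theta> powr (- (\<mu> + 1))) * wpoly \<theta> * (ringQ1 m (chi \<sigma> \<theta>) * kap1 \<sigma> \<theta>)"
    unfolding k1_def qser_chi[OF assms] ringQ1_def by (simp only: mult_ac)
  then show "k1 \<sigma> \<theta> = wh \<theta> * (ringQ1 m (chi \<sigma> \<theta>) * (kap1 \<sigma> \<theta> / sin \<theta>))"
    unfolding p wh_def by simp
  have "k2 \<sigma> \<theta> = (sin \<theta> ^ (2 * m + 1) * sin \<theta> powr (- (\<mu> + 1 + 1))) * wpoly \<theta> * (ringQ2 m (chi \<sigma> \<theta>) * kap1 \<sigma> \<theta> * kap1 \<sigma> \<theta>)
      + (sin \<theta> ^ (2 * m + 1) * sin \<theta> powr (- (\<mu> + 1))) * wpoly \<theta> * (ringQ1 m (chi \<sigma> \<theta>) * kap2 \<sigma> \<theta>)"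
    unfolding k2_def qser_chi[OF assms] ringQ2_def ringQ1_def distrib_left by (simp only: mult_ac)
  then show "k2 \<sigma> \<theta> = wh \<theta> * (ringQ2 m (chi \<sigma> \<theta>) * (kap1 \<sigma> \<theta> / sin \<theta>)\<^sup>2 + ringQ1 m (chi \<sigma> \<theta>) * (kap2 \<sigma> \<theta> / sin \<theta>))"
    unfolding p wh_def by (simp add: distrib_left power2_eq_square)
qed

lemma continuous_on_kap [continuous_intros]:
  fixes f g :: "'b :: t2_space \<Rightarrow> real"
  assumes "continuous_on S f" "continuous_on S g"
  shows "continuous_on S (\<lambda>x. kap (f x) (g x))" "continuous_on S (\<lambda>x. kap1 (f x) (g x))"
    "continuous_on S (\<lambda>x. kap2 (f x) (g x))" "continuous_on S (\<lambda>x. kapt (f x) (g x))"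
  unfolding kap_def kap1_def kap2_def kapt_def tanh_def using assms C_pos
  by (auto intro!: continuous_intros)

lemma continuous_on_wpoly [continuous_intros]:
  fixes g :: "'b :: t2_space \<Rightarrow> real"
  assumes "continuous_on S g"
  shows "continuous_on S (\<lambda>x. wpoly (g x))" "continuous_on S (\<lambda>x. wpoly1 (g x))"
  unfolding wpoly_def wpoly1_def using assms by (auto intro!: continuous_intros)

lemma conv1_e: "conv1 e0" "conv1 e1" "conv1 e2" "conv1 (diffs e0)"
  by (intro conv1_ring_coeff conv1_qshift conv1_diffs)+

lemma continuous_on_k:
  fixes f g :: "'b :: t2_space \<Rightarrow> real"
  assumes "continuous_on S f" "continuous_on S g"
    and "\<And>x. x \<in> S \<Longrightarrow> g x \<in> {0..pi} \<and> (f x \<noteq> \<sigma>' \<or> g x \<noteq> \<theta>') \<and> f x \<noteq> - \<sigma>'"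
  shows "continuous_on S (\<lambda>x. k0 (f x) (g x))" "continuous_on S (\<lambda>x. k1 (f x) (g x))"
    "continuous_on S (\<lambda>x. k2 (f x) (g x))"
proof -
  have less: "\<bar>sin (g x)\<bar> < kap (f x) (g x)" if "x \<in> S" for x
    using assms(3)[OF that] by (intro sin_less_kap) auto
  show "continuous_on S (\<lambda>x. k0 (f x) (g x))"
    unfolding k0_def by (intro continuous_intros assms(1,2) conv1_e less)
  show "continuous_on S (\<lambda>x. k1 (f x) (g x))"
    unfolding k1_def by (intro continuous_intros assms(1,2) conv1_e less)
  show "continuous_on S (\<lambda>x. k2 (f x) (g x))"
    unfolding k2_def by (intro continuous_intros assms(1,2) conv1_e less)
qed

lemma k_integrable:
  assumes "\<sigma> \<noteq> \<sigma>'" "\<sigma> \<noteq> - \<sigma>'"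
  shows "k0 \<sigma> integrable_on {0..pi}" "k1 \<sigma> integrable_on {0..pi}" "k2 \<sigma> integrable_on {0..pi}"
  using assms by (auto intro!: integrable_continuous_real continuous_on_k continuous_intros)

lemma k_deriv:
  assumes "\<theta> \<in> {0..pi}" "\<sigma> \<noteq> \<sigma>'" "\<sigma> \<noteq> - \<sigma>'"
  shows "((\<lambda>\<sigma>. k0 \<sigma> \<theta>) has_real_derivative k1 \<sigma> \<theta>) (at \<sigma>)"
    and "((\<lambda>\<sigma>. k1 \<sigma> \<theta>) has_real_derivative k2 \<sigma> \<theta>) (at \<sigma>)"
proof -
  have less: "\<bar>sin \<theta>\<bar> < kap \<sigma> \<theta>" using assms by (intro sin_less_kap) auto
  note q0 = DERIV_chain2[OF qser_deriv[OF conv1_e(1) less] kap_deriv, of \<mu>]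
  note q1 = DERIV_chain2[OF qser_deriv[OF conv1_e(2) less] kap_deriv, of "\<mu> + 1"]
  show "((\<lambda>\<sigma>. k0 \<sigma> \<theta>) has_real_derivative k1 \<sigma> \<theta>) (at \<sigma>)"
    unfolding k0_def k1_def by (rule DERIV_cmult[OF q0])
  show "((\<lambda>\<sigma>. k1 \<sigma> \<theta>) has_real_derivative k2 \<sigma> \<theta>) (at \<sigma>)"
    unfolding k1_def k2_def by (rule DERIV_cmult[OF DERIV_mult[OF q1 kap1_deriv]])
qed

lemma K_deriv:
  assumes "\<sigma> \<noteq> \<sigma>'" "\<sigma> \<noteq> - \<sigma>'"
  shows "(K0 has_real_derivative K1 \<sigma>) (at \<sigma>)" "(K1 has_real_derivative K2 \<sigma>) (at \<sigma>)"
proof -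
  obtain r where r: "r > 0" "ball \<sigma> r \<subseteq> - {\<sigma>', - \<sigma>'}"
    using open_contains_ball[of "- {\<sigma>', - \<sigma>'}"] assms by (auto simp: open_Compl)
  then have U: "x \<noteq> \<sigma>'" "x \<noteq> - \<sigma>'" if "x \<in> ball \<sigma> r" for x using that by auto
  have UU: "\<not> dist \<sigma> \<sigma>' < r" "\<not> dist \<sigma> (- \<sigma>') < r" using U(1)[of \<sigma>'] U(2)[of "- \<sigma>'"] by auto
  have within: "at \<sigma> within ball \<sigma> r = at \<sigma>" using r by (intro at_within_open) auto
  have "((\<lambda>x. integral (cbox 0 pi) (k0 x)) has_real_derivative integral (cbox 0 pi) (k1 \<sigma>)) (at \<sigma> within ball \<sigma> r)"
  proof (rule leibniz_rule_field_derivative)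
    show "continuous_on (ball \<sigma> r \<times> cbox 0 pi) (\<lambda>(x, t). k1 x t)"
      unfolding case_prod_beta by (rule continuous_on_k(2)) (use UU in \<open>auto intro!: continuous_intros\<close>)
  qed (use r U k_deriv k_integrable in \<open>auto intro: has_field_derivative_at_within\<close>)
  then show "(K0 has_real_derivative K1 \<sigma>) (at \<sigma>)" unfolding within K0_def K1_def by simp
  have "((\<lambda>x. integral (cbox 0 pi) (k1 x)) has_real_derivative integral (cbox 0 pi) (k2 \<sigma>)) (at \<sigma> within ball \<sigma> r)"
  proof (rule leibniz_rule_field_derivative)
    show "continuous_on (ball \<sigma> r \<times> cbox 0 pi) (\<lambda>(x, t). k2 x t)"
      unfolding case_prod_beta by (rule continuous_on_k(3)) (use UU in \<open>auto intro!: continuous_intros\<close>)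
  qed (use r U k_deriv k_integrable in \<open>auto intro: has_field_derivative_at_within\<close>)
  then show "(K1 has_real_derivative K2 \<sigma>) (at \<sigma>)" unfolding within K1_def K2_def by simp
qed

text \<open>The boundary term of Green's identity in \<open>\<theta>\<close>, written so that its factor \<open>sin \<theta> ^ (2 * m + 1)\<close>
  is visible and it extends continuously by zero to the end points.\<close>

definition green :: "real \<Rightarrow> real \<Rightarrow> real" where
  "green \<sigma> \<theta> = sin \<theta> ^ (2 * m + 1) * (qser \<mu> e0 (sin \<theta>) (kap \<sigma> \<theta>) * wpoly1 \<theta>
     - (kapt \<sigma> \<theta> * qser (\<mu> + 1) e1 (sin \<theta>) (kap \<sigma> \<theta>)
        + 2 * sin \<theta> * cos \<theta> * qser (\<mu> + 1 + 1) (diffs e0) (sin \<theta>) (kap \<sigma> \<theta>)) * wpoly \<theta>)"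

text \<open>In the interior form both terms contain a quotient by \<open>sin \<theta>\<close>. These
  singular parts cancel by Euler's relation for the homogeneous series, which leaves the regular
  expression \<open>green\<close>.\<close>

lemma green_interior:
  assumes \<theta>: "0 < \<theta>" "\<theta> < pi" and "\<sigma> \<noteq> \<sigma>'" "\<sigma> \<noteq> - \<sigma>'"
  shows "green \<sigma> \<theta> = ringQ m (chi \<sigma> \<theta>) * wh1 \<theta> - ringQ1 m (chi \<sigma> \<theta>) * chit \<sigma> \<theta> * wh \<theta>"
proof -
  define s c \<kappa> where "s = sin \<theta>" and "c = cos \<theta>" and "\<kappa> = kap \<sigma> \<theta>"
  have s: "s > 0" using \<theta> by (simp add: s_def sin_gt_zero)
  have less: "\<bar>s\<bar> < \<kappa>" unfolding s_def \<kappa>_def using assms by (intro sin_less_kap) auto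
  then have \<kappa>: "\<kappa> > 0" by linarith
  define V V1 D where "V = qser \<mu> e0 s \<kappa>" and "V1 = qser (\<mu> + 1) e1 s \<kappa>" and "D = qser (\<mu> + 1 + 1) (diffs e0) s \<kappa>"
  \<comment> \<open>Euler's relation in degree \<open>- \<mu>\<close>: \<open>\<kappa> * V1\<close>
    is the radial derivative in the second argument, and \<open>2 * s^2 * D\<close> that in the
    first.\<close>
  have rel: "\<kappa> * V1 = - \<mu> * V - 2 * s\<^sup>2 * D"
  proof -
    have sq: "\<bar>(s / \<kappa>)\<^sup>2\<bar> < 1" using less by (rule quotient_square_less_1)
    have "(\<Sum>k. e1 k * ((s / \<kappa>)\<^sup>2) ^ k) = - \<mu> * (\<Sum>k. e0 k * ((s / \<kappa>)\<^sup>2) ^ k) - 2 * (s / \<kappa>)\<^sup>2 * (\<Sum>k. diffs e0 k * ((s / \<kappa>)\<^sup>2) ^ k)"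
      by (rule sums_unique[OF qshift_sums[OF conv1_e(1) sq], symmetric])
    moreover have "\<kappa> powr (- (\<mu> + 1)) * \<kappa> = \<kappa> powr (- \<mu>)" "\<kappa> powr (- (\<mu> + 1 + 1)) * \<kappa>\<^sup>2 = \<kappa> powr (- \<mu>)"
      by (rule powr_minus_shift[OF \<kappa>])+
    moreover have "(s / \<kappa>)\<^sup>2 * \<kappa>\<^sup>2 = s\<^sup>2" using \<kappa> by (simp add: power_divide)
    ultimately show ?thesis unfolding V_def V1_def D_def qser_def by algebra
  qed
  have chit: "chit \<sigma> \<theta> * s\<^sup>2 = kapt \<sigma> \<theta> * s - \<kappa> * c"
    unfolding s_def c_def \<kappa>_def by (rule chit_kapt) (use s in \<open>simp add: s_def\<close>)
  have Q: "V = s powr (- \<mu>) * ringQ m (chi \<sigma> \<theta>)" "V1 = s powr (- (\<mu> + 1)) * ringQ1 m (chi \<sigma> \<theta>)"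
    unfolding V_def V1_def ringQ_def ringQ1_def s_def \<kappa>_def by (rule qser_chi; use assms in simp)+
  define E where "E = s powr \<mu>"
  have E: "s powr (- \<mu>) = 1 / E" "s powr (- (\<mu> + 1)) = 1 / (E * s)" "E \<noteq> 0"
  proof -
    show E1: "s powr (- \<mu>) = 1 / E" "E \<noteq> 0"
      using s unfolding E_def powr_minus by (simp_all add: inverse_eq_divide)
    show "s powr (- (\<mu> + 1)) = 1 / (E * s)"
      using powr_minus_shift(1)[OF s, of \<mu>] s E1 by (simp add: field_simps)
  qed
  have Q': "ringQ m (chi \<sigma> \<theta>) = E * V" "ringQ1 m (chi \<sigma> \<theta>) = E * s * V1"
    unfolding Q E using E s by simp_all
  have pw: "s ^ (2 * m + 1) = E * E"
    using sin_power_powr(1)[OF s, folded E_def] E(3) unfolding E(1) by (simp add: divide_eq_eq)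
  have w: "wh \<theta> = E * wpoly \<theta>" "wh1 \<theta> = E * (\<mu> * (c / s) * wpoly \<theta> + wpoly1 \<theta>)"
    unfolding wh_def wh1_def E_def s_def c_def by simp_all
  have "s * (V * (\<mu> * (c / s) * wpoly \<theta> + wpoly1 \<theta>) - s * V1 * chit \<sigma> \<theta> * wpoly \<theta>)
     = V * \<mu> * c * wpoly \<theta> + V * wpoly1 \<theta> * s - V1 * (chit \<sigma> \<theta> * s\<^sup>2) * wpoly \<theta>"
    using s by (simp add: field_simps power2_eq_square)
  also have "\<dots> = V * \<mu> * c * wpoly \<theta> + V * wpoly1 \<theta> * s - V1 * kapt \<sigma> \<theta> * s * wpoly \<theta> + c * (\<kappa> * V1) * wpoly \<theta>"
    unfolding chit by (simp add: algebra_simps)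
  also have "\<dots> = s * (V * wpoly1 \<theta> - (kapt \<sigma> \<theta> * V1 + 2 * s * c * D) * wpoly \<theta>)"
    unfolding rel by (simp add: algebra_simps power2_eq_square)
  finally have "V * (\<mu> * (c / s) * wpoly \<theta> + wpoly1 \<theta>) - s * V1 * chit \<sigma> \<theta> * wpoly \<theta> =
     V * wpoly1 \<theta> - (kapt \<sigma> \<theta> * V1 + 2 * s * c * D) * wpoly \<theta>" using s by simp
  then have "E * E * (V * (\<mu> * (c / s) * wpoly \<theta> + wpoly1 \<theta>) - s * V1 * chit \<sigma> \<theta> * wpoly \<theta>) =
     E * E * (V * wpoly1 \<theta> - (kapt \<sigma> \<theta> * V1 + 2 * s * c * D) * wpoly \<theta>)" by simp
  then show ?thesis
    unfolding green_def Q' w s_def[symmetric] c_def[symmetric] \<kappa>_def[symmetric] V_def[symmetric] V1_def[symmetric] D_def[symmetric] pw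
    by (simp only: right_diff_distrib mult_ac)
qed

text \<open>The difference of the two sides is the integral of an exact \<theta>-derivative, and its
  boundary values vanish through the factor \<open>sin \<theta> ^ (2 * m + 1)\<close>.\<close>

lemma K_ode:
  assumes "\<sigma> \<noteq> \<sigma>'" "\<sigma> \<noteq> - \<sigma>'"
  shows "K2 \<sigma> = ((real n + 1 / 2)\<^sup>2 - \<mu> * (\<mu> - 1) / (cosh \<sigma>)\<^sup>2) * K0 \<sigma>"
proof -
  define l where "l = (real n + 1 / 2)\<^sup>2 - \<mu> * (\<mu> - 1) / (cosh \<sigma>)\<^sup>2"
  have "((\<lambda>\<theta>. k2 \<sigma> \<theta> - l * k0 \<sigma> \<theta>) has_integral green \<sigma> pi - green \<sigma> 0) {0..pi}"
  proof (rule fundamental_theorem_of_calculus_interior)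
    show "continuous_on {0..pi} (green \<sigma>)"
    proof -
      have "\<bar>sin x\<bar> < kap \<sigma> x" if "x \<in> {0..pi}" for x using that assms by (intro sin_less_kap) auto
      then show ?thesis unfolding green_def by (intro continuous_intros conv1_e; assumption)
    qed
    fix \<theta> assume "\<theta> \<in> {0<..<pi}"
    then have \<theta>: "0 < \<theta>" "\<theta> < pi" by auto
    have s: "sin \<theta> > 0" using \<theta> by (simp add: sin_gt_zero)
    have chi1: "chi \<sigma> \<theta> > 1" using \<theta> assms by (intro chi_gt_1) auto
    have d0: "((\<lambda>\<theta>. ringQ m (chi \<sigma> \<theta>)) has_real_derivative ringQ1 m (chi \<sigma> \<theta>) * chit \<sigma> \<theta>) (at \<theta>)"
      by (rule DERIV_chain2[where f = "ringQ m" and g = "chi \<sigma>", OF ringQ_deriv[OF chi1]])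
         (rule chi_theta_deriv, use s in simp)
    have d1: "((\<lambda>\<theta>. ringQ1 m (chi \<sigma> \<theta>)) has_real_derivative ringQ2 m (chi \<sigma> \<theta>) * chit \<sigma> \<theta>) (at \<theta>)"
      by (rule DERIV_chain2[where f = "ringQ1 m" and g = "chi \<sigma>", OF ringQ1_deriv[OF chi1]])
         (rule chi_theta_deriv, use s in simp)
    have d2: "((\<lambda>\<theta>. chit \<sigma> \<theta>) has_real_derivative chitt \<sigma> \<theta>) (at \<theta>)" using s by (intro chi_theta_deriv) simp
    have "((\<lambda>\<theta>. ringQ m (chi \<sigma> \<theta>) * wh1 \<theta> - ringQ1 m (chi \<sigma> \<theta>) * chit \<sigma> \<theta> * wh \<theta>) has_real_derivative
       k2 \<sigma> \<theta> - l * k0 \<sigma> \<theta>) (at \<theta>)"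
    proof (rule DERIV_cong[OF DERIV_diff[OF DERIV_mult[OF d0 wh_deriv(2)[OF s]] DERIV_mult[OF DERIV_mult[OF d1 d2] wh_deriv(1)[OF s]]]])
      define q h where "q = 1 / (sin \<theta>)\<^sup>2" and "h = 1 / (cosh \<sigma>)\<^sup>2"
      define \<Lambda> where "\<Lambda> = q - h"
      define X where "X = chi \<sigma> \<theta>"
      define a1 a2 where "a1 = kap1 \<sigma> \<theta> / sin \<theta>" and "a2 = kap2 \<sigma> \<theta> / sin \<theta>"
      \<comment> \<open>By the chain rule the Laplacian of \<open>Q(\<chi>)\<close> is Q'' times I1
        plus Q' times I2. The common factor \<Lambda> leaves the Legendre operator, hence
        \<open>\<Lambda> * (m^2 - 1/4) * Q\<close>.\<close>
      have I1: "a1\<^sup>2 + (chit \<sigma> \<theta>)\<^sup>2 = (X\<^sup>2 - 1) * \<Lambda>"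
        unfolding a1_def X_def \<Lambda>_def q_def h_def using s by (intro chi_gradient) simp
      have I2: "a2 + chitt \<sigma> \<theta> = 2 * X * \<Lambda>"
        unfolding a2_def X_def \<Lambda>_def q_def h_def using s by (intro chi_laplacian) simp
      have ode: "(X\<^sup>2 - 1) * ringQ2 m X + 2 * X * ringQ1 m X = ((real m)\<^sup>2 - 1 / 4) * ringQ m X"
        unfolding X_def by (rule ringQ_ode[OF chi1])
      have mu: "\<mu> * (\<mu> - 1) = (real m)\<^sup>2 - 1 / 4" by (simp add: algebra_simps power2_eq_square)
      have k: "k2 \<sigma> \<theta> = wh \<theta> * (ringQ2 m X * a1\<^sup>2 + ringQ1 m X * a2)" "k0 \<sigma> \<theta> = wh \<theta> * ringQ m X"
        unfolding X_def a1_def a2_def by (rule k_interior; use \<theta> assms in simp)+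
      have l: "l = (real n + 1 / 2)\<^sup>2 - ((real m)\<^sup>2 - 1 / 4) * h" unfolding l_def mu h_def by simp
      have q: "((real m)\<^sup>2 - 1 / 4) / (sin \<theta>)\<^sup>2 = ((real m)\<^sup>2 - 1 / 4) * q" by (simp add: q_def)
      define M N R0 R1 R2 W W1 T T2 where "M = (real m)\<^sup>2 - 1 / 4" and "N = (real n + 1 / 2)\<^sup>2"
        and "R0 = ringQ m X" and "R1 = ringQ1 m X" and "R2 = ringQ2 m X" and "W = wh \<theta>" and "W1 = wh1 \<theta>"
        and "T = chit \<sigma> \<theta>" and "T2 = chitt \<sigma> \<theta>"
      note abbr = M_def[symmetric] N_def[symmetric] R0_def[symmetric] R1_def[symmetric] R2_def[symmetric]
        W_def[symmetric] W1_def[symmetric] T_def[symmetric] T2_def[symmetric]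
      show "ringQ1 m (chi \<sigma> \<theta>) * chit \<sigma> \<theta> * wh1 \<theta> +
        (((real m)\<^sup>2 - 1 / 4) / (sin \<theta>)\<^sup>2 - (real n + 1 / 2)\<^sup>2) * wh \<theta> * ringQ m (chi \<sigma> \<theta>) -
        ((ringQ2 m (chi \<sigma> \<theta>) * chit \<sigma> \<theta> * chit \<sigma> \<theta> + chitt \<sigma> \<theta> * ringQ1 m (chi \<sigma> \<theta>)) * wh \<theta> +
         wh1 \<theta> * (ringQ1 m (chi \<sigma> \<theta>) * chit \<sigma> \<theta>)) = k2 \<sigma> \<theta> - l * k0 \<sigma> \<theta>"
        unfolding k l q X_def[symmetric] unfolding abbr
        using I1[unfolded abbr] I2[unfolded abbr] ode[unfolded abbr] \<Lambda>_def by algebra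
    qed
    moreover have "\<forall>\<^sub>F \<theta> in nhds \<theta>. green \<sigma> \<theta> = ringQ m (chi \<sigma> \<theta>) * wh1 \<theta> - ringQ1 m (chi \<sigma> \<theta>) * chit \<sigma> \<theta> * wh \<theta>"
      by (rule eventually_mono[OF eventually_nhds_in_open[of "{0<..<pi}"]])
         (use \<theta> assms in \<open>auto intro!: green_interior\<close>)
    ultimately have "(green \<sigma> has_real_derivative k2 \<sigma> \<theta> - l * k0 \<sigma> \<theta>) (at \<theta>)"
      by (subst DERIV_cong_ev[OF refl _ refl])
    then show "(green \<sigma> has_vector_derivative k2 \<sigma> \<theta> - l * k0 \<sigma> \<theta>) (at \<theta>)"
      by (rule has_real_derivative_iff_has_vector_derivative[THEN iffD1])
  qed simp
  also have "green \<sigma> pi - green \<sigma> 0 = 0" by (simp add: green_def)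
  finally have "integral {0..pi} (\<lambda>\<theta>. k2 \<sigma> \<theta> - l * k0 \<sigma> \<theta>) = 0" by (rule integral_unique)
  moreover have "(\<lambda>\<theta>. l * k0 \<sigma> \<theta>) integrable_on {0..pi}"
    using integrable_cmul[OF k_integrable(1)[OF assms], of l] by simp
  ultimately show ?thesis
    unfolding K2_def K0_def l_def[symmetric] using k_integrable(3)[OF assms]
    by (subst (asm) integral_diff) auto
qed

end

subsection \<open>The Poisson kernel\<close>

text \<open>Jordan's inequality with a weaker constant: up to \<open>pi / 4\<close> the sine has
  slope at least \<open>sqrt 2 / 2\<close>, and doubling the angle costs the same factor
  again.\<close>

lemma half_le_sin:
  fixes x :: real
  assumes "0 \<le> x" "x \<le> pi / 2"
  shows "x / 2 \<le> sin x"
proof -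
  have small: "y * (sqrt 2 / 2) \<le> sin y" if "0 \<le> y" "y \<le> pi / 4" for y
  proof -
    have "sin 0 - 0 * (sqrt 2 / 2) \<le> sin y - y * (sqrt 2 / 2)"
    proof (rule DERIV_nonneg_imp_nondecreasing[OF that(1)])
      fix t assume t: "0 \<le> t" "t \<le> y"
      have "((\<lambda>y. sin y - y * (sqrt 2 / 2)) has_real_derivative cos t - sqrt 2 / 2) (at t)"
        by (auto intro!: derivative_eq_intros)
      moreover have "cos (pi / 4) \<le> cos t" using t that by (intro cos_monotone_0_pi_le) auto
      ultimately show "\<exists>z. ((\<lambda>y. sin y - y * (sqrt 2 / 2)) has_real_derivative z) (at t) \<and> 0 \<le> z"
        by (auto simp: cos_45)
    qed
    then show ?thesis by simp
  qed
  have "cos (pi / 4) \<le> cos (x / 2)" using assms by (intro cos_monotone_0_pi_le) auto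
  then have c: "sqrt 2 / 2 \<le> cos (x / 2)" by (simp add: cos_45)
  have "x / 2 = 2 * ((x / 2) * (sqrt 2 / 2)) * (sqrt 2 / 2)" by simp
  also have "\<dots> \<le> 2 * sin (x / 2) * cos (x / 2)"
    using small[of "x / 2"] c assms by (intro mult_mono) (auto intro!: sin_ge_zero)
  also have "\<dots> = sin x" using sin_double[of "x / 2"] by simp
  finally show ?thesis .
qed

lemma one_minus_cos_ge:
  fixes t :: real
  assumes "\<bar>t\<bar> \<le> pi"
  shows "t\<^sup>2 / 8 \<le> 1 - cos t"
proof -
  have "\<bar>t\<bar> / 2 / 2 \<le> sin (\<bar>t\<bar> / 2)" using assms by (intro half_le_sin) auto
  then have "(\<bar>t\<bar> / 2 / 2)\<^sup>2 \<le> (sin (\<bar>t\<bar> / 2))\<^sup>2" by (intro power_mono) auto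
  moreover have "cos \<bar>t\<bar> = 1 - 2 * (sin (\<bar>t\<bar> / 2))\<^sup>2" using cos_double_sin[of "\<bar>t\<bar> / 2"] by simp
  ultimately show ?thesis by (simp add: power_divide)
qed

text \<open>The antiderivative \<open>2 * sgn (x - c) * sqrt \<bar>x - c\<bar>\<close> is continuous
  across c, so c is an admissible exceptional point of the fundamental theorem.\<close>

lemma integrable_inverse_sqrt_abs: "(\<lambda>x. 1 / sqrt \<bar>x - c\<bar>) integrable_on {a..b::real}"
proof (cases "a \<le> b")
  case True
  define F where "F = (\<lambda>x. 2 * sgn (x - c) * sqrt \<bar>x - c\<bar>)"
  have "continuous_on {a..b} F"
  proof -
    have "isCont (\<lambda>y::real. sgn y * sqrt \<bar>y\<bar>) y" for y
    proof (cases "y = 0")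
      case True
      have "((\<lambda>y::real. sgn y * sqrt \<bar>y\<bar>) \<longlongrightarrow> 0) (at 0)"
      proof (rule Lim_null_comparison)
        show "\<forall>\<^sub>F y in at 0. norm (sgn y * sqrt \<bar>y\<bar>) \<le> sqrt \<bar>y\<bar>"
          by (intro always_eventually allI) (simp add: abs_mult abs_sgn_eq)
        have "((\<lambda>y::real. sqrt \<bar>y\<bar>) \<longlongrightarrow> sqrt \<bar>0\<bar>) (at 0)" by (intro tendsto_intros)
        then show "((\<lambda>y::real. sqrt \<bar>y\<bar>) \<longlongrightarrow> 0) (at 0)" by simp
      qed
      then show ?thesis using True by (simp add: isCont_def)
    qed (auto intro!: continuous_intros isCont_sgn)
    then have "continuous_on UNIV (\<lambda>y::real. sgn y * sqrt \<bar>y\<bar>)" by (simp add: continuous_on_eq_continuous_at)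
    then have "continuous_on {a..b} (\<lambda>x. sgn (x - c) * sqrt \<bar>x - c\<bar>)"
      by (rule continuous_on_compose2) (auto intro!: continuous_intros)
    from continuous_on_mult[OF continuous_on_const[of _ 2] this] show ?thesis
      unfolding F_def by (simp add: mult.assoc)
  qed
  moreover have "(F has_vector_derivative 1 / sqrt \<bar>x - c\<bar>) (at x)" if "x \<in> {a<..<b} - {c}" for x
  proof (cases "x > c")
    case True
    have "((\<lambda>x. 2 * sqrt (x - c)) has_real_derivative 1 / sqrt \<bar>x - c\<bar>) (at x)"
      using True by (auto intro!: derivative_eq_intros simp: field_simps)
    moreover have "\<forall>\<^sub>F x in nhds x. F x = 2 * sqrt (x - c)"
      by (rule eventually_mono[OF eventually_nhds_in_open[of "{c<..}"]]) (use True in \<open>auto simp: F_def\<close>)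
    ultimately have "(F has_real_derivative 1 / sqrt \<bar>x - c\<bar>) (at x)" by (subst DERIV_cong_ev[OF refl _ refl])
    then show ?thesis by (rule has_real_derivative_iff_has_vector_derivative[THEN iffD1])
  next
    case False
    then have x: "x < c" using that by auto
    have "((\<lambda>x. - 2 * sqrt (c - x)) has_real_derivative 1 / sqrt \<bar>x - c\<bar>) (at x)"
      using x by (auto intro!: derivative_eq_intros simp: field_simps)
    moreover have "\<forall>\<^sub>F x in nhds x. F x = - 2 * sqrt (c - x)"
      by (rule eventually_mono[OF eventually_nhds_in_open[of "{..<c}"]]) (use x in \<open>auto simp: F_def\<close>)
    ultimately have "(F has_real_derivative 1 / sqrt \<bar>x - c\<bar>) (at x)" by (subst DERIV_cong_ev[OF refl _ refl])
    then show ?thesis by (rule has_real_derivative_iff_has_vector_derivative[THEN iffD1])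
  qed
  ultimately have "((\<lambda>x. 1 / sqrt \<bar>x - c\<bar>) has_integral (F b - F a)) {a..b}"
    by (intro fundamental_theorem_of_calculus_interior_strong[of "{c}"]) (use True in auto)
  then show ?thesis by blast
qed auto

text \<open>The Poisson kernel of the disc for radius \<open>exp (- \<epsilon>)\<close>. It appears
  here as the \<epsilon>-derivative of \<open>ln (cosh \<epsilon> - cos t)\<close>.\<close>

definition poisson :: "real \<Rightarrow> real \<Rightarrow> real" where
  "poisson \<epsilon> t = sinh \<epsilon> / (cosh \<epsilon> - cos t)"

lemma cosh_minus_cos_pos: "\<epsilon> \<noteq> 0 \<Longrightarrow> cosh \<epsilon> - cos t > (0::real)"
  using cosh_real_ge_1[of \<epsilon>] cos_le_one[of t] by (auto simp: le_less intro: order.strict_trans1)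

text \<open>The half-angle antiderivative has no jump on the interval, because
  \<open>\<bar>\<theta> - c\<bar> < pi\<close> keeps the tangent away from its poles.\<close>

lemma poisson_has_integral:
  assumes \<epsilon>: "\<epsilon> > 0" and c: "0 < c" "c < pi"
  defines "q \<equiv> cosh (\<epsilon> / 2) / sinh (\<epsilon> / 2)"
  shows "((\<lambda>\<theta>. poisson \<epsilon> (\<theta> - c)) has_integral (2 * arctan (q * tan ((pi - c) / 2)) + 2 * arctan (q * tan (c / 2)))) {0..pi}"
proof -
  define F where "F = (\<lambda>\<theta>. 2 * arctan (q * tan ((\<theta> - c) / 2)))"
  have "(F has_real_derivative poisson \<epsilon> (\<theta> - c)) (at \<theta>)" if "\<theta> \<in> {0..pi}" for \<theta>
  proof -
    define y where "y = (\<theta> - c) / 2"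
    have "- (pi / 2) < y" "y < pi / 2" using that c by (auto simp: y_def)
    then have cy: "cos y > 0" by (intro cos_gt_zero_pi) auto
    define S K where "S = sinh (\<epsilon> / 2)" and "K = cosh (\<epsilon> / 2)"
    have S: "S > 0" "K > 0" using \<epsilon> by (simp_all add: S_def K_def)
    have "(F has_real_derivative 2 * (inverse (1 + (q * tan y)\<^sup>2) * (q * (inverse ((cos y)\<^sup>2) * (1 / 2))))) (at \<theta>)"
      unfolding F_def y_def using cy unfolding y_def
      by (auto intro!: derivative_eq_intros simp: divide_simps)
    also have "2 * (inverse (1 + (q * tan y)\<^sup>2) * (q * (inverse ((cos y)\<^sup>2) * (1 / 2)))) = S * K / (S\<^sup>2 * (cos y)\<^sup>2 + K\<^sup>2 * (sin y)\<^sup>2)"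
    proof -
      have "1 + (q * tan y)\<^sup>2 = (S\<^sup>2 * (cos y)\<^sup>2 + K\<^sup>2 * (sin y)\<^sup>2) / (S\<^sup>2 * (cos y)\<^sup>2)"
        using S cy unfolding q_def S_def[symmetric] K_def[symmetric] tan_def
        by (simp add: field_simps power_mult_distrib)
      then have inv: "inverse (1 + (q * tan y)\<^sup>2) = (S\<^sup>2 * (cos y)\<^sup>2) / (S\<^sup>2 * (cos y)\<^sup>2 + K\<^sup>2 * (sin y)\<^sup>2)"
        by simp
      have q: "q = K / S" by (simp add: q_def S_def K_def)
      define D where "D = S\<^sup>2 * (cos y)\<^sup>2 + K\<^sup>2 * (sin y)\<^sup>2"
      show ?thesis
        unfolding inv D_def[symmetric] unfolding q using S cy by (simp add: power2_eq_square inverse_eq_divide)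
    qed
    also have "\<dots> = poisson \<epsilon> (\<theta> - c)"
    proof -
      have "sinh \<epsilon> = 2 * S * K" using sinh_double[of "\<epsilon> / 2"] by (simp add: S_def K_def)
      moreover have "cosh \<epsilon> - cos (\<theta> - c) = 2 * (S\<^sup>2 * (cos y)\<^sup>2 + K\<^sup>2 * (sin y)\<^sup>2)"
      proof -
        have "cosh \<epsilon> = 1 + 2 * S\<^sup>2" using cosh_double[of "\<epsilon> / 2"] cosh_square_eq[of "\<epsilon> / 2"] by (simp add: S_def)
        moreover have "2 * y = \<theta> - c" by (simp add: y_def)
        then have "cos (\<theta> - c) = 1 - 2 * (sin y)\<^sup>2" using cos_double_sin[of y] by simp
        moreover have "K\<^sup>2 = S\<^sup>2 + 1" by (simp add: K_def S_def cosh_square_eq)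
        ultimately show ?thesis using sin_cos_squared_add[of y] by algebra
      qed
      ultimately show ?thesis
        unfolding poisson_def by (simp only: mult.assoc mult_divide_mult_cancel_left_if) simp
    qed
    finally show ?thesis .
  qed
  then have "((\<lambda>\<theta>. poisson \<epsilon> (\<theta> - c)) has_integral (F pi - F 0)) {0..pi}"
    by (intro fundamental_theorem_of_calculus)
       (auto intro: has_field_derivative_at_within simp flip: has_real_derivative_iff_has_vector_derivative)
  moreover have "F pi - F 0 = 2 * arctan (q * tan ((pi - c) / 2)) + 2 * arctan (q * tan (c / 2))"
    by (simp add: F_def arctan_minus)
  ultimately show ?thesis by simp
qed

lemma poisson_integral_limit:
  assumes \<epsilon>: "\<And>j. \<epsilon> j > 0" "\<epsilon> \<longlonglongrightarrow> 0" and c: "0 < c" "c < pi"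
  shows "(\<lambda>j. integral {0..pi} (\<lambda>\<theta>. poisson (\<epsilon> j) (\<theta> - c))) \<longlonglongrightarrow> 2 * pi"
proof -
  define q where "q = (\<lambda>\<epsilon>::real. cosh (\<epsilon> / 2) / sinh (\<epsilon> / 2))"
  have "filterlim q at_top (at_right 0)" unfolding q_def by real_asymp
  moreover have "filterlim \<epsilon> (at_right 0) sequentially"
    unfolding filterlim_at using \<epsilon> by (auto simp: less_imp_neq[THEN not_sym])
  ultimately have q: "filterlim (\<lambda>j. q (\<epsilon> j)) at_top sequentially" by (rule filterlim_compose)
  have at: "((\<lambda>j. arctan (q (\<epsilon> j) * a)) \<longlongrightarrow> pi / 2) sequentially" if "a > 0" for a
    by (rule filterlim_compose[OF tendsto_arctan_at_top])
       (rule filterlim_at_top_mult_tendsto_pos[OF tendsto_const that q, THEN filterlim_cong[THEN iffD1, rotated -1]], auto simp: mult.commute)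
  have t: "tan ((pi - c) / 2) > 0" "tan (c / 2) > 0" using c by (auto intro!: tan_gt_zero)
  have "(\<lambda>j. 2 * arctan (q (\<epsilon> j) * tan ((pi - c) / 2)) + 2 * arctan (q (\<epsilon> j) * tan (c / 2))) \<longlonglongrightarrow> 2 * (pi / 2) + 2 * (pi / 2)"
    by (intro tendsto_intros at t)
  moreover have "integral {0..pi} (\<lambda>\<theta>. poisson (\<epsilon> j) (\<theta> - c)) =
     2 * arctan (q (\<epsilon> j) * tan ((pi - c) / 2)) + 2 * arctan (q (\<epsilon> j) * tan (c / 2))" for j
    unfolding q_def by (rule integral_unique[OF poisson_has_integral[OF \<epsilon>(1) c]])
  ultimately show ?thesis by simp
qed

text \<open>An approximate identity applied to functions that vary with j. Closeness to L is
  therefore required eventually in j, on a neighbourhood of c independent of j; away from c the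
  kernel is at most \<open>sinh \<epsilon> / (1 - cos \<delta>)\<close>, which tends to 0.\<close>

lemma poisson_limit:
  fixes \<phi> :: "nat \<Rightarrow> real \<Rightarrow> real"
  assumes \<epsilon>: "\<And>j. \<epsilon> j > 0" "\<epsilon> \<longlonglongrightarrow> 0" and c: "0 < c" "c < pi"
    and bound: "\<And>j \<theta>. \<theta> \<in> {0..pi} \<Longrightarrow> \<bar>\<phi> j \<theta>\<bar> \<le> M"
    and int: "\<And>j. (\<lambda>\<theta>. \<phi> j \<theta> * poisson (\<epsilon> j) (\<theta> - c)) integrable_on {0..pi}"
    and lim: "\<And>\<eta>. \<eta> > 0 \<Longrightarrow> \<exists>\<delta>>0. \<forall>\<^sub>F j in sequentially. \<forall>\<theta>\<in>{0..pi}. \<bar>\<theta> - c\<bar> < \<delta> \<longrightarrow> \<bar>\<phi> j \<theta> - L\<bar> \<le> \<eta>"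
  shows "(\<lambda>j. integral {0..pi} (\<lambda>\<theta>. \<phi> j \<theta> * poisson (\<epsilon> j) (\<theta> - c))) \<longlonglongrightarrow> 2 * pi * L"
proof -
  define I where "I = (\<lambda>j. integral {0..pi} (\<lambda>\<theta>. poisson (\<epsilon> j) (\<theta> - c)))"
  have I: "I \<longlonglongrightarrow> 2 * pi" unfolding I_def by (rule poisson_integral_limit[OF \<epsilon> c])
  have Pint: "(\<lambda>\<theta>. poisson (\<epsilon> j) (\<theta> - c)) integrable_on {0..pi}" for j
    using poisson_has_integral[OF \<epsilon>(1) c] by blast
  have Ppos: "poisson (\<epsilon> j) t \<ge> 0" for j t
    unfolding poisson_def using \<epsilon>(1)[of j] cosh_minus_cos_pos[of "\<epsilon> j" t]
    by (intro divide_nonneg_nonneg) (auto simp: less_imp_le)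
  define d where "d = (\<lambda>j. integral {0..pi} (\<lambda>\<theta>. (\<phi> j \<theta> - L) * poisson (\<epsilon> j) (\<theta> - c)))"
  have dint: "(\<lambda>\<theta>. (\<phi> j \<theta> - L) * poisson (\<epsilon> j) (\<theta> - c)) integrable_on {0..pi}" for j
    unfolding left_diff_distrib using integrable_diff[OF int[of j] integrable_cmul[OF Pint[of j], of L]] by simp
  have split: "integral {0..pi} (\<lambda>\<theta>. \<phi> j \<theta> * poisson (\<epsilon> j) (\<theta> - c)) = d j + L * I j" for j
  proof -
    have "d j = integral {0..pi} (\<lambda>\<theta>. \<phi> j \<theta> * poisson (\<epsilon> j) (\<theta> - c)) - integral {0..pi} (\<lambda>\<theta>. L * poisson (\<epsilon> j) (\<theta> - c))"
      unfolding d_def left_diff_distrib using int[of j] integrable_cmul[OF Pint[of j], of L]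
      by (intro integral_diff) auto
    then show ?thesis by (simp add: I_def)
  qed
  have "d \<longlonglongrightarrow> 0"
  proof (rule tendstoI)
    fix e :: real assume e: "e > 0"
    \<comment> \<open>The error estimate tends to \<open>2 * pi * \<eta>\<close>, and this choice
      puts the limit strictly below e.\<close>
    define \<eta> where "\<eta> = e / (4 * pi + 2)"
    have \<eta>: "\<eta> > 0" using e pi_gt_zero by (auto simp: \<eta>_def intro!: divide_pos_pos add_pos_pos)
    obtain \<delta>0 where \<delta>0: "\<delta>0 > 0" and near0: "\<forall>\<^sub>F j in sequentially. \<forall>\<theta>\<in>{0..pi}. \<bar>\<theta> - c\<bar> < \<delta>0 \<longrightarrow> \<bar>\<phi> j \<theta> - L\<bar> \<le> \<eta>"
      using lim[OF \<eta>] by blast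
    \<comment> \<open>Capping at pi keeps \<delta> in the range where the cosine decreases.\<close>
    define \<delta> where "\<delta> = min \<delta>0 pi"
    have \<delta>: "0 < \<delta>" "\<delta> \<le> pi" "\<delta> \<le> \<delta>0" using \<delta>0 by (auto simp: \<delta>_def)
    have cd: "1 - cos \<delta> > 0" using cos_monotone_0_pi[of 0 \<delta>] \<delta> by simp
    define M' where "M' = M + \<bar>L\<bar>"
    have M': "M' \<ge> 0" using bound[of 0 0] by (simp add: M'_def) 
    have "(\<lambda>j. \<eta> * I j + M' * (sinh (\<epsilon> j) / (1 - cos \<delta>)) * pi) \<longlonglongrightarrow> \<eta> * (2 * pi) + M' * (sinh 0 / (1 - cos \<delta>)) * pi"
      using cd by (intro tendsto_intros I \<epsilon>(2)) auto
    moreover have "\<eta> * (2 * pi) + M' * (sinh 0 / (1 - cos \<delta>)) * pi < e"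
    proof -
      have "4 * pi + 2 \<noteq> 0" using pi_gt_zero by linarith
      then have "\<eta> * (4 * pi + 2) = e" by (simp add: \<eta>_def)
      moreover have "\<eta> * (2 * pi) < \<eta> * (4 * pi + 2)" using \<eta> pi_gt_zero by (intro mult_strict_left_mono) linarith+
      ultimately show ?thesis by simp
    qed
    ultimately have "\<forall>\<^sub>F j in sequentially. \<eta> * I j + M' * (sinh (\<epsilon> j) / (1 - cos \<delta>)) * pi < e"
      by (rule order_tendstoD(2))
    with near0 show "\<forall>\<^sub>F j in sequentially. dist (d j) 0 < e"
    proof eventually_elim
      case (elim j)
      have pw: "norm ((\<phi> j \<theta> - L) * poisson (\<epsilon> j) (\<theta> - c)) \<le> \<eta> * poisson (\<epsilon> j) (\<theta> - c) + M' * (sinh (\<epsilon> j) / (1 - cos \<delta>))"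
        if \<theta>: "\<theta> \<in> {0..pi}" for \<theta>
      proof (cases "\<bar>\<theta> - c\<bar> < \<delta>")
        case True
        then have "\<bar>\<phi> j \<theta> - L\<bar> \<le> \<eta>" using elim(1) \<theta> \<delta> by auto
        then have "norm ((\<phi> j \<theta> - L) * poisson (\<epsilon> j) (\<theta> - c)) \<le> \<eta> * poisson (\<epsilon> j) (\<theta> - c)"
          using Ppos[of j "\<theta> - c"] by (simp add: abs_mult mult_right_mono)
        moreover have "M' * (sinh (\<epsilon> j) / (1 - cos \<delta>)) \<ge> 0"
          using M' cd \<epsilon>(1)[of j] by (intro mult_nonneg_nonneg divide_nonneg_nonneg) auto
        ultimately show ?thesis by linarith
      next
        case False
        have "cos \<bar>\<theta> - c\<bar> \<le> cos \<delta>" using False \<theta> c \<delta> by (intro cos_monotone_0_pi_le) auto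
        then have "1 - cos \<delta> \<le> cosh (\<epsilon> j) - cos (\<theta> - c)" using cosh_real_ge_1[of "\<epsilon> j"] by simp
        then have P: "poisson (\<epsilon> j) (\<theta> - c) \<le> sinh (\<epsilon> j) / (1 - cos \<delta>)"
          unfolding poisson_def using cd \<epsilon>(1)[of j] by (intro divide_left_mono) auto
        have "\<bar>\<phi> j \<theta> - L\<bar> \<le> M'" using bound[OF \<theta>, of j] by (simp add: M'_def)
        then have "norm ((\<phi> j \<theta> - L) * poisson (\<epsilon> j) (\<theta> - c)) \<le> M' * (sinh (\<epsilon> j) / (1 - cos \<delta>))"
          using P Ppos[of j "\<theta> - c"] M' by (simp only: real_norm_def abs_mult) (intro mult_mono; simp)
        moreover have "\<eta> * poisson (\<epsilon> j) (\<theta> - c) \<ge> 0" using \<eta> Ppos[of j "\<theta> - c"] by simp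
        ultimately show ?thesis by linarith
      qed
      have rint: "((\<lambda>\<theta>. \<eta> * poisson (\<epsilon> j) (\<theta> - c) + M' * (sinh (\<epsilon> j) / (1 - cos \<delta>))) has_integral
          \<eta> * I j + M' * (sinh (\<epsilon> j) / (1 - cos \<delta>)) * pi) {0..pi}"
      proof (rule has_integral_add)
        show "((\<lambda>\<theta>. \<eta> * poisson (\<epsilon> j) (\<theta> - c)) has_integral \<eta> * I j) {0..pi}"
          unfolding I_def by (rule has_integral_mult_right[OF integrable_integral[OF Pint]])
        show "((\<lambda>\<theta>. M' * (sinh (\<epsilon> j) / (1 - cos \<delta>))) has_integral M' * (sinh (\<epsilon> j) / (1 - cos \<delta>)) * pi) {0..pi}"
          using has_integral_const_real[of "M' * (sinh (\<epsilon> j) / (1 - cos \<delta>))" 0 pi] by (simp add: mult.commute)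
      qed
      have "norm (d j) \<le> integral {0..pi} (\<lambda>\<theta>. \<eta> * poisson (\<epsilon> j) (\<theta> - c) + M' * (sinh (\<epsilon> j) / (1 - cos \<delta>)))"
        unfolding d_def using pw rint by (intro integral_norm_bound_integral dint) auto
      also have "\<dots> < e" using elim(2) integral_unique[OF rint] by simp
      finally show ?case by simp
    qed
  qed
  then have "(\<lambda>j. d j + L * I j) \<longlonglongrightarrow> 0 + L * (2 * pi)" by (intro tendsto_intros I)
  then show ?thesis unfolding split by (simp add: mult_ac)
qed

subsection \<open>Behaviour at the source point\<close>

context ring_kernel
begin

text \<open>The singularity of \<open>k1\<close> at the source point is isolated in a Poisson kernel:
  \<open>k1 = z1 * (poisson + r1)\<close> with \<open>z1\<close> and \<open>r1\<close> bounded.\<close>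

definition z1 :: "real \<Rightarrow> real \<Rightarrow> real" where
  "z1 \<sigma> \<theta> = sin \<theta> ^ (2 * m + 1) * wpoly \<theta> * ((kap \<sigma> \<theta> - sin \<theta>) * qser (\<mu> + 1) e1 (sin \<theta>) (kap \<sigma> \<theta>))"

definition r1 :: "real \<Rightarrow> real \<Rightarrow> real" where
  "r1 \<sigma> \<theta> = sinh (\<sigma> + \<sigma>') / (cosh (\<sigma> + \<sigma>') + cos (\<theta> + \<theta>')) - tanh \<sigma>"

lemma cosh_plus_cos_pos: "\<sigma> \<noteq> - \<sigma>' \<Longrightarrow> cosh (\<sigma> + \<sigma>') + cos (\<theta> + \<theta>') > 0"
  using cosh_gt_1[of "\<sigma> + \<sigma>'"] cos_ge_minus_one[of "\<theta> + \<theta>'"] by linarith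

text \<open>The logarithmic derivative in \<sigma> of the factorisation of \<open>kap - sin\<close>:
  the factor vanishing at the source yields the Poisson kernel, the other two yield
  \<open>r1\<close>.\<close>

lemma kap1_eq:
  assumes "\<sigma> \<noteq> \<sigma>'" "\<sigma> \<noteq> - \<sigma>'"
  shows "kap1 \<sigma> \<theta> = (kap \<sigma> \<theta> - sin \<theta>) * (poisson (\<sigma> - \<sigma>') (\<theta> - \<theta>') + r1 \<sigma> \<theta>)"
proof -
  define D1 D2 where "D1 = cosh (\<sigma> - \<sigma>') - cos (\<theta> - \<theta>')" and "D2 = cosh (\<sigma> + \<sigma>') + cos (\<theta> + \<theta>')"
  have D: "D1 > 0" "D2 > 0"
    unfolding D1_def D2_def
    using assms cosh_plus_cos_pos[of \<sigma> \<theta>] cosh_minus_cos_pos[of "\<sigma> - \<sigma>'" "\<theta> - \<theta>'"] by auto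
  have "((\<lambda>\<sigma>. kap \<sigma> \<theta> - sin \<theta>) has_real_derivative kap1 \<sigma> \<theta>) (at \<sigma>)"
    using DERIV_diff[OF kap_deriv DERIV_const] by simp
  moreover have "((\<lambda>\<sigma>. kap \<sigma> \<theta> - sin \<theta>) has_real_derivative
      ((sinh (\<sigma> - \<sigma>') * D2 + D1 * sinh (\<sigma> + \<sigma>')) * (C * cosh \<sigma>) - D1 * D2 * (C * sinh \<sigma>)) / (C * cosh \<sigma>)\<^sup>2) (at \<sigma>)"
    unfolding kap_minus_sin D1_def D2_def using C_pos
    by (auto intro!: derivative_eq_intros simp: power2_eq_square mult_ac)
  ultimately have "kap1 \<sigma> \<theta> = ((sinh (\<sigma> - \<sigma>') * D2 + D1 * sinh (\<sigma> + \<sigma>')) * (C * cosh \<sigma>) - D1 * D2 * (C * sinh \<sigma>)) / (C * cosh \<sigma>)\<^sup>2"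
    by (rule DERIV_unique)
  also have "\<dots> = D1 * D2 / (C * cosh \<sigma>) * (sinh (\<sigma> - \<sigma>') / D1 + (sinh (\<sigma> + \<sigma>') / D2 - sinh \<sigma> / cosh \<sigma>))"
    using D C_pos by (simp add: divide_simps) (simp add: algebra_simps power2_eq_square)
  finally show ?thesis
    unfolding kap_minus_sin D1_def[symmetric] D2_def[symmetric] poisson_def r1_def tanh_def .
qed

lemma k1_eq:
  assumes "\<sigma> \<noteq> \<sigma>'" "\<sigma> \<noteq> - \<sigma>'"
  shows "k1 \<sigma> \<theta> = z1 \<sigma> \<theta> * poisson (\<sigma> - \<sigma>') (\<theta> - \<theta>') + z1 \<sigma> \<theta> * r1 \<sigma> \<theta>"
  unfolding k1_def z1_def kap1_eq[OF assms] by (simp add: algebra_simps)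

lemma z1_interior:
  assumes "0 < \<theta>" "\<theta> < pi" and "\<sigma> \<noteq> \<sigma>' \<or> \<theta> \<noteq> \<theta>'" "\<sigma> \<noteq> - \<sigma>'"
  shows "z1 \<sigma> \<theta> = wh \<theta> * ((chi \<sigma> \<theta> - 1) * ringQ1 m (chi \<sigma> \<theta>))"
proof -
  have s: "sin \<theta> > 0" using assms by (simp add: sin_gt_zero)
  have "kap \<sigma> \<theta> - sin \<theta> = sin \<theta> * (chi \<sigma> \<theta> - 1)" using s by (simp add: chi_def algebra_simps)
  then have "z1 \<sigma> \<theta> = (sin \<theta> ^ (2 * m + 1) * sin \<theta> powr (- (\<mu> + 1))) * sin \<theta> * wpoly \<theta> * ((chi \<sigma> \<theta> - 1) * ringQ1 m (chi \<sigma> \<theta>))"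
    unfolding z1_def qser_chi[OF assms] ringQ1_def by (simp only: mult_ac)
  then show ?thesis unfolding sin_power_powr[OF s] wh_def using s by simp
qed

lemma wh_bound:
  obtains M where "M > 0" "\<And>\<theta>. \<theta> \<in> {0..pi} \<Longrightarrow> \<bar>wh \<theta>\<bar> \<le> M"
proof -
  have "compact (wpoly ` {0..pi})" by (intro compact_continuous_image continuous_intros) auto
  then obtain M where M: "M > 0" "\<And>\<theta>. \<theta> \<in> {0..pi} \<Longrightarrow> \<bar>wpoly \<theta>\<bar> \<le> M"
    using bounded_pos compact_imp_bounded by (metis image_eqI real_norm_def)
  show ?thesis
  proof (rule that[OF M(1)])
    fix \<theta> assume \<theta>: "\<theta> \<in> {0..pi}"
    have "sin \<theta> powr \<mu> \<le> 1 powr \<mu>" using \<theta> by (intro powr_mono2) (auto intro: sin_ge_zero)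
    then have "\<bar>wh \<theta>\<bar> \<le> 1 * M" unfolding wh_def abs_mult using M(2)[OF \<theta>] by (intro mult_mono) auto
    then show "\<bar>wh \<theta>\<bar> \<le> M" by simp
  qed
qed

text \<open>In the interior \<open>z1\<close> is \<open>wh\<close> times
  \<open>(\<chi> - 1) * Q'(\<chi>)\<close>, both bounded uniformly; at the end points it vanishes
  with the sine.\<close>

lemma z1_bound:
  obtains M where "M > 0" "\<And>\<sigma> \<theta>. \<theta> \<in> {0..pi} \<Longrightarrow> \<sigma> \<noteq> \<sigma>' \<or> \<theta> \<noteq> \<theta>' \<Longrightarrow> \<sigma> \<noteq> - \<sigma>' \<Longrightarrow> \<bar>z1 \<sigma> \<theta>\<bar> \<le> M"
proof -
  obtain M where M: "M > 0" "\<And>\<theta>. \<theta> \<in> {0..pi} \<Longrightarrow> \<bar>wh \<theta>\<bar> \<le> M" using wh_bound by blast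
  obtain D where D: "D > 0" "\<And>x. x > 1 \<Longrightarrow> \<bar>(x - 1) * ringQ1 m x\<bar> \<le> D" using ringQ1_bound by blast
  show ?thesis
  proof (rule that[of "M * D"])
    fix \<sigma> \<theta> assume h: "\<theta> \<in> {0..pi}" "\<sigma> \<noteq> \<sigma>' \<or> \<theta> \<noteq> \<theta>'" "\<sigma> \<noteq> - \<sigma>'"
    show "\<bar>z1 \<sigma> \<theta>\<bar> \<le> M * D"
    proof (cases "0 < \<theta> \<and> \<theta> < pi")
      case True
      then have \<theta>: "0 < \<theta>" "\<theta> < pi" by auto
      show ?thesis
        unfolding z1_interior[OF \<theta> h(2,3)] abs_mult[of "wh \<theta>"]
        using M(2)[OF h(1)] D(2)[OF chi_gt_1[OF \<theta> h(2,3)]] M(1) by (intro mult_mono) auto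
    next
      case False
      then have "\<theta> = 0 \<or> \<theta> = pi" using h by auto
      then have "z1 \<sigma> \<theta> = 0" by (auto simp: z1_def)
      then show ?thesis using M(1) D(1) by simp
    qed
  qed (use M D in auto)
qed

text \<open>For nonnegative \<sigma> the mirror image is out of reach: the denominator is at least
  \<open>cosh \<sigma>' - 1 > 0\<close>.\<close>

lemma r1_bound:
  assumes "\<sigma> \<ge> 0"
  shows "\<bar>r1 \<sigma> \<theta>\<bar> \<le> 2 + 1 / (cosh \<sigma>' - 1)"
proof -
  define x where "x = \<sigma> + \<sigma>'"
  have c1: "cosh \<sigma>' > 1" using s' by (intro cosh_gt_1) simp
  have cx: "cosh \<sigma>' \<le> cosh x" unfolding x_def using assms s' by (subst cosh_real_nonneg_le_iff) auto
  have "0 \<le> sinh x" using assms s' by (simp add: x_def)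
  have "sinh x \<le> cosh x" by (rule sinh_le_cosh_real)
  have D: "cosh x - 1 \<le> cosh x + cos (\<theta> + \<theta>')" using cos_ge_minus_one[of "\<theta> + \<theta>'"] by linarith
  have "sinh x / (cosh x + cos (\<theta> + \<theta>')) \<le> cosh x / (cosh x - 1)"
    using \<open>sinh x \<le> cosh x\<close> \<open>0 \<le> sinh x\<close> D c1 cx by (intro frac_le) auto
  also have "\<dots> = 1 + 1 / (cosh x - 1)"
  proof -
    have "cosh x - 1 \<noteq> 0" using c1 cx by linarith
    then show ?thesis by (simp add: divide_simps)
  qed
  also have "\<dots> \<le> 1 + 1 / (cosh \<sigma>' - 1)" using c1 cx by (intro add_left_mono divide_left_mono) auto
  finally have u: "sinh x / (cosh x + cos (\<theta> + \<theta>')) \<le> 1 + 1 / (cosh \<sigma>' - 1)" .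
  have l: "0 \<le> sinh x / (cosh x + cos (\<theta> + \<theta>'))" using \<open>0 \<le> sinh x\<close> D c1 cx by (intro divide_nonneg_nonneg) linarith+
  have "\<bar>tanh \<sigma>\<bar> < 1" using tanh_real_bounds[of \<sigma>] by auto
  moreover have "1 / (cosh \<sigma>' - 1) > 0" using c1 by simp
  ultimately show ?thesis unfolding r1_def x_def[symmetric] using u l by (auto simp: abs_le_iff)
qed

text \<open>The mirror factor is at least \<open>cosh \<sigma> * (cosh \<sigma>' - 1)\<close>, which
  absorbs the denominator \<open>cosh \<sigma>\<close> and makes the constant independent of
  \<sigma>.\<close>

lemma chi_lower:
  assumes "\<sigma> \<ge> 0" "0 < \<theta>" "\<theta> < pi"
  shows "(cosh \<sigma>' - 1) / C * (cosh (\<sigma> - \<sigma>') - cos (\<theta> - \<theta>')) \<le> chi \<sigma> \<theta> - 1"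
proof -
  define D1 D2 where "D1 = cosh (\<sigma> - \<sigma>') - cos (\<theta> - \<theta>')" and "D2 = cosh (\<sigma> + \<sigma>') + cos (\<theta> + \<theta>')"
  have s: "sin \<theta> > 0" using assms by (simp add: sin_gt_zero)
  have D1: "D1 \<ge> 0" unfolding D1_def using cosh_real_ge_1[of "\<sigma> - \<sigma>'"] cos_le_one[of "\<theta> - \<theta>'"] by linarith
  have "cosh \<sigma> * cosh \<sigma>' \<le> cosh (\<sigma> + \<sigma>')" using assms s' by (simp add: cosh_add)
  then have "cosh \<sigma> * cosh \<sigma>' - 1 \<le> D2" unfolding D2_def using cos_ge_minus_one[of "\<theta> + \<theta>'"] by linarith
  moreover have "cosh \<sigma> * (cosh \<sigma>' - 1) \<le> cosh \<sigma> * cosh \<sigma>' - 1"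
    using cosh_real_ge_1[of \<sigma>] by (simp add: algebra_simps)
  ultimately have D2: "cosh \<sigma> * (cosh \<sigma>' - 1) \<le> D2" by linarith
  have cc: "cosh \<sigma>' - 1 \<ge> 0" using cosh_real_ge_1[of \<sigma>'] by simp
  have "(cosh \<sigma>' - 1) / C * D1 * (cosh \<sigma> * sin \<theta>) \<le> (cosh \<sigma>' - 1) / C * D1 * (cosh \<sigma> * 1)"
    using cc C_pos D1 by (intro mult_left_mono mult_nonneg_nonneg divide_nonneg_nonneg) auto
  also have "\<dots> = D1 * (cosh \<sigma> * (cosh \<sigma>' - 1)) / C" by (simp add: mult_ac)
  also have "\<dots> \<le> D1 * D2 / C" using D1 D2 C_pos by (intro divide_right_mono mult_left_mono) auto
  finally have "(cosh \<sigma>' - 1) / C * D1 \<le> D1 * D2 / C / (cosh \<sigma> * sin \<theta>)"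
    using s by (subst pos_le_divide_eq) auto
  also have "\<dots> = (kap \<sigma> \<theta> - sin \<theta>) / sin \<theta>"
    unfolding kap_minus_sin D1_def D2_def by simp
  also have "\<dots> = chi \<sigma> \<theta> - 1" using s by (simp add: chi_def diff_divide_distrib)
  finally show ?thesis unfolding D1_def .
qed

lemma continuous_on_z1:
  fixes f g :: "'b :: t2_space \<Rightarrow> real"
  assumes "continuous_on S f" "continuous_on S g"
    and "\<And>x. x \<in> S \<Longrightarrow> g x \<in> {0..pi} \<and> (f x \<noteq> \<sigma>' \<or> g x \<noteq> \<theta>') \<and> f x \<noteq> - \<sigma>'"
  shows "continuous_on S (\<lambda>x. z1 (f x) (g x))" "continuous_on S (\<lambda>x. r1 (f x) (g x))"
proof -
  have less: "\<bar>sin (g x)\<bar> < kap (f x) (g x)" if "x \<in> S" for x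
    using assms(3)[OF that] by (intro sin_less_kap) auto
  show "continuous_on S (\<lambda>x. z1 (f x) (g x))"
    unfolding z1_def by (intro continuous_intros assms(1,2) conv1_e less)
  have "cosh (f x + \<sigma>') + cos (g x + \<theta>') \<noteq> 0" if "x \<in> S" for x
    using cosh_plus_cos_pos[of "f x" "g x"] assms(3)[OF that] by auto
  then show "continuous_on S (\<lambda>x. r1 (f x) (g x))"
    unfolding r1_def tanh_def by (intro continuous_intros assms(1,2)) auto
qed

lemma z1_integrable:
  assumes "\<sigma> \<noteq> \<sigma>'" "\<sigma> \<noteq> - \<sigma>'"
  shows "(\<lambda>\<theta>. z1 \<sigma> \<theta> * r1 \<sigma> \<theta>) integrable_on {0..pi}"
    and "(\<lambda>\<theta>. z1 \<sigma> \<theta> * poisson (\<sigma> - \<sigma>') (\<theta> - \<theta>')) integrable_on {0..pi}"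
proof -
  have c: "continuous_on {0..pi} (z1 \<sigma>)" "continuous_on {0..pi} (r1 \<sigma>)"
    by (rule continuous_on_z1; use assms in \<open>auto intro!: continuous_intros\<close>)+
  have "cosh (\<sigma> - \<sigma>') - cos (\<theta> - \<theta>') \<noteq> 0" for \<theta>
    using cosh_minus_cos_pos[of "\<sigma> - \<sigma>'" "\<theta> - \<theta>'"] assms by auto
  then have "continuous_on {0..pi} (\<lambda>\<theta>. poisson (\<sigma> - \<sigma>') (\<theta> - \<theta>'))"
    unfolding poisson_def by (intro continuous_intros) auto
  with c show "(\<lambda>\<theta>. z1 \<sigma> \<theta> * r1 \<sigma> \<theta>) integrable_on {0..pi}"
    "(\<lambda>\<theta>. z1 \<sigma> \<theta> * poisson (\<sigma> - \<sigma>') (\<theta> - \<theta>')) integrable_on {0..pi}"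
    by (auto intro!: integrable_continuous_real continuous_intros)
qed

lemma K1_split:
  assumes "\<sigma> \<noteq> \<sigma>'" "\<sigma> \<noteq> - \<sigma>'"
  shows "K1 \<sigma> = integral {0..pi} (\<lambda>\<theta>. z1 \<sigma> \<theta> * poisson (\<sigma> - \<sigma>') (\<theta> - \<theta>')) + integral {0..pi} (\<lambda>\<theta>. z1 \<sigma> \<theta> * r1 \<sigma> \<theta>)"
  unfolding K1_def k1_eq[OF assms] by (intro integral_add z1_integrable assms)

text \<open>Boundedness is enough for the comparison at infinity, as the decaying solution supplies
  the decay in the Wronskian. The offset 1 keeps a fixed distance from the source, so that the
  Poisson kernel and \<open>\<chi> - 1\<close> are controlled.\<close>

lemma K_bounded:
  obtains M where "\<And>\<sigma>. \<sigma> \<ge> \<sigma>' + 1 \<Longrightarrow> \<bar>K0 \<sigma>\<bar> \<le> M \<and> \<bar>K1 \<sigma>\<bar> \<le> M"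
proof -
  obtain W where W: "W > 0" "\<And>\<theta>. \<theta> \<in> {0..pi} \<Longrightarrow> \<bar>wh \<theta>\<bar> \<le> W" using wh_bound by blast
  obtain Z where Z: "Z > 0" "\<And>\<sigma> \<theta>. \<theta> \<in> {0..pi} \<Longrightarrow> \<sigma> \<noteq> \<sigma>' \<or> \<theta> \<noteq> \<theta>' \<Longrightarrow> \<sigma> \<noteq> - \<sigma>' \<Longrightarrow> \<bar>z1 \<sigma> \<theta>\<bar> \<le> Z" using z1_bound by blast
  obtain D where D: "D > 0" "\<And>x. x > 1 \<Longrightarrow> ringQ m x \<le> D + D / sqrt (sqrt (x - 1))" using ringQ_bound by blast
  have c1: "cosh (1::real) > 1" "cosh \<sigma>' > 1" using s' by (auto intro!: cosh_gt_1)
  define \<delta> where "\<delta> = (cosh \<sigma>' - 1) / C * (cosh 1 - 1)"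
  have \<delta>: "\<delta> > 0" unfolding \<delta>_def using c1 C_pos by (intro mult_pos_pos divide_pos_pos) auto
  define M0 where "M0 = W * (D + D / sqrt (sqrt \<delta>))"
  define M1 where "M1 = Z * ((1 + 1 / (cosh 1 - 1)) + (2 + 1 / (cosh \<sigma>' - 1)))"
  show ?thesis
  proof (rule that[of "max (M0 * pi) (M1 * pi)"])
    fix \<sigma> assume \<sigma>: "\<sigma> \<ge> \<sigma>' + 1"
    then have g: "\<sigma> \<noteq> \<sigma>'" "\<sigma> \<noteq> - \<sigma>'" "\<sigma> \<ge> 0" using s' by auto
    have ch: "cosh 1 \<le> cosh (\<sigma> - \<sigma>')" using \<sigma> by (subst cosh_real_nonneg_le_iff) auto
    have b0: "norm (k0 \<sigma> \<theta>) \<le> M0" if \<theta>: "\<theta> \<in> {0..pi}" for \<theta>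
    proof (cases "0 < \<theta> \<and> \<theta> < pi")
      case True
      then have t: "0 < \<theta>" "\<theta> < pi" by auto
      have X: "chi \<sigma> \<theta> > 1" using t g by (intro chi_gt_1) auto
      have "\<delta> \<le> (cosh \<sigma>' - 1) / C * (cosh (\<sigma> - \<sigma>') - cos (\<theta> - \<theta>'))"
      proof -
        have "cosh 1 - 1 \<le> cosh (\<sigma> - \<sigma>') - cos (\<theta> - \<theta>')" using ch cos_le_one[of "\<theta> - \<theta>'"] by linarith
        then show ?thesis unfolding \<delta>_def using c1 C_pos by (intro mult_left_mono) auto
      qed
      also have "\<dots> \<le> chi \<sigma> \<theta> - 1" by (rule chi_lower[OF g(3) t])
      finally have "D / sqrt (sqrt (chi \<sigma> \<theta> - 1)) \<le> D / sqrt (sqrt \<delta>)"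
        using D(1) \<delta> by (intro divide_left_mono) auto
      then have "ringQ m (chi \<sigma> \<theta>) \<le> D + D / sqrt (sqrt \<delta>)" using D(2)[OF X] by linarith
      moreover have "0 \<le> ringQ m (chi \<sigma> \<theta>)" by (rule ringQ_nonneg[OF X])
      moreover have "k0 \<sigma> \<theta> = wh \<theta> * ringQ m (chi \<sigma> \<theta>)" using t g by (intro k_interior) auto
      ultimately show ?thesis unfolding M0_def using W(2)[OF \<theta>] W(1) by (simp only: real_norm_def abs_mult) (intro mult_mono; simp)
    next
      case False
      then have "\<theta> = 0 \<or> \<theta> = pi" using \<theta> by auto
      then have "k0 \<sigma> \<theta> = 0" by (auto simp: k0_def)
      then show ?thesis using W D \<delta> by (simp add: M0_def)
    qed
    have b1: "norm (k1 \<sigma> \<theta>) \<le> M1" if \<theta>: "\<theta> \<in> {0..pi}" for \<theta>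
    proof -
      define e where "e = \<sigma> - \<sigma>'"
      have "sinh e \<ge> 0" "sinh e \<le> cosh e" using \<sigma> by (auto simp: e_def intro: sinh_le_cosh_real)
      have D1: "cosh e - 1 \<le> cosh e - cos (\<theta> - \<theta>')" using cos_le_one[of "\<theta> - \<theta>'"] by linarith
      have "poisson e (\<theta> - \<theta>') \<le> cosh e / (cosh e - 1)"
        unfolding poisson_def using \<open>sinh e \<ge> 0\<close> \<open>sinh e \<le> cosh e\<close> D1 ch c1 by (intro frac_le) (auto simp: e_def)
      also have "\<dots> = 1 + 1 / (cosh e - 1)"
      proof -
        have "cosh e - 1 \<noteq> 0" using ch c1 unfolding e_def by linarith
        then show ?thesis by (simp add: divide_simps)
      qed
      also have "\<dots> \<le> 1 + 1 / (cosh 1 - 1)" using ch c1 by (intro add_left_mono divide_left_mono) (auto simp: e_def)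
      finally have P: "poisson e (\<theta> - \<theta>') \<le> 1 + 1 / (cosh 1 - 1)" .
      have P0: "poisson e (\<theta> - \<theta>') \<ge> 0"
        unfolding poisson_def using \<open>sinh e \<ge> 0\<close> D1 ch[folded e_def] c1 by (intro divide_nonneg_nonneg) linarith+
      have "\<bar>poisson e (\<theta> - \<theta>') + r1 \<sigma> \<theta>\<bar> \<le> (1 + 1 / (cosh 1 - 1)) + (2 + 1 / (cosh \<sigma>' - 1))"
        using P P0 r1_bound[OF g(3), of \<theta>] by linarith
      moreover have "k1 \<sigma> \<theta> = z1 \<sigma> \<theta> * (poisson e (\<theta> - \<theta>') + r1 \<sigma> \<theta>)"
        unfolding k1_eq[OF g(1,2)] e_def by (simp add: algebra_simps)
      ultimately show ?thesis
        unfolding M1_def using Z(1) Z(2)[OF \<theta>, of \<sigma>] g by (simp only: real_norm_def abs_mult) (intro mult_mono; simp)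
    qed
    have const: "((\<lambda>\<theta>::real. c) has_integral c * pi) {0..pi}" for c :: real
      using has_integral_const_real[of c 0 pi] by (simp add: mult.commute)
    have "norm (K0 \<sigma>) \<le> M0 * pi"
      unfolding K0_def by (rule integral_norm_bound_integral[THEN order_trans, OF k_integrable(1)[OF g(1,2)] has_integral_integrable[OF const] b0]) (auto simp: integral_unique[OF const])
    moreover have "norm (K1 \<sigma>) \<le> M1 * pi"
      unfolding K1_def by (rule integral_norm_bound_integral[THEN order_trans, OF k_integrable(2)[OF g(1,2)] has_integral_integrable[OF const] b1]) (auto simp: integral_unique[OF const])
    ultimately show "\<bar>K0 \<sigma>\<bar> \<le> max (M0 * pi) (M1 * pi) \<and> \<bar>K1 \<sigma>\<bar> \<le> max (M0 * pi) (M1 * pi)" by auto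
  qed
qed

section \<open>One-sided limits at the source\<close>

definition S0 :: "real set" where "S0 = {0<..<pi} - {\<theta>'}"

text \<open>Dominated convergence asks for bounds and limits at every point of its set; passing to
  \<open>S0\<close> discards the end points and the singularity, a finite set.\<close>

lemma has_integral_S0: "(f has_integral y) S0 \<longleftrightarrow> (f has_integral y) {0..pi}" for f :: "real \<Rightarrow> real"
proof (rule has_integral_spike_set_eq)
  show "negligible {x \<in> S0 - {0..pi}. f x \<noteq> 0}" by (rule negligible_subset[OF negligible_empty]) (auto simp: S0_def)
  show "negligible {x \<in> {0..pi} - S0. f x \<noteq> 0}"
    by (rule negligible_subset[OF negligible_finite[of "{0, pi, \<theta>'}"]]) (auto simp: S0_def)
qed

lemma integrable_S0: "f integrable_on S0 \<longleftrightarrow> f integrable_on {0..pi}" for f :: "real \<Rightarrow> real"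
  unfolding integrable_on_def has_integral_S0 ..

lemma integral_S0: "integral S0 f = integral {0..pi} f" for f :: "real \<Rightarrow> real"
  unfolding integral_def integrable_S0 has_integral_S0 ..

lemma seq_converges:
  assumes f: "continuous_on ((UNIV - {- \<sigma>'}) \<times> {0..pi} - {(\<sigma>', \<theta>')}) (\<lambda>p. f (fst p) (snd p))"
    and x: "x \<longlonglongrightarrow> \<sigma>'" "\<And>j. x j \<ge> 0" "\<And>j. x j \<noteq> \<sigma>'" and \<theta>: "\<theta> \<in> S0"
  shows "(\<lambda>j. f (x j) \<theta>) \<longlonglongrightarrow> f \<sigma>' \<theta>"
proof -
  have "continuous_on (UNIV - {- \<sigma>'}) (\<lambda>\<sigma>. f (fst (\<sigma>, \<theta>)) (snd (\<sigma>, \<theta>)))"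
    by (rule continuous_on_compose2[OF f]) (use \<theta> in \<open>auto simp: S0_def intro!: continuous_intros\<close>)
  then have "isCont (\<lambda>\<sigma>. f \<sigma> \<theta>) \<sigma>'"
    using s' by (subst (asm) continuous_on_eq_continuous_at) (auto intro: open_delete)
  then show ?thesis using x(1) by (rule isCont_tendsto_compose)
qed

text \<open>The integrands have a common majorant with an inverse square root at
  \<open>\<theta>'\<close>. Dominated convergence then gives both integrability on the singular line
  and the same limit from either side.\<close>

lemma K0_limit:
  assumes x: "x \<longlonglongrightarrow> \<sigma>'" "\<And>j. x j \<ge> 0" "\<And>j. x j \<noteq> \<sigma>'"
  shows "k0 \<sigma>' integrable_on {0..pi}" "(\<lambda>j. K0 (x j)) \<longlonglongrightarrow> K0 \<sigma>'"
proof -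
  obtain W where W: "W > 0" "\<And>\<theta>. \<theta> \<in> {0..pi} \<Longrightarrow> \<bar>wh \<theta>\<bar> \<le> W" using wh_bound by blast
  obtain D where D: "D > 0" "\<And>x. x > 1 \<Longrightarrow> ringQ m x \<le> D + D / sqrt (sqrt (x - 1))" using ringQ_bound by blast
  have c1: "cosh \<sigma>' > 1" using s' by (auto intro!: cosh_gt_1)
  \<comment> \<open>The first factor is the constant of \<open>chi_lower\<close>, the 8 that of
    \<open>one_minus_cos_ge\<close>, so that \<open>\<delta> * (\<theta> - \<theta>')^2\<close>
    bounds \<open>\<chi> - 1\<close> from below.\<close>
  define \<delta> where "\<delta> = (cosh \<sigma>' - 1) / C / 8"
  have \<delta>: "\<delta> > 0" unfolding \<delta>_def using c1 C_pos by simp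
  have xg: "x j \<noteq> - \<sigma>'" for j using x(2)[of j] s' by linarith
  define h where "h = (\<lambda>\<theta>. W * D + W * D / sqrt (sqrt \<delta>) * (1 / sqrt \<bar>\<theta> - \<theta>'\<bar>))"
  have int: "k0 (x j) integrable_on S0" for j unfolding integrable_S0 by (intro k_integrable x xg)
  have hint: "h integrable_on S0"
    unfolding integrable_S0 h_def
  proof (rule integrable_add)
    show "(\<lambda>\<theta>. W * D / sqrt (sqrt \<delta>) * (1 / sqrt \<bar>\<theta> - \<theta>'\<bar>)) integrable_on {0..pi}"
      using integrable_cmul[OF integrable_inverse_sqrt_abs[of \<theta>' 0 pi], of "W * D / sqrt (sqrt \<delta>)"] by simp
  qed (rule integrable_const_ivl)
  have bd: "norm (k0 (x j) \<theta>) \<le> h \<theta>" if \<theta>: "\<theta> \<in> S0" for j \<theta>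
  proof -
    have t: "0 < \<theta>" "\<theta> < pi" "\<theta> \<noteq> \<theta>'" using \<theta> by (auto simp: S0_def)
    have X: "chi (x j) \<theta> > 1" using t xg by (intro chi_gt_1) auto
    have "\<delta> * (\<theta> - \<theta>')\<^sup>2 \<le> (cosh \<sigma>' - 1) / C * (1 - cos (\<theta> - \<theta>'))"
    proof -
      have "(\<theta> - \<theta>')\<^sup>2 / 8 \<le> 1 - cos (\<theta> - \<theta>')" using t t' by (intro one_minus_cos_ge) auto
      then have "(cosh \<sigma>' - 1) / C * ((\<theta> - \<theta>')\<^sup>2 / 8) \<le> (cosh \<sigma>' - 1) / C * (1 - cos (\<theta> - \<theta>'))"
        using c1 C_pos by (intro mult_left_mono) auto
      then show ?thesis by (simp add: \<delta>_def)
    qed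
    also have "\<dots> \<le> (cosh \<sigma>' - 1) / C * (cosh (x j - \<sigma>') - cos (\<theta> - \<theta>'))"
      using c1 C_pos cosh_real_ge_1[of "x j - \<sigma>'"] by (intro mult_left_mono) auto
    also have "\<dots> \<le> chi (x j) \<theta> - 1" by (rule chi_lower[OF x(2) t(1,2)])
    finally have "sqrt (sqrt (\<delta> * (\<theta> - \<theta>')\<^sup>2)) \<le> sqrt (sqrt (chi (x j) \<theta> - 1))" by simp
    then have "sqrt (sqrt \<delta>) * sqrt \<bar>\<theta> - \<theta>'\<bar> \<le> sqrt (sqrt (chi (x j) \<theta> - 1))" by (simp add: real_sqrt_mult)
    then have "D / sqrt (sqrt (chi (x j) \<theta> - 1)) \<le> D / (sqrt (sqrt \<delta>) * sqrt \<bar>\<theta> - \<theta>'\<bar>)"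
      using D(1) \<delta> t X by (intro divide_left_mono mult_pos_pos) auto
    then have "ringQ m (chi (x j) \<theta>) \<le> D + D / (sqrt (sqrt \<delta>) * sqrt \<bar>\<theta> - \<theta>'\<bar>)" using D(2)[OF X] by linarith
    then have "norm (k0 (x j) \<theta>) \<le> W * (D + D / (sqrt (sqrt \<delta>) * sqrt \<bar>\<theta> - \<theta>'\<bar>))"
      using W(2)[of \<theta>] W(1) t ringQ_nonneg[OF X, of m] k_interior(1)[OF t(1,2), of "x j"] xg[of j]
      by (simp add: abs_mult mult_mono)
    then show ?thesis by (simp add: h_def distrib_left)
  qed
  have lim: "(\<lambda>j. k0 (x j) \<theta>) \<longlonglongrightarrow> k0 \<sigma>' \<theta>" if "\<theta> \<in> S0" for \<theta>
    by (rule seq_converges[OF _ x that]) (auto intro!: continuous_on_k continuous_intros)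
  show "k0 \<sigma>' integrable_on {0..pi}" "(\<lambda>j. K0 (x j)) \<longlonglongrightarrow> K0 \<sigma>'"
    using dominated_convergence[OF int hint bd lim] unfolding integrable_S0 integral_S0 K0_def by auto
qed

text \<open>The remainder has a bounded integrand and the same limit from both sides, so it drops
  out of the jump.\<close>

lemma r_limit:
  assumes x: "x \<longlonglongrightarrow> \<sigma>'" "\<And>j. x j \<ge> 0" "\<And>j. x j \<noteq> \<sigma>'"
  shows "(\<lambda>j. integral {0..pi} (\<lambda>\<theta>. z1 (x j) \<theta> * r1 (x j) \<theta>)) \<longlonglongrightarrow> integral {0..pi} (\<lambda>\<theta>. z1 \<sigma>' \<theta> * r1 \<sigma>' \<theta>)"
proof -
  obtain Z where Z: "Z > 0" "\<And>\<sigma> \<theta>. \<theta> \<in> {0..pi} \<Longrightarrow> \<sigma> \<noteq> \<sigma>' \<or> \<theta> \<noteq> \<theta>' \<Longrightarrow> \<sigma> \<noteq> - \<sigma>' \<Longrightarrow> \<bar>z1 \<sigma> \<theta>\<bar> \<le> Z" using z1_bound by blast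
  have xg: "x j \<noteq> - \<sigma>'" for j using x(2)[of j] s' by linarith
  define R where "R = Z * (2 + 1 / (cosh \<sigma>' - 1))"
  have int: "(\<lambda>\<theta>. z1 (x j) \<theta> * r1 (x j) \<theta>) integrable_on S0" for j
    unfolding integrable_S0 by (intro z1_integrable x xg)
  have hint: "(\<lambda>_. R) integrable_on S0" unfolding integrable_S0 by (rule integrable_const_ivl)
  have bd: "norm (z1 (x j) \<theta> * r1 (x j) \<theta>) \<le> R" if "\<theta> \<in> S0" for j \<theta>
    unfolding R_def real_norm_def abs_mult using that Z(1) Z(2)[of \<theta> "x j"] x(3)[of j] xg[of j] r1_bound[OF x(2), of j \<theta>]
    by (intro mult_mono) (auto simp: S0_def)
  have lim: "(\<lambda>j. z1 (x j) \<theta> * r1 (x j) \<theta>) \<longlonglongrightarrow> z1 \<sigma>' \<theta> * r1 \<sigma>' \<theta>" if "\<theta> \<in> S0" for \<theta>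
    by (intro tendsto_mult; rule seq_converges[OF _ x that]) (auto intro!: continuous_on_z1 continuous_intros)
  show ?thesis using dominated_convergence(2)[OF int hint bd lim] unfolding integral_S0 .
qed

text \<open>A limit in both variables jointly, because the approximate identity is applied to
  functions that change as \<sigma> approaches \<open>\<sigma>'\<close>. As \<chi> tends to 1 from
  above, \<open>(\<chi> - 1) * Q'(\<chi>)\<close> tends to the negative of the residue.\<close>

lemma z1_limit:
  "((\<lambda>p. z1 (fst p) (snd p)) \<longlongrightarrow> - ring_residue m * wh \<theta>') (at (\<sigma>', \<theta>'))"
proof -
  have ev: "\<forall>\<^sub>F p in at (\<sigma>', \<theta>'). 0 < snd p \<and> snd p < pi \<and> (fst p \<noteq> \<sigma>' \<or> snd p \<noteq> \<theta>') \<and> fst p \<noteq> - \<sigma>'"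
  proof -
    have "\<forall>\<^sub>F p in at (\<sigma>', \<theta>'). p \<in> {0<..} \<times> {0<..<pi} - {(\<sigma>', \<theta>')}"
      using s' t' by (intro eventually_at_in_open open_Times) auto
    then show ?thesis by eventually_elim (use s' in \<open>auto simp: mem_Times_iff prod_eq_iff\<close>)
  qed
  have s: "sin \<theta>' > 0" using t' by (simp add: sin_gt_zero)
  have k1: "kap \<sigma>' \<theta>' = sin \<theta>'" using kap_minus_sin[of \<sigma>' \<theta>'] by simp
  have "((\<lambda>p. chi (fst p) (snd p)) \<longlongrightarrow> 1) (at (\<sigma>', \<theta>'))"
  proof -
    have "continuous_on UNIV (\<lambda>p. kap (fst p) (snd p))" by (intro continuous_intros)
    then have "((\<lambda>p. kap (fst p) (snd p)) \<longlongrightarrow> kap \<sigma>' \<theta>') (at (\<sigma>', \<theta>'))"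
      by (simp add: continuous_on_eq_continuous_at isCont_def)
    moreover have "((\<lambda>p. sin (snd p)) \<longlongrightarrow> sin \<theta>') (at (\<sigma>', \<theta>'))"
      using tendsto_sin[OF tendsto_snd[OF tendsto_ident_at[of "(\<sigma>', \<theta>')" UNIV]]] by simp
    ultimately have "((\<lambda>p. kap (fst p) (snd p) / sin (snd p)) \<longlongrightarrow> kap \<sigma>' \<theta>' / sin \<theta>') (at (\<sigma>', \<theta>'))"
      using s by (intro tendsto_divide) auto
    then show ?thesis unfolding chi_def k1 using s by simp
  qed
  then have "filterlim (\<lambda>p. chi (fst p) (snd p)) (at_right 1) (at (\<sigma>', \<theta>'))"
    unfolding filterlim_at using ev
    by (auto elim!: eventually_mono dest: chi_gt_1)
  from filterlim_compose[OF ringQ1_limit this]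
  have a: "((\<lambda>p. (chi (fst p) (snd p) - 1) * ringQ1 m (chi (fst p) (snd p))) \<longlongrightarrow> - ring_residue m) (at (\<sigma>', \<theta>'))" .
  have "isCont wh \<theta>'" using wh_deriv(1)[OF s] by (rule DERIV_isCont)
  moreover have "((\<lambda>p. snd p) \<longlongrightarrow> \<theta>') (at (\<sigma>', \<theta>'))"
    using tendsto_snd[OF tendsto_ident_at[of "(\<sigma>', \<theta>')" UNIV]] by simp
  ultimately have w: "((\<lambda>p. wh (snd p)) \<longlongrightarrow> wh \<theta>') (at (\<sigma>', \<theta>'))" by (rule isCont_tendsto_compose)
  have "((\<lambda>p. wh (snd p) * ((chi (fst p) (snd p) - 1) * ringQ1 m (chi (fst p) (snd p)))) \<longlongrightarrow> wh \<theta>' * (- ring_residue m)) (at (\<sigma>', \<theta>'))"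
    by (intro tendsto_mult w a)
  moreover have "\<forall>\<^sub>F p in at (\<sigma>', \<theta>'). wh (snd p) * ((chi (fst p) (snd p) - 1) * ringQ1 m (chi (fst p) (snd p))) = z1 (fst p) (snd p)"
    using ev by eventually_elim (simp add: z1_interior)
  ultimately show ?thesis by (subst (asm) tendsto_cong) (auto simp: mult.commute)
qed

text \<open>The sign c records the side of approach. The Poisson kernel is odd in its first
  argument, so the two sides give opposite limits.\<close>

lemma z1_poisson_limit:
  assumes x: "x \<longlonglongrightarrow> \<sigma>'" "\<And>j. x j \<ge> 0" "\<And>j. x j \<noteq> \<sigma>'" and sgn: "\<And>j. x j - \<sigma>' = c * \<epsilon> j" "c = 1 \<or> c = -1"
    and \<epsilon>: "\<And>j. \<epsilon> j > 0" "\<epsilon> \<longlonglongrightarrow> 0"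
  shows "(\<lambda>j. integral {0..pi} (\<lambda>\<theta>. z1 (x j) \<theta> * poisson (x j - \<sigma>') (\<theta> - \<theta>'))) \<longlonglongrightarrow> - c * (2 * pi * ring_residue m * wh \<theta>')"
proof -
  obtain Z where Z: "Z > 0" "\<And>\<sigma> \<theta>. \<theta> \<in> {0..pi} \<Longrightarrow> \<sigma> \<noteq> \<sigma>' \<or> \<theta> \<noteq> \<theta>' \<Longrightarrow> \<sigma> \<noteq> - \<sigma>' \<Longrightarrow> \<bar>z1 \<sigma> \<theta>\<bar> \<le> Z" using z1_bound by blast
  have xg: "x j \<noteq> - \<sigma>'" for j using x(2)[of j] s' by linarith
  have P: "poisson (x j - \<sigma>') t = c * poisson (\<epsilon> j) t" for j t
    unfolding sgn(1) poisson_def using sgn(2) by auto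
  have cc: "c * c = 1" using sgn(2) by auto
  have int: "(\<lambda>\<theta>. z1 (x j) \<theta> * poisson (\<epsilon> j) (\<theta> - \<theta>')) integrable_on {0..pi}" for j
  proof -
    have "(\<lambda>\<theta>. c * (z1 (x j) \<theta> * poisson (x j - \<sigma>') (\<theta> - \<theta>'))) integrable_on {0..pi}"
      using integrable_cmul[OF z1_integrable(2)[OF x(3) xg, of j], of c] by simp
    moreover have "c * (a * (c * b)) = a * b" for a b
    proof -
      have "c * (a * (c * b)) = (c * c) * (a * b)" by (simp only: mult_ac)
      then show ?thesis by (simp add: cc)
    qed
    ultimately show ?thesis unfolding P by simp
  qed
  have "(\<lambda>j. integral {0..pi} (\<lambda>\<theta>. z1 (x j) \<theta> * poisson (\<epsilon> j) (\<theta> - \<theta>'))) \<longlonglongrightarrow> 2 * pi * (- ring_residue m * wh \<theta>')"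
  proof (rule poisson_limit[OF \<epsilon> t' _ int])
    show "\<bar>z1 (x j) \<theta>\<bar> \<le> Z" if "\<theta> \<in> {0..pi}" for j \<theta> using Z(2)[OF that] x(3) xg by blast
  next
    fix \<eta> :: real assume \<eta>: "\<eta> > 0"
    then obtain d where d: "d > 0" "\<And>p. p \<noteq> (\<sigma>', \<theta>') \<Longrightarrow> dist p (\<sigma>', \<theta>') < d \<Longrightarrow> dist (z1 (fst p) (snd p)) (- ring_residue m * wh \<theta>') < \<eta>"
      using z1_limit unfolding tendsto_iff eventually_at by blast
    have "\<forall>\<^sub>F j in sequentially. dist (x j) \<sigma>' < d / 2" using x(1) d(1) by (intro tendstoD) auto
    then have "\<forall>\<^sub>F j in sequentially. \<forall>\<theta>\<in>{0..pi}. \<bar>\<theta> - \<theta>'\<bar> < d / 2 \<longrightarrow> \<bar>z1 (x j) \<theta> - - ring_residue m * wh \<theta>'\<bar> \<le> \<eta>"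
    proof eventually_elim
      case (elim j)
      show ?case
      proof (intro ballI impI)
        fix \<theta> assume \<theta>: "\<theta> \<in> {0..pi}" "\<bar>\<theta> - \<theta>'\<bar> < d / 2"
        have "dist (x j, \<theta>) (\<sigma>', \<theta>') \<le> dist (x j) \<sigma>' + dist \<theta> \<theta>'"
          unfolding dist_Pair_Pair by (rule sqrt_sum_squares_le_sum) auto
        also have "\<dots> < d" using elim \<theta> by (simp add: dist_real_def)
        finally have "dist (z1 (x j) \<theta>) (- ring_residue m * wh \<theta>') < \<eta>" using d(2)[of "(x j, \<theta>)"] x(3)[of j] by simp
        then show "\<bar>z1 (x j) \<theta> - - ring_residue m * wh \<theta>'\<bar> \<le> \<eta>" by (simp add: dist_real_def)
      qed
    qed
    then show "\<exists>\<delta>>0. \<forall>\<^sub>F j in sequentially. \<forall>\<theta>\<in>{0..pi}. \<bar>\<theta> - \<theta>'\<bar> < \<delta> \<longrightarrow> \<bar>z1 (x j) \<theta> - - ring_residue m * wh \<theta>'\<bar> \<le> \<eta>"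
      using d(1) by (intro exI[of _ "d / 2"]) auto
  qed
  from tendsto_mult[OF tendsto_const[of c] this]
  have "(\<lambda>j. c * integral {0..pi} (\<lambda>\<theta>. z1 (x j) \<theta> * poisson (\<epsilon> j) (\<theta> - \<theta>'))) \<longlonglongrightarrow> c * (2 * pi * (- ring_residue m * wh \<theta>'))" .
  moreover have "c * integral {0..pi} (\<lambda>\<theta>. z1 (x j) \<theta> * poisson (\<epsilon> j) (\<theta> - \<theta>')) =
      integral {0..pi} (\<lambda>\<theta>. z1 (x j) \<theta> * poisson (x j - \<sigma>') (\<theta> - \<theta>'))" for j
    unfolding P by (subst integral_mult_right[symmetric]) (simp only: mult_ac)
  ultimately show ?thesis by (simp add: mult_ac)
qed

lemma K1_jump:
  assumes \<epsilon>: "\<And>j. \<epsilon> j > 0" "\<And>j. \<epsilon> j < \<sigma>'" "\<epsilon> \<longlonglongrightarrow> 0"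
  shows "(\<lambda>j. K1 (\<sigma>' + \<epsilon> j) - K1 (\<sigma>' - \<epsilon> j)) \<longlonglongrightarrow> - 4 * pi * ring_residue m * wh \<theta>'"
proof -
  have xp: "(\<lambda>j. \<sigma>' + \<epsilon> j) \<longlonglongrightarrow> \<sigma>'" "\<And>j. \<sigma>' + \<epsilon> j \<ge> 0" "\<And>j. \<sigma>' + \<epsilon> j \<noteq> \<sigma>'"
    using tendsto_add[OF tendsto_const[of \<sigma>'] \<epsilon>(3)] \<epsilon>(1) s' by (auto simp: add_nonneg_nonneg less_imp_le less_imp_neq[THEN not_sym])
  have xm: "(\<lambda>j. \<sigma>' - \<epsilon> j) \<longlonglongrightarrow> \<sigma>'" "\<And>j. \<sigma>' - \<epsilon> j \<ge> 0" "\<And>j. \<sigma>' - \<epsilon> j \<noteq> \<sigma>'"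
    using tendsto_diff[OF tendsto_const[of \<sigma>'] \<epsilon>(3)] \<epsilon>(1,2) by (auto simp: less_imp_le less_imp_neq[THEN not_sym])
  note lp = tendsto_add[OF z1_poisson_limit[OF xp _ _ \<epsilon>(1,3), of 1] r_limit[OF xp]]
  note lm = tendsto_add[OF z1_poisson_limit[OF xm _ _ \<epsilon>(1,3), of "-1"] r_limit[OF xm]]
  have g: "\<sigma>' + \<epsilon> j \<noteq> - \<sigma>'" "\<sigma>' - \<epsilon> j \<noteq> - \<sigma>'" for j using \<epsilon>(1,2)[of j] s' by linarith+
  have "(\<lambda>j. K1 (\<sigma>' + \<epsilon> j)) \<longlonglongrightarrow> - 1 * (2 * pi * ring_residue m * wh \<theta>') + integral {0..pi} (\<lambda>\<theta>. z1 \<sigma>' \<theta> * r1 \<sigma>' \<theta>)"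
    unfolding K1_split[OF xp(3) g(1)] by (rule lp) auto
  moreover have "(\<lambda>j. K1 (\<sigma>' - \<epsilon> j)) \<longlonglongrightarrow> - (-1) * (2 * pi * ring_residue m * wh \<theta>') + integral {0..pi} (\<lambda>\<theta>. z1 \<sigma>' \<theta> * r1 \<sigma>' \<theta>)"
    unfolding K1_split[OF xm(3) g(2)] by (rule lm) auto
  ultimately have "(\<lambda>j. K1 (\<sigma>' + \<epsilon> j) - K1 (\<sigma>' - \<epsilon> j)) \<longlonglongrightarrow>
     (- 1 * (2 * pi * ring_residue m * wh \<theta>') + integral {0..pi} (\<lambda>\<theta>. z1 \<sigma>' \<theta> * r1 \<sigma>' \<theta>))
     - (- (-1) * (2 * pi * ring_residue m * wh \<theta>') + integral {0..pi} (\<lambda>\<theta>. z1 \<sigma>' \<theta> * r1 \<sigma>' \<theta>))"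
    by (rule tendsto_diff)
  then show ?thesis by (simp add: algebra_simps)
qed

end

subsection \<open>Matching the two solutions\<close>

lemma integral_reflect_pi:
  fixes f :: "real \<Rightarrow> real"
  assumes "f integrable_on {0..pi}"
  shows "integral {0..pi} (\<lambda>\<theta>. f (pi - \<theta>)) = integral {0..pi} f"
proof -
  have "(\<lambda>x. - x + pi) ` {0..pi} = {0..pi}"
  proof (intro equalityI subsetI)
    fix x assume "x \<in> {0..pi}"
    then show "x \<in> (\<lambda>x. - x + pi) ` {0..pi}" by (intro image_eqI[of _ _ "pi - x"]) auto
  qed auto
  moreover have "((\<lambda>x. f (- 1 *\<^sub>R x + pi)) has_integral (1 / (\<bar>-1\<bar> ^ DIM(real))) *\<^sub>R integral {0..pi} f)
      ((\<lambda>x. (1 / - 1) *\<^sub>R x + - ((1 / - 1) *\<^sub>R pi)) ` cbox 0 pi)"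
    using assms by (intro has_integral_affinity) (auto simp: integrable_integral)
  ultimately have "((\<lambda>x. f (pi - x)) has_integral integral {0..pi} f) {0..pi}" by simp
  then show ?thesis by (rule integral_unique)
qed

context ring_kernel
begin

text \<open>The reflection of \<open>(\<sigma>, \<theta>)\<close> to
  \<open>(- \<sigma>, pi - \<theta>)\<close> leaves \<open>kap\<close> and the sine unchanged; the
  sign comes from the Legendre derivative alone, and one more from differentiating in
  \<sigma>.\<close>

lemma K_parity:
  assumes "\<sigma> \<noteq> \<sigma>'" "\<sigma> \<noteq> - \<sigma>'"
  shows "K0 (- \<sigma>) = (-1) ^ (n - m) * K0 \<sigma>" "K1 (- \<sigma>) = - ((-1) ^ (n - m)) * K1 \<sigma>"
proof -
  have kap: "kap (- \<sigma>) (pi - \<theta>) = kap \<sigma> \<theta>" "kap1 (- \<sigma>) (pi - \<theta>) = - kap1 \<sigma> \<theta>" for \<theta>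
    by (simp_all add: kap_def kap1_def diff_divide_distrib add_divide_distrib)
  have w: "wpoly (pi - \<theta>) = (-1) ^ (n - m) * wpoly \<theta>" for \<theta>
    unfolding wpoly_def by (simp add: poly_legendre_deriv_minus[OF mn])
  have g: "- \<sigma> \<noteq> \<sigma>'" "- \<sigma> \<noteq> - \<sigma>'" using assms by auto
  have k0: "k0 (- \<sigma>) (pi - \<theta>) = (-1) ^ (n - m) * k0 \<sigma> \<theta>" for \<theta> unfolding k0_def kap w by simp
  have k1: "k1 (- \<sigma>) (pi - \<theta>) = - ((-1) ^ (n - m)) * k1 \<sigma> \<theta>" for \<theta> unfolding k1_def kap w by simp
  have "K0 (- \<sigma>) = integral {0..pi} (\<lambda>\<theta>. k0 (- \<sigma>) (pi - \<theta>))"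
    unfolding K0_def by (rule integral_reflect_pi[OF k_integrable(1)[OF g], symmetric])
  then show "K0 (- \<sigma>) = (-1) ^ (n - m) * K0 \<sigma>" unfolding k0 K0_def by simp
  have "K1 (- \<sigma>) = integral {0..pi} (\<lambda>\<theta>. k1 (- \<sigma>) (pi - \<theta>))"
    unfolding K1_def by (rule integral_reflect_pi[OF k_integrable(2)[OF g], symmetric])
  then show "K1 (- \<sigma>) = - ((-1) ^ (n - m)) * K1 \<sigma>" unfolding k1 K1_def by simp
qed

end

section \<open>The two separated solutions in normal form\<close>

definition hatP :: "nat \<Rightarrow> nat \<Rightarrow> real \<Rightarrow> real" where
  "hatP m n s = cosh s powr (real m + 1 / 2) * poly (legendre_abs m n) (sinh s)"

definition hatP1 :: "nat \<Rightarrow> nat \<Rightarrow> real \<Rightarrow> real" where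
  "hatP1 m n s = cosh s powr (real m + 1 / 2) *
     (poly (pderiv (legendre_abs m n)) (sinh s) * cosh s + (real m + 1 / 2) * tanh s * poly (legendre_abs m n) (sinh s))"

text \<open>Up to constants, \<open>hatP\<close> and \<open>hatQ\<close> are
  \<open>sqrt (cosh s)\<close> times the two Legendre functions at \<open>\<i> * sinh s\<close>; the
  remaining m powers of cosh belong to the Legendre functions themselves.\<close>

definition hatQ :: "nat \<Rightarrow> nat \<Rightarrow> real \<Rightarrow> real" where
  "hatQ m n s = cosh s powr (real m + 1 / 2) * oblateQ m n s"

lemma hatP_deriv:
  assumes "m \<le> n"
  shows "(hatP m n has_real_derivative hatP1 m n s) (at s)"
    and "(hatP1 m n has_real_derivative
           ((real n + 1 / 2)\<^sup>2 - (real m + 1 / 2) * (real m + 1 / 2 - 1) / (cosh s)\<^sup>2) * hatP m n s) (at s)"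
proof -
  define y where "y = legendre_abs m n"
  define f f1 f2 where "f = (\<lambda>s. poly y (sinh s))" and "f1 = (\<lambda>s. poly (pderiv y) (sinh s) * cosh s)"
    and "f2 = (\<lambda>s. poly (pderiv (pderiv y)) (sinh s) * (cosh s)\<^sup>2 + poly (pderiv y) (sinh s) * sinh s)"
  have sh: "(sinh has_real_derivative cosh s) (at s)" "(cosh has_real_derivative sinh s) (at s)" for s :: real
    by (auto intro!: derivative_eq_intros)
  have d1: "(f has_real_derivative f1 s) (at s)" for s
    unfolding f_def f1_def by (rule DERIV_chain2[OF poly_DERIV sh(1)])
  have d2: "(f1 has_real_derivative f2 s) (at s)" for s
    unfolding f1_def f2_def
    by (rule DERIV_cong[OF DERIV_mult[OF DERIV_chain2[OF poly_DERIV sh(1)] sh(2)]]) (simp add: power2_eq_square mult_ac)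
  have ode: "f2 s + 2 * (real m + 1 / 2) * tanh s * f1 s + (real m + 1 / 2)\<^sup>2 * f s = (real n + 1 / 2)\<^sup>2 * f s" for s
  proof -
    have "poly ([:1, 0, 1:] * pderiv (pderiv y) + smult (2 * (real m + 1)) ([:0, 1:] * pderiv y)) (sinh s)
       = poly (smult ((real n - real m) * (real n + real m + 1)) y) (sinh s)"
      unfolding y_def legendre_abs_ode[OF assms] ..
    then have o: "(1 + (sinh s)\<^sup>2) * poly (pderiv (pderiv y)) (sinh s) + 2 * (real m + 1) * sinh s * poly (pderiv y) (sinh s)
       = (real n - real m) * (real n + real m + 1) * poly y (sinh s)"
      by (simp add: algebra_simps power2_eq_square)
    have "2 * (real m + 1 / 2) * tanh s * f1 s = (2 * real m + 1) * sinh s * poly (pderiv y) (sinh s)"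
      unfolding f1_def tanh_def by (simp add: field_simps)
    then have "f2 s + 2 * (real m + 1 / 2) * tanh s * f1 s = (1 + (sinh s)\<^sup>2) * poly (pderiv (pderiv y)) (sinh s) + 2 * (real m + 1) * sinh s * poly (pderiv y) (sinh s)"
      unfolding f2_def cosh_square_eq by (simp add: algebra_simps)
    then show ?thesis unfolding o f_def by (simp add: algebra_simps power2_eq_square)
  qed
  show "(hatP m n has_real_derivative hatP1 m n s) (at s)"
    unfolding hatP_def hatP1_def
    using liouville_cosh(1)[where f = f and ?f1.0 = f1 and ?f2.0 = f2, OF d1[of s] d2[of s] ode[of s]]
    unfolding f_def f1_def y_def .
  show "(hatP1 m n has_real_derivative
           ((real n + 1 / 2)\<^sup>2 - (real m + 1 / 2) * (real m + 1 / 2 - 1) / (cosh s)\<^sup>2) * hatP m n s) (at s)"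
    unfolding hatP_def hatP1_def
    using liouville_cosh(2)[where f = f and ?f1.0 = f1 and ?f2.0 = f2, OF d1[of s] d2[of s] ode[of s]]
    unfolding f_def f1_def y_def .
qed

lemma hatP_parity:
  assumes "m \<le> n"
  shows "hatP m n (- s) = (-1) ^ (n - m) * hatP m n s" "hatP1 m n (- s) = - ((-1) ^ (n - m)) * hatP1 m n s"
proof -
  show P: "hatP m n (- s) = (-1) ^ (n - m) * hatP m n s" for s
    unfolding hatP_def by (simp add: poly_legendre_abs_minus[OF assms])
  have "((\<lambda>s. hatP m n (- s)) has_real_derivative - hatP1 m n (- s)) (at s)"
    using DERIV_chain2[OF hatP_deriv(1)[OF assms] DERIV_minus[OF DERIV_ident]] by simp
  moreover have "((\<lambda>s. hatP m n (- s)) has_real_derivative (-1) ^ (n - m) * hatP1 m n s) (at s)"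
    unfolding P by (rule DERIV_cmult[OF hatP_deriv(1)[OF assms]])
  ultimately have "- hatP1 m n (- s) = (-1) ^ (n - m) * hatP1 m n s" by (rule DERIV_unique)
  then show "hatP1 m n (- s) = - ((-1) ^ (n - m)) * hatP1 m n s" by simp
qed

text \<open>\<open>sinh s\<close> grows like \<open>exp s / 2\<close>, so only the coefficient at N
  survives; if the degree is smaller, that coefficient and the limit are 0.\<close>

lemma poly_sinh_limit:
  fixes p :: "real poly"
  assumes "degree p \<le> N"
  shows "((\<lambda>s. poly p (sinh s) * exp (- s) ^ N) \<longlongrightarrow> coeff p N / 2 ^ N) at_top"
proof -
  have l1: "((\<lambda>s::real. sinh s * exp (- s)) \<longlongrightarrow> 1 / 2) at_top" by real_asymp
  have l2: "((\<lambda>s::real. exp (- s)) \<longlongrightarrow> 0) at_top" by real_asymp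
  have "((\<lambda>s. \<Sum>k\<le>N. coeff p k * ((sinh s * exp (- s)) ^ k * exp (- s) ^ (N - k))) \<longlongrightarrow>
      (\<Sum>k\<le>N. coeff p k * ((1 / 2) ^ k * 0 ^ (N - k)))) at_top"
    by (intro tendsto_intros l1 l2)
  \<comment> \<open>\<open>0 ^ (N - k)\<close> is 1 for k = N and 0 otherwise.\<close>
  also have "(\<Sum>k\<le>N. coeff p k * ((1 / 2) ^ k * 0 ^ (N - k))) = (\<Sum>k\<in>{N}. coeff p k * ((1 / 2) ^ k * 0 ^ (N - k)))"
    by (rule sum.mono_neutral_right) auto
  also have "\<dots> = coeff p N / 2 ^ N" by (simp add: power_divide)
  also have "(\<lambda>s. \<Sum>k\<le>N. coeff p k * ((sinh s * exp (- s)) ^ k * exp (- s) ^ (N - k))) = (\<lambda>s. poly p (sinh s) * exp (- s) ^ N)"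
  proof
    fix s :: real
    have "(sinh s * exp (- s)) ^ k * exp (- s) ^ (N - k) = sinh s ^ k * exp (- s) ^ N" if "k \<le> N" for k
      using that by (simp add: power_mult_distrib power_add[symmetric])
    then show "(\<Sum>k\<le>N. coeff p k * ((sinh s * exp (- s)) ^ k * exp (- s) ^ (N - k))) = poly p (sinh s) * exp (- s) ^ N"
      unfolding poly_altdef_le[OF assms] sum_distrib_right by (intro sum.cong) auto
  qed
  finally show ?thesis .
qed

text \<open>Needed to combine the normalisation of the decaying solution with the leading
  coefficient of the polynomial one.\<close>

lemma Gamma_half_integer:
  "Gamma (real n + 3 / 2) = fact (2 * n + 1) * sqrt pi / (2 ^ (2 * n + 1) * fact n)"
proof (induction n)
  case 0
  have "Gamma (1 / 2 + 1 :: real) = 1 / 2 * Gamma (1 / 2)" by (rule Gamma_plus1) (auto elim!: nonpos_Ints_cases)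
  then show ?case by (simp add: Gamma_one_half_real)
next
  case (Suc n)
  have "real n + 3 / 2 \<notin> \<int>\<^sub>\<le>\<^sub>0" using nonpos_Ints_nonpos[of "real n + 3 / 2"] by auto
  then have "Gamma (real n + 3 / 2 + 1) = (real n + 3 / 2) * Gamma (real n + 3 / 2)" by (rule Gamma_plus1)
  moreover have "real (Suc n) + 3 / 2 = real n + 3 / 2 + 1" by simp
  ultimately have "Gamma (real (Suc n) + 3 / 2) = (real n + 3 / 2) * (fact (2 * n + 1) * sqrt pi / (2 ^ (2 * n + 1) * fact n))"
    using Suc.IH by metis
  moreover have "fact (2 * Suc n + 1) = (2 * real n + 3) * (2 * real n + 2) * fact (2 * n + 1)"
    by (simp add: algebra_simps)
  moreover have "fact (Suc n) = (real n + 1) * fact n" by simp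
  moreover have "(2::real) ^ (2 * Suc n + 1) = 4 * 2 ^ (2 * n + 1)" by simp
  moreover have "real n + 1 \<noteq> 0" by linarith
  moreover have "(a + 3 / 2) * (F * r / (P * f)) = (2 * a + 3) * (2 * a + 2) * F * r / (4 * P * ((a + 1) * f))"
    if "a + 1 \<noteq> 0" for a F r P f :: real
  proof -
    have "(2 * a + 3) * (2 * a + 2) * F * r = 4 * (a + 1) * ((a + 3 / 2) * (F * r))"
      "4 * P * ((a + 1) * f) = 4 * (a + 1) * (P * f)" by (simp_all add: algebra_simps)
    moreover have "4 * (a + 1) \<noteq> 0" using that by simp
    ultimately show ?thesis by (simp only: mult_divide_mult_cancel_left_if if_False times_divide_eq_right)
  qed
  ultimately show ?case by (simp only:)
qed

text \<open>Without a first-order term in the equation the Wronskian is constant, so it may be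
  evaluated at infinity, where only the leading coefficient of the polynomial and the value
  \<open>rGamma (n + 3/2)\<close> of the series enter.\<close>

lemma hatQ_solution:
  assumes mn: "m \<le> n"
  obtains q1 where
    "\<And>s. s > 0 \<Longrightarrow> (hatQ m n has_real_derivative q1 s) (at s)"
    "\<And>s. s > 0 \<Longrightarrow> (q1 has_real_derivative
        ((real n + 1 / 2)\<^sup>2 - (real m + 1 / 2) * (real m + 1 / 2 - 1) / (cosh s)\<^sup>2) * hatQ m n s) (at s)"
    "(hatQ m n \<longlongrightarrow> 0) at_top" "(q1 \<longlongrightarrow> 0) at_top"
    "\<And>s. s > 0 \<Longrightarrow> hatP m n s * q1 s - hatP1 m n s * hatQ m n s = - 1 / (fact (n - m) * sqrt pi * 2 ^ m)"
proof -
  define \<mu> \<alpha> where "\<mu> = real m + 1 / 2" and "\<alpha> = real n + real m + 1"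
  define y where "y = legendre_abs m n"
  define g where "g = oblateQ m n"
  define R where "R = rGamma (real n + 3 / 2)"
  obtain g1 g2 where g1: "\<And>s. s > 0 \<Longrightarrow> (g has_real_derivative g1 s) (at s)"
    and g2: "\<And>s. s > 0 \<Longrightarrow> (g1 has_real_derivative g2 s) (at s)"
    and ode: "\<And>s. s > 0 \<Longrightarrow> g2 s + 2 * \<mu> * tanh s * g1 s + \<mu>\<^sup>2 * g s = (real n + 1 / 2)\<^sup>2 * g s"
    and lim0: "((\<lambda>s. exp (\<alpha> * s) * g s) \<longlongrightarrow> R) at_top"
    and lim1: "((\<lambda>s. exp (\<alpha> * s) * g1 s) \<longlongrightarrow> - \<alpha> * R) at_top"
    using oblateQ_ode unfolding \<mu>_def \<alpha>_def g_def R_def by blast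
  define q1 where "q1 = (\<lambda>s. cosh s powr \<mu> * (g1 s + \<mu> * tanh s * g s))"
  have Q: "hatQ m n = (\<lambda>s. cosh s powr \<mu> * g s)" by (simp add: hatQ_def fun_eq_iff \<mu>_def g_def)
  have D1: "(hatQ m n has_real_derivative q1 s) (at s)" if "s > 0" for s
    unfolding Q q1_def
    by (rule liouville_cosh(1)[where f = g and ?f1.0 = g1 and ?f2.0 = g2, OF g1[OF that] g2[OF that] ode[OF that]])
  have D2: "(q1 has_real_derivative ((real n + 1 / 2)\<^sup>2 - \<mu> * (\<mu> - 1) / (cosh s)\<^sup>2) * hatQ m n s) (at s)" if "s > 0" for s
    unfolding Q q1_def
    by (rule liouville_cosh(2)[where f = g and ?f1.0 = g1 and ?f2.0 = g2, OF g1[OF that] g2[OF that] ode[OF that]])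
  have ce: "((\<lambda>s::real. cosh s * exp (- s)) \<longlongrightarrow> 1 / 2) at_top" by real_asymp
  have cmu: "((\<lambda>s::real. (cosh s * exp (- s)) powr \<mu>) \<longlongrightarrow> (1 / 2) powr \<mu>) at_top"
    by (intro tendsto_powr ce tendsto_const) simp
  have en: "((\<lambda>s::real. exp (- (real n + 1 / 2) * s)) \<longlongrightarrow> 0) at_top"
  proof -
    have "filterlim (\<lambda>s::real. - (real n + 1 / 2) * s) at_bot at_top"
      by (rule filterlim_tendsto_neg_mult_at_bot[OF tendsto_const _ filterlim_ident]) simp
    then show ?thesis by (rule filterlim_compose[OF exp_at_bot])
  qed
  have th: "((tanh :: real \<Rightarrow> real) \<longlongrightarrow> 1) at_top" by (rule tanh_real_at_top)
  \<comment> \<open>The three exponential rates add up to zero: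
    \<open>- \<mu> + \<alpha> - (n + 1/2) = 0\<close>. The surplus decay
    \<open>exp (- (n + 1/2) * s)\<close> drives both limits to 0.\<close>
  have fac: "cosh s powr \<mu> * x = (cosh s * exp (- s)) powr \<mu> * (exp (\<alpha> * s) * x) * exp (- (real n + 1 / 2) * s)" for s x :: real
  proof -
    have 1: "(cosh s * exp (- s)) powr \<mu> = cosh s powr \<mu> * exp (- \<mu> * s)"
      by (simp add: powr_mult powr_def[of "exp (- s)"])
    have 2: "exp (- \<mu> * s) * exp (\<alpha> * s) * exp (- (real n + 1 / 2) * s) = 1"
      unfolding exp_add[symmetric] by (simp add: \<mu>_def \<alpha>_def algebra_simps)
    have "(cosh s * exp (- s)) powr \<mu> * (exp (\<alpha> * s) * x) * exp (- (real n + 1 / 2) * s) =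
        cosh s powr \<mu> * x * (exp (- \<mu> * s) * exp (\<alpha> * s) * exp (- (real n + 1 / 2) * s))"
      unfolding 1 by (simp only: mult_ac)
    then show ?thesis unfolding 2 by (simp only: mult_1_right)
  qed
  have Q0: "(hatQ m n \<longlongrightarrow> 0) at_top"
    using tendsto_mult[OF tendsto_mult[OF cmu lim0] en] unfolding Q fac by simp
  have q10: "(q1 \<longlongrightarrow> 0) at_top"
  proof -
    have "((\<lambda>s. exp (\<alpha> * s) * g1 s + \<mu> * tanh s * (exp (\<alpha> * s) * g s)) \<longlongrightarrow> - \<alpha> * R + \<mu> * 1 * R) at_top"
      by (intro tendsto_intros lim0 lim1 th)
    then have "((\<lambda>s. exp (\<alpha> * s) * (g1 s + \<mu> * tanh s * g s)) \<longlongrightarrow> - \<alpha> * R + \<mu> * 1 * R) at_top"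
      by (simp add: algebra_simps)
    from tendsto_mult[OF tendsto_mult[OF cmu this] en] show ?thesis unfolding q1_def fac by simp
  qed
  define W where "W = (\<lambda>s. hatP m n s * q1 s - hatP1 m n s * hatQ m n s)"
  have "\<exists>c. \<forall>s\<in>{0<..}. W s = c"
  proof (rule has_field_derivative_zero_constant)
    fix s :: real assume "s \<in> {0<..}"
    then have s: "s > 0" by simp
    show "(W has_real_derivative 0) (at s within {0<..})"
      unfolding W_def
      by (rule has_field_derivative_at_within, rule DERIV_cong[OF DERIV_diff[OF DERIV_mult[OF hatP_deriv(1)[OF mn] D2[OF s]]
            DERIV_mult[OF hatP_deriv(2)[OF mn, folded \<mu>_def] D1[OF s]]]]) (simp add: algebra_simps)
  qed simp
  then obtain c where c: "\<And>s. s > 0 \<Longrightarrow> W s = c" by auto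
  define N where "N = n - m"
  define lead where "lead = coeff y N"
  have deg: "degree y \<le> N" unfolding y_def N_def by (rule degree_legendre_abs)
  have y0: "((\<lambda>s. poly y (sinh s) * exp (- s) ^ N) \<longlongrightarrow> lead / 2 ^ N) at_top"
    unfolding lead_def by (rule poly_sinh_limit[OF deg])
  \<comment> \<open>Replacing cosh by sinh costs a factor tending to 1, and \<open>x * y'\<close>
    again has degree at most N, with coefficient \<open>N * lead\<close> at N.\<close>
  have y1: "((\<lambda>s. poly (pderiv y) (sinh s) * cosh s * exp (- s) ^ N) \<longlongrightarrow> real N * lead / 2 ^ N) at_top"
  proof -
    have "degree ([:0, 1:] * pderiv y) \<le> N"
    proof (rule degree_le, intro allI impI)
      fix i assume "N < i"
      then show "coeff ([:0, 1:] * pderiv y) i = 0" using deg by (cases i) (auto simp: coeff_pderiv coeff_eq_0)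
    qed
    from poly_sinh_limit[OF this]
    have l: "((\<lambda>s. sinh s * poly (pderiv y) (sinh s) * exp (- s) ^ N) \<longlongrightarrow> coeff ([:0, 1:] * pderiv y) N / 2 ^ N) at_top" by simp
    have top: "coeff ([:0, 1:] * pderiv y) N = real N * lead" by (cases N) (simp_all add: coeff_pderiv lead_def)
    have "((\<lambda>s::real. cosh s / sinh s) \<longlongrightarrow> 1) at_top" by real_asymp
    from tendsto_mult[OF l[unfolded top] this]
    have "((\<lambda>s. sinh s * poly (pderiv y) (sinh s) * exp (- s) ^ N * (cosh s / sinh s)) \<longlongrightarrow> real N * lead / 2 ^ N * 1) at_top" .
    moreover have "\<forall>\<^sub>F s in at_top. sinh s * poly (pderiv y) (sinh s) * exp (- s) ^ N * (cosh s / sinh s) = poly (pderiv y) (sinh s) * cosh s * exp (- s) ^ N"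
      using eventually_gt_at_top[of 0] by eventually_elim simp
    ultimately show ?thesis by (subst (asm) tendsto_cong) auto
  qed
  have "((\<lambda>s. (cosh s * exp (- s)) ^ (2 * m + 1) * ((poly y (sinh s) * exp (- s) ^ N) * (exp (\<alpha> * s) * g1 s)
      - (poly (pderiv y) (sinh s) * cosh s * exp (- s) ^ N) * (exp (\<alpha> * s) * g s))) \<longlongrightarrow>
      (1 / 2) ^ (2 * m + 1) * (lead / 2 ^ N * (- \<alpha> * R) - real N * lead / 2 ^ N * R)) at_top"
    by (intro tendsto_intros ce y0 y1 lim0 lim1)
  moreover have "(cosh s * exp (- s)) ^ (2 * m + 1) * ((poly y (sinh s) * exp (- s) ^ N) * (exp (\<alpha> * s) * g1 s)
      - (poly (pderiv y) (sinh s) * cosh s * exp (- s) ^ N) * (exp (\<alpha> * s) * g s)) = W s" for s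
  proof -
    \<comment> \<open>The rates match because
      \<open>2 * m + 1 + N = n + m + 1 = \<alpha>\<close>.\<close>
    have e: "exp (- s) ^ (2 * m + 1) * exp (- s) ^ N * exp (\<alpha> * s) = 1"
      unfolding exp_of_nat_mult[symmetric] exp_add[symmetric] using mn by (simp add: N_def \<alpha>_def of_nat_diff algebra_simps)
    have cc: "cosh s ^ (2 * m + 1) = cosh s powr \<mu> * cosh s powr \<mu>"
    proof -
      have "cosh s ^ (2 * m + 1) = cosh s powr (real (2 * m + 1))" by (simp only: powr_realpow cosh_real_pos)
      also have "real (2 * m + 1) = \<mu> + \<mu>" by (simp add: \<mu>_def)
      finally show ?thesis by (simp only: powr_add)
    qed
    have "(cosh s * exp (- s)) ^ (2 * m + 1) * ((poly y (sinh s) * exp (- s) ^ N) * (exp (\<alpha> * s) * g1 s)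
      - (poly (pderiv y) (sinh s) * cosh s * exp (- s) ^ N) * (exp (\<alpha> * s) * g s)) =
      cosh s ^ (2 * m + 1) * (exp (- s) ^ (2 * m + 1) * exp (- s) ^ N * exp (\<alpha> * s)) * (poly y (sinh s) * g1 s - poly (pderiv y) (sinh s) * cosh s * g s)"
      unfolding power_mult_distrib right_diff_distrib by (simp only: mult_ac)
    also have "\<dots> = cosh s powr \<mu> * cosh s powr \<mu> * (poly y (sinh s) * g1 s - poly (pderiv y) (sinh s) * cosh s * g s)"
      unfolding e cc by simp
    \<comment> \<open>The terms with \<open>\<mu> * tanh s\<close> from the two derivatives
      cancel.\<close>
    also have "\<dots> = W s"
      unfolding W_def hatP_def hatP1_def Q q1_def \<mu>_def[symmetric] y_def[symmetric] by (simp add: algebra_simps)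
    finally show ?thesis .
  qed
  ultimately have "(W \<longlongrightarrow> (1 / 2) ^ (2 * m + 1) * (lead / 2 ^ N * (- \<alpha> * R) - real N * lead / 2 ^ N * R)) at_top" by simp
  moreover have "(W \<longlongrightarrow> c) at_top"
    by (rule tendsto_eventually, rule eventually_mono[OF eventually_gt_at_top[of 0]], rule c)
  ultimately have "c = (1 / 2) ^ (2 * m + 1) * (lead / 2 ^ N * (- \<alpha> * R) - real N * lead / 2 ^ N * R)"
    by (intro tendsto_unique[OF trivial_limit_at_top_linorder]) auto
  also have "\<dots> = - (\<alpha> + real N) * lead * R / (2 ^ (2 * m + 1) * 2 ^ N)"
    by (simp add: power_divide field_simps)
  also have "\<alpha> + real N = 2 * real n + 1" using mn by (simp add: \<alpha>_def N_def of_nat_diff)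
  also have "(2::real) ^ (2 * m + 1) * 2 ^ N = 2 ^ n * 2 ^ m * 2"
  proof -
    have "2 * m + 1 + N = n + m + 1" using mn by (simp add: N_def)
    then show ?thesis by (metis power_add power_one_right)
  qed
  also have "- (2 * real n + 1) * lead * R / (2 ^ n * 2 ^ m * 2) = - 1 / (fact (n - m) * sqrt pi * 2 ^ m)"
  proof -
    have R: "R = (2 ^ (2 * n + 1) * fact n) / (fact (2 * n + 1) * sqrt pi)"
      unfolding R_def rGamma_inverse_Gamma Gamma_half_integer by simp
    have lead: "lead = fact (2 * n) / (2 ^ n * fact n * fact (n - m))"
      unfolding lead_def y_def N_def by (rule coeff_legendre_abs_top[OF mn])
    have f: "fact (2 * n + 1) = (2 * real n + 1) * fact (2 * n)" by (simp add: algebra_simps)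
    have "2 * n + 1 = n + n + 1" by simp
    then have p: "(2::real) ^ (2 * n + 1) = 2 ^ n * 2 ^ n * 2" by (simp only: power_add power_one_right)
    have nz: "2 * real n + 1 \<noteq> 0" by linarith
    have gen: "- a * (F / (p * f * g)) * ((p * p * 2 * f) / (a * F * s)) / (p * q * 2) = - 1 / (g * s * q)"
      if "a \<noteq> 0" "F \<noteq> 0" "p \<noteq> 0" "f \<noteq> 0" for a F p f g s q :: real
      using that by simp
    show ?thesis unfolding R lead f p by (rule gen) (use nz in auto)
  qed
  finally have cv: "c = - 1 / (fact (n - m) * sqrt pi * 2 ^ m)" .
  show ?thesis
    by (rule that[of q1]) (use D1 D2 Q0 q10 c cv in \<open>auto simp: \<mu>_def W_def\<close>)
qed

lemma hatP_pos:
  assumes "m \<le> n" "s > 0"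
  shows "hatP m n s > 0"
  unfolding hatP_def using poly_legendre_abs_pos[OF assms(1), of "sinh s"] assms(2) by simp

section \<open>Proportionality on each side and the value on the diagonal\<close>

context ring_kernel
begin

text \<open>The Wronskian is constant on the interval between the two excluded points. Both
  functions have parity \<open>(-1) ^ (n - m)\<close>, so it is also odd, and therefore
  zero.\<close>

lemma K_hatP:
  assumes "\<sigma> \<in> {- \<sigma>'<..<\<sigma>'}"
  shows "K1 \<sigma> * hatP m n \<sigma> = K0 \<sigma> * hatP1 m n \<sigma>"
proof -
  define W where "W = (\<lambda>s. K1 s * hatP m n s - K0 s * hatP1 m n s)"
  have "\<exists>c. \<forall>s\<in>{- \<sigma>'<..<\<sigma>'}. W s = c"
  proof (rule has_field_derivative_zero_constant)
    fix s assume "s \<in> {- \<sigma>'<..<\<sigma>'}"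
    then have g: "s \<noteq> \<sigma>'" "s \<noteq> - \<sigma>'" by auto
    show "(W has_real_derivative 0) (at s within {- \<sigma>'<..<\<sigma>'})"
      unfolding W_def
      by (rule has_field_derivative_at_within, rule DERIV_cong[OF DERIV_diff[OF DERIV_mult[OF K_deriv(2)[OF g] hatP_deriv(1)[OF mn]]
            DERIV_mult[OF K_deriv(1)[OF g] hatP_deriv(2)[OF mn]]]]) (simp add: K_ode[OF g] algebra_simps)
  qed simp
  then obtain c where c: "\<And>s. s \<in> {- \<sigma>'<..<\<sigma>'} \<Longrightarrow> W s = c" by auto
  have g: "\<sigma> \<noteq> \<sigma>'" "\<sigma> \<noteq> - \<sigma>'" using assms by auto
  define e :: real where "e = (-1) ^ (n - m)"
  have ee: "e * e = 1" unfolding e_def by (simp flip: power_mult_distrib)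
  have "W (- \<sigma>) = - ((e * e) * W \<sigma>)"
    unfolding W_def K_parity[OF g] hatP_parity[OF mn] e_def[symmetric] by (simp add: algebra_simps)
  then have "W (- \<sigma>) = - W \<sigma>" unfolding ee by simp
  moreover have "W (- \<sigma>) = c" "W \<sigma> = c" using assms by (auto intro!: c)
  ultimately have "W \<sigma> = 0" by simp
  then show ?thesis by (simp add: W_def)
qed

lemma K0_ratio:
  assumes "0 < \<sigma>" "\<sigma> < \<sigma>'" "0 < \<tau>" "\<tau> < \<sigma>'"
  shows "K0 \<sigma> / hatP m n \<sigma> = K0 \<tau> / hatP m n \<tau>"
proof -
  have "\<exists>c. \<forall>s\<in>{0<..<\<sigma>'}. K0 s / hatP m n s = c"
  proof (rule has_field_derivative_zero_constant)
    fix s assume "s \<in> {0<..<\<sigma>'}"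
    then have s: "s > 0" "s < \<sigma>'" by auto
    then have g: "s \<noteq> \<sigma>'" "s \<noteq> - \<sigma>'" by auto
    have nz: "hatP m n s \<noteq> 0" using hatP_pos[OF mn s(1)] by simp
    have "((\<lambda>s. K0 s / hatP m n s) has_real_derivative (K1 s * hatP m n s - K0 s * hatP1 m n s) / (hatP m n s * hatP m n s)) (at s)"
      by (rule DERIV_divide[OF K_deriv(1)[OF g] hatP_deriv(1)[OF mn] nz])
    then show "((\<lambda>s. K0 s / hatP m n s) has_real_derivative 0) (at s within {0<..<\<sigma>'})"
      using K_hatP[of s] s by (simp add: has_field_derivative_at_within)
  qed simp
  then show ?thesis using assms by (metis greaterThanLessThan_iff)
qed

text \<open>The constant Wronskian tends to 0 at infinity, being built from bounded and decaying
  factors.\<close>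

lemma K_hatQ:
  assumes q1: "\<And>s. s > 0 \<Longrightarrow> (hatQ m n has_real_derivative q1 s) (at s)"
    "\<And>s. s > 0 \<Longrightarrow> (q1 has_real_derivative ((real n + 1 / 2)\<^sup>2 - \<mu> * (\<mu> - 1) / (cosh s)\<^sup>2) * hatQ m n s) (at s)"
    "(hatQ m n \<longlongrightarrow> 0) at_top" "(q1 \<longlongrightarrow> 0) at_top"
    and \<sigma>: "\<sigma> > \<sigma>'"
  shows "K1 \<sigma> * hatQ m n \<sigma> = K0 \<sigma> * q1 \<sigma>"
proof -
  define W where "W = (\<lambda>s. K1 s * hatQ m n s - K0 s * q1 s)"
  have "\<exists>c. \<forall>s\<in>{\<sigma>'<..}. W s = c"
  proof (rule has_field_derivative_zero_constant)
    fix s assume "s \<in> {\<sigma>'<..}"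
    then have s: "s > 0" and g: "s \<noteq> \<sigma>'" "s \<noteq> - \<sigma>'" using s' by auto
    show "(W has_real_derivative 0) (at s within {\<sigma>'<..})"
      unfolding W_def
      by (rule has_field_derivative_at_within, rule DERIV_cong[OF DERIV_diff[OF DERIV_mult[OF K_deriv(2)[OF g] q1(1)[OF s]]
            DERIV_mult[OF K_deriv(1)[OF g] q1(2)[OF s]]]]) (simp add: K_ode[OF g] algebra_simps)
  qed simp
  then obtain c where c: "\<And>s. s > \<sigma>' \<Longrightarrow> W s = c" by auto
  obtain M where M: "\<And>\<sigma>. \<sigma> \<ge> \<sigma>' + 1 \<Longrightarrow> \<bar>K0 \<sigma>\<bar> \<le> M \<and> \<bar>K1 \<sigma>\<bar> \<le> M" using K_bounded by blast
  have "(W \<longlongrightarrow> 0) at_top"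
  proof (rule Lim_null_comparison)
    show "\<forall>\<^sub>F s in at_top. norm (W s) \<le> M * \<bar>hatQ m n s\<bar> + M * \<bar>q1 s\<bar>"
      using eventually_ge_at_top[of "\<sigma>' + 1"]
    proof eventually_elim
      case (elim s)
      have "norm (W s) \<le> \<bar>K1 s\<bar> * \<bar>hatQ m n s\<bar> + \<bar>K0 s\<bar> * \<bar>q1 s\<bar>"
        unfolding W_def real_norm_def abs_mult[symmetric] by (rule abs_triangle_ineq4)
      also have "\<dots> \<le> M * \<bar>hatQ m n s\<bar> + M * \<bar>q1 s\<bar>" using M[OF elim] by (intro add_mono mult_right_mono) auto
      finally show ?case .
    qed
    have "((\<lambda>s. M * \<bar>hatQ m n s\<bar> + M * \<bar>q1 s\<bar>) \<longlongrightarrow> M * \<bar>0\<bar> + M * \<bar>0\<bar>) at_top" by (intro tendsto_intros q1)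
    then show "((\<lambda>s. M * \<bar>hatQ m n s\<bar> + M * \<bar>q1 s\<bar>) \<longlongrightarrow> 0) at_top" by simp
  qed
  moreover have "(W \<longlongrightarrow> c) at_top"
    by (rule tendsto_eventually, rule eventually_mono[OF eventually_gt_at_top[of \<sigma>']], rule c)
  ultimately have "c = 0" by (intro tendsto_unique[OF trivial_limit_at_top_linorder]) auto
  with c[OF \<sigma>] show ?thesis by (simp add: W_def)
qed

text \<open>The jump of \<open>K1\<close> is multiplied by \<open>hatQ\<close> on the right and
  \<open>hatP\<close> on the left of the source, and the proportionalities exchange each
  \<open>K1\<close> for \<open>K0\<close>. In the limit this gives \<open>K0 \<sigma>'\<close> times
  the Wronskian of the two solutions.\<close>

lemma K0_diagonal:
  "ring_const m * K0 \<sigma>' = 2 * pi * wh \<theta>' * hatP m n \<sigma>' * hatQ m n \<sigma>' * (fact (n - m) * sqrt pi * 2 ^ m)"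
  "((\<lambda>j. K0 (\<sigma>' - \<sigma>' / real (j + 2))) \<longlonglongrightarrow> K0 \<sigma>')" "k0 \<sigma>' integrable_on {0..pi}"
proof -
  obtain q1 where q1: "\<And>s. s > 0 \<Longrightarrow> (hatQ m n has_real_derivative q1 s) (at s)"
    "\<And>s. s > 0 \<Longrightarrow> (q1 has_real_derivative ((real n + 1 / 2)\<^sup>2 - \<mu> * (\<mu> - 1) / (cosh s)\<^sup>2) * hatQ m n s) (at s)"
    "(hatQ m n \<longlongrightarrow> 0) at_top" "(q1 \<longlongrightarrow> 0) at_top"
    "\<And>s. s > 0 \<Longrightarrow> hatP m n s * q1 s - hatP1 m n s * hatQ m n s = - 1 / (fact (n - m) * sqrt pi * 2 ^ m)"
    using hatQ_solution[OF mn] by blast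
  \<comment> \<open>The offset 2 keeps every step below \<open>\<sigma>'\<close>, already for j = 0,
    so the left sequence stays positive.\<close>
  define \<epsilon> where "\<epsilon> = (\<lambda>j. \<sigma>' / real (j + 2))"
  have \<epsilon>: "\<epsilon> j > 0" "\<epsilon> j < \<sigma>'" for j using s' by (auto simp: \<epsilon>_def field_simps add_pos_nonneg)
  have \<epsilon>0: "\<epsilon> \<longlonglongrightarrow> 0" unfolding \<epsilon>_def by real_asymp
  have xp: "(\<lambda>j. \<sigma>' + \<epsilon> j) \<longlonglongrightarrow> \<sigma>'" "\<And>j. \<sigma>' + \<epsilon> j \<ge> 0" "\<And>j. \<sigma>' + \<epsilon> j \<noteq> \<sigma>'"
    using tendsto_add[OF tendsto_const[of \<sigma>'] \<epsilon>0] \<epsilon>(1) s' by (auto simp: add_nonneg_nonneg less_imp_le less_imp_neq[THEN not_sym])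
  have xm: "(\<lambda>j. \<sigma>' - \<epsilon> j) \<longlonglongrightarrow> \<sigma>'" "\<And>j. \<sigma>' - \<epsilon> j \<ge> 0" "\<And>j. \<sigma>' - \<epsilon> j \<noteq> \<sigma>'"
    using tendsto_diff[OF tendsto_const[of \<sigma>'] \<epsilon>0] \<epsilon> by (auto simp: less_imp_le less_imp_neq[THEN not_sym])
  show int: "k0 \<sigma>' integrable_on {0..pi}" by (rule K0_limit(1)[OF xp])
  have Kp: "(\<lambda>j. K0 (\<sigma>' + \<epsilon> j)) \<longlonglongrightarrow> K0 \<sigma>'" by (rule K0_limit(2)[OF xp])
  have Km: "(\<lambda>j. K0 (\<sigma>' - \<epsilon> j)) \<longlonglongrightarrow> K0 \<sigma>'" by (rule K0_limit(2)[OF xm])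
  then show "(\<lambda>j. K0 (\<sigma>' - \<sigma>' / real (j + 2))) \<longlonglongrightarrow> K0 \<sigma>'" by (simp add: \<epsilon>_def)
  have iso: "isCont (hatQ m n) \<sigma>'" "isCont q1 \<sigma>'" "isCont (hatP m n) \<sigma>'" "isCont (hatP1 m n) \<sigma>'"
    using DERIV_isCont[OF q1(1)[OF s']] DERIV_isCont[OF q1(2)[OF s']] DERIV_isCont[OF hatP_deriv(1)[OF mn]] DERIV_isCont[OF hatP_deriv(2)[OF mn]]
    by auto
  note lims = isCont_tendsto_compose[OF iso(1) xp(1)] isCont_tendsto_compose[OF iso(2) xp(1)]
    isCont_tendsto_compose[OF iso(3) xm(1)] isCont_tendsto_compose[OF iso(4) xm(1)]
  have "(K1 (\<sigma>' + \<epsilon> j) - K1 (\<sigma>' - \<epsilon> j)) * (hatQ m n (\<sigma>' + \<epsilon> j) * hatP m n (\<sigma>' - \<epsilon> j)) =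
      K0 (\<sigma>' + \<epsilon> j) * q1 (\<sigma>' + \<epsilon> j) * hatP m n (\<sigma>' - \<epsilon> j) - K0 (\<sigma>' - \<epsilon> j) * hatP1 m n (\<sigma>' - \<epsilon> j) * hatQ m n (\<sigma>' + \<epsilon> j)" for j
  proof -
    have a: "K1 (\<sigma>' + \<epsilon> j) * hatQ m n (\<sigma>' + \<epsilon> j) = K0 (\<sigma>' + \<epsilon> j) * q1 (\<sigma>' + \<epsilon> j)"
      by (rule K_hatQ[OF q1(1-4)]) (use \<epsilon>[of j] in auto)
    have b: "K1 (\<sigma>' - \<epsilon> j) * hatP m n (\<sigma>' - \<epsilon> j) = K0 (\<sigma>' - \<epsilon> j) * hatP1 m n (\<sigma>' - \<epsilon> j)"
      by (rule K_hatP) (use \<epsilon>[of j] s' in auto)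
    have "(K1 (\<sigma>' + \<epsilon> j) - K1 (\<sigma>' - \<epsilon> j)) * (hatQ m n (\<sigma>' + \<epsilon> j) * hatP m n (\<sigma>' - \<epsilon> j)) =
      (K1 (\<sigma>' + \<epsilon> j) * hatQ m n (\<sigma>' + \<epsilon> j)) * hatP m n (\<sigma>' - \<epsilon> j) - (K1 (\<sigma>' - \<epsilon> j) * hatP m n (\<sigma>' - \<epsilon> j)) * hatQ m n (\<sigma>' + \<epsilon> j)"
      by (simp add: algebra_simps)
    then show ?thesis unfolding a b .
  qed
  moreover have "(\<lambda>j. (K1 (\<sigma>' + \<epsilon> j) - K1 (\<sigma>' - \<epsilon> j)) * (hatQ m n (\<sigma>' + \<epsilon> j) * hatP m n (\<sigma>' - \<epsilon> j))) \<longlonglongrightarrow>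
     - 4 * pi * ring_residue m * wh \<theta>' * (hatQ m n \<sigma>' * hatP m n \<sigma>')"
    by (intro tendsto_mult K1_jump lims \<epsilon> \<epsilon>0)
  moreover have "(\<lambda>j. K0 (\<sigma>' + \<epsilon> j) * q1 (\<sigma>' + \<epsilon> j) * hatP m n (\<sigma>' - \<epsilon> j) - K0 (\<sigma>' - \<epsilon> j) * hatP1 m n (\<sigma>' - \<epsilon> j) * hatQ m n (\<sigma>' + \<epsilon> j)) \<longlonglongrightarrow>
     K0 \<sigma>' * q1 \<sigma>' * hatP m n \<sigma>' - K0 \<sigma>' * hatP1 m n \<sigma>' * hatQ m n \<sigma>'"
    by (intro tendsto_mult tendsto_diff lims Kp Km)
  ultimately have "- 4 * pi * ring_residue m * wh \<theta>' * (hatQ m n \<sigma>' * hatP m n \<sigma>') =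
     K0 \<sigma>' * q1 \<sigma>' * hatP m n \<sigma>' - K0 \<sigma>' * hatP1 m n \<sigma>' * hatQ m n \<sigma>'"
    by (simp add: LIMSEQ_unique)
  also have "\<dots> = K0 \<sigma>' * (hatP m n \<sigma>' * q1 \<sigma>' - hatP1 m n \<sigma>' * hatQ m n \<sigma>')" by (simp add: algebra_simps)
  also have "\<dots> = - K0 \<sigma>' / (fact (n - m) * sqrt pi * 2 ^ m)" unfolding q1(5)[OF s'] by simp
  finally have "K0 \<sigma>' = 4 * pi * ring_residue m * wh \<theta>' * (hatQ m n \<sigma>' * hatP m n \<sigma>') * (fact (n - m) * sqrt pi * 2 ^ m)"
    by (simp add: field_simps)
  \<comment> \<open>Grouped so that \<open>ring_const m * ring_residue m = 1/2\<close> reduces the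
    factor 4 to 2.\<close>
  then have "ring_const m * K0 \<sigma>' = 4 * (ring_const m * ring_residue m) * pi * wh \<theta>' * (hatQ m n \<sigma>' * hatP m n \<sigma>') * (fact (n - m) * sqrt pi * 2 ^ m)"
    by (simp only: mult_ac)
  then show "ring_const m * K0 \<sigma>' = 2 * pi * wh \<theta>' * hatP m n \<sigma>' * hatQ m n \<sigma>' * (fact (n - m) * sqrt pi * 2 ^ m)"
    unfolding ring_const_residue by (simp add: mult_ac)
qed

text \<open>The quotient \<open>K0 / hatP\<close> is constant left of the source, and continuity
  identifies the constant with its diagonal value.\<close>

lemma k0_has_integral:
  assumes "0 < \<sigma>" "\<sigma> \<le> \<sigma>'"
  shows "((\<lambda>\<theta>. ring_const m * k0 \<sigma> \<theta>) has_integral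
    2 * pi * wh \<theta>' * hatP m n \<sigma> * hatQ m n \<sigma>' * (fact (n - m) * sqrt pi * 2 ^ m)) {0..pi}"
proof -
  have int: "k0 \<sigma> integrable_on {0..pi}"
  proof (cases "\<sigma> = \<sigma>'")
    case True
    then show ?thesis using K0_diagonal(3) by simp
  next
    case False
    then show ?thesis using assms s' by (intro k_integrable) auto
  qed
  have "K0 \<sigma> * hatP m n \<sigma>' = K0 \<sigma>' * hatP m n \<sigma>"
  proof (cases "\<sigma> = \<sigma>'")
    case False
    define x where "x = (\<lambda>j. \<sigma>' - \<sigma>' / real (j + 2))"
    have x: "0 < x j" "x j < \<sigma>'" for j using s' by (auto simp: x_def field_simps add_pos_nonneg)
    have "x \<longlonglongrightarrow> \<sigma>'" unfolding x_def by real_asymp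
    then have "(\<lambda>j. hatP m n (x j)) \<longlonglongrightarrow> hatP m n \<sigma>'"
      by (rule isCont_tendsto_compose[OF DERIV_isCont[OF hatP_deriv(1)[OF mn]]])
    moreover have "(\<lambda>j. K0 (x j)) \<longlonglongrightarrow> K0 \<sigma>'" unfolding x_def by (rule K0_diagonal(2))
    ultimately have "(\<lambda>j. K0 (x j) / hatP m n (x j)) \<longlonglongrightarrow> K0 \<sigma>' / hatP m n \<sigma>'"
      using hatP_pos[OF mn s'] by (intro tendsto_divide) auto
    moreover have "K0 (x j) / hatP m n (x j) = K0 \<sigma> / hatP m n \<sigma>" for j
      by (rule K0_ratio) (use x assms False in auto)
    ultimately have "K0 \<sigma> / hatP m n \<sigma> = K0 \<sigma>' / hatP m n \<sigma>'" by (simp add: LIMSEQ_const_iff)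
    then show ?thesis using hatP_pos[OF mn s'] hatP_pos[OF mn assms(1)] by (simp add: field_simps)
  qed simp
  then have "ring_const m * K0 \<sigma> * hatP m n \<sigma>' = (ring_const m * K0 \<sigma>') * hatP m n \<sigma>" by (simp add: mult_ac)
  also have "\<dots> = 2 * pi * wh \<theta>' * hatP m n \<sigma> * hatQ m n \<sigma>' * (fact (n - m) * sqrt pi * 2 ^ m) * hatP m n \<sigma>'"
    unfolding K0_diagonal(1) by (simp only: mult_ac)
  finally have "ring_const m * K0 \<sigma> = 2 * pi * wh \<theta>' * hatP m n \<sigma> * hatQ m n \<sigma>' * (fact (n - m) * sqrt pi * 2 ^ m)"
    using hatP_pos[OF mn s'] by simp
  with has_integral_mult_right[OF integrable_integral[OF int], of "ring_const m"]
  show ?thesis unfolding K0_def by simp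
qed

section \<open>Return to the Legendre functions\<close>

lemma ferrersP_wh:
  assumes "0 < \<theta>" "\<theta> < pi"
  shows "ferrersP m n (cos \<theta>) * sqrt (sin \<theta>) = (-1) ^ m * wh \<theta>"
proof -
  have s: "sin \<theta> > 0" using assms by (simp add: sin_gt_zero)
  have "sqrt (1 - (cos \<theta>)\<^sup>2) = sin \<theta>"
    using s by (simp add: sin_squared_eq[symmetric])
  moreover have "sin \<theta> powr \<mu> = sin \<theta> ^ m * sqrt (sin \<theta>)"
    using s by (simp add: powr_add powr_realpow powr_half_sqrt)
  ultimately show ?thesis unfolding ferrersP_def wh_def wpoly_def by (simp only: mult_ac)
qed

lemma cosh_powr_mu: "cosh s powr \<mu> = cosh s ^ m * sqrt (cosh s)" for s :: real
  by (simp add: powr_add powr_realpow powr_half_sqrt)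

lemma ring_kernel_integral:
  assumes \<sigma>: "0 < \<sigma>" "\<sigma> \<le> \<sigma>'"
  shows "((\<lambda>\<theta>::real.
            legendreQ 0 (of_nat m - 1 / 2)
              (complex_of_real
                (((sinh \<sigma>)\<^sup>2 + (sinh \<sigma>')\<^sup>2 + (sin \<theta>)\<^sup>2 + (sin \<theta>')\<^sup>2
                   - 2 * sinh \<sigma> * sinh \<sigma>' * cos \<theta> * cos \<theta>')
                 / (2 * cosh \<sigma> * cosh \<sigma>' * sin \<theta> * sin \<theta>')))
            * complex_of_real (ferrersP m n (cos \<theta>) * sqrt (sin \<theta>)))
         has_integral
           (2 * of_real pi * \<i> * (-1) ^ m * of_real (fact (n - m) / fact (n + m))
             * complex_of_real (sqrt (cosh \<sigma> * cosh \<sigma>' * sin \<theta>') * ferrersP m n (cos \<theta>'))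
             * legendreP (of_nat m) (of_nat n) (\<i> * complex_of_real (sinh \<sigma>))
             * legendreQ (of_nat m) (of_nat n) (\<i> * complex_of_real (sinh \<sigma>'))))
         {0..pi}" (is "(?f has_integral ?R) _")
proof -
  define v where "v = 2 * pi * wh \<theta>' * hatP m n \<sigma> * hatQ m n \<sigma>' * (fact (n - m) * sqrt pi * 2 ^ m)"
  have "((\<lambda>\<theta>. (-1) ^ m * (ring_const m * k0 \<sigma> \<theta>)) has_integral (-1) ^ m * v) {0..pi}"
    unfolding v_def by (rule has_integral_mult_right[OF k0_has_integral[OF \<sigma>]])
  from has_integral_linear[OF this bounded_linear_of_real]
  have "((\<lambda>\<theta>. complex_of_real ((-1) ^ m * (ring_const m * k0 \<sigma> \<theta>))) has_integral of_real ((-1) ^ m * v)) {0..pi}"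
    by (simp add: o_def)
  then have "(?f has_integral of_real ((-1) ^ m * v)) {0..pi}"
  \<comment> \<open>The end points, where the quotient has denominator zero, and the singular point
    are discarded; elsewhere the two integrands coincide.\<close>
  proof (rule has_integral_spike_finite[of "{0, pi, \<theta>'}", rotated 2])
    fix \<theta> assume "\<theta> \<in> {0..pi} - {0, pi, \<theta>'}"
    then have \<theta>: "0 < \<theta>" "\<theta> < pi" "\<sigma> \<noteq> \<sigma>' \<or> \<theta> \<noteq> \<theta>'" "\<sigma> \<noteq> - \<sigma>'" using \<sigma> s' by auto
    have "((sinh \<sigma>)\<^sup>2 + (sinh \<sigma>')\<^sup>2 + (sin \<theta>)\<^sup>2 + (sin \<theta>')\<^sup>2 - 2 * sinh \<sigma> * sinh \<sigma>' * cos \<theta> * cos \<theta>')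
                 / (2 * cosh \<sigma> * cosh \<sigma>' * sin \<theta> * sin \<theta>') = chi \<sigma> \<theta>"
      unfolding chi_def kap_num num_def C_def by (simp add: mult_ac)
    then show "?f \<theta> = complex_of_real ((-1) ^ m * (ring_const m * k0 \<sigma> \<theta>))"
      unfolding ferrersP_wh[OF \<theta>(1,2)] k_interior(1)[OF \<theta>]
      by (simp add: legendreQ_half[OF chi_gt_1[OF \<theta>]] mult_ac)
  qed simp
  moreover have "complex_of_real ((-1) ^ m * v) = ?R"
  proof -
    define P Q where "P = cosh \<sigma> ^ m * poly (legendre_abs m n) (sinh \<sigma>)" and "Q = cosh \<sigma>' ^ m * oblateQ m n \<sigma>'"
    \<comment> \<open>The function of the first kind contributes \<open>\<i> ^ n\<close> and the
      explicit factor one more \<i>, which together make the function of the second kind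
      real.\<close>
    have "?R = 2 * of_real pi * (-1) ^ m * of_real (fact (n - m) / fact (n + m))
       * complex_of_real (sqrt (cosh \<sigma> * cosh \<sigma>' * sin \<theta>') * ferrersP m n (cos \<theta>'))
       * of_real P * (\<i> ^ (n + 1) * legendreQ (of_nat m) (of_nat n) (\<i> * complex_of_real (sinh \<sigma>')))"
      unfolding legendreP_imaginary[OF mn \<sigma>(1)] P_def[symmetric] by (simp add: mult_ac)
    also have "\<dots> = of_real (2 * pi * (-1) ^ m * (fact (n - m) / fact (n + m)) * (sqrt (cosh \<sigma>) * sqrt (cosh \<sigma>') * (ferrersP m n (cos \<theta>') * sqrt (sin \<theta>')))
        * P * ((-1) ^ m * sqrt pi * fact (n + m) * 2 ^ m * Q))"
      unfolding legendreQ_imaginary[OF mn s'] Q_def[symmetric] real_sqrt_mult by (simp add: mult_ac)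
    also have "2 * pi * (-1) ^ m * (fact (n - m) / fact (n + m)) * (sqrt (cosh \<sigma>) * sqrt (cosh \<sigma>') * (ferrersP m n (cos \<theta>') * sqrt (sin \<theta>')))
        * P * ((-1) ^ m * sqrt pi * fact (n + m) * 2 ^ m * Q) = (-1) ^ m * v"
    proof -
      define e :: real where "e = (-1) ^ m"
      have ee: "e * e = 1" unfolding e_def by (simp flip: power_mult_distrib)
      have h: "hatP m n \<sigma> = sqrt (cosh \<sigma>) * P" "hatQ m n \<sigma>' = sqrt (cosh \<sigma>') * Q"
        unfolding hatP_def hatQ_def cosh_powr_mu P_def Q_def by simp_all
      have "2 * pi * e * (fact (n - m) / fact (n + m)) * (sqrt (cosh \<sigma>) * sqrt (cosh \<sigma>') * (e * wh \<theta>'))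
        * P * (e * sqrt pi * fact (n + m) * 2 ^ m * Q) = (e * e) * e * v"
        unfolding v_def h by simp
      then show ?thesis unfolding ferrersP_wh[OF t'] e_def[symmetric] ee by simp
    qed
    finally show ?thesis by simp
  qed
  ultimately show ?thesis by simp
qed

end

theorem theorem3p4:
  fixes m n :: nat and \<sigma> \<sigma>' \<theta>' :: real
  assumes "m \<le> n" and "0 < \<sigma>" and "0 < \<sigma>'" and "0 < \<theta>'" and "\<theta>' < pi"
  shows "((\<lambda>\<theta>::real.
            legendreQ 0 (of_nat m - 1 / 2)
              (complex_of_real
                (((sinh \<sigma>)\<^sup>2 + (sinh \<sigma>')\<^sup>2 + (sin \<theta>)\<^sup>2 + (sin \<theta>')\<^sup>2
                   - 2 * sinh \<sigma> * sinh \<sigma>' * cos \<theta> * cos \<theta>')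
                 / (2 * cosh \<sigma> * cosh \<sigma>' * sin \<theta> * sin \<theta>')))
            * complex_of_real (ferrersP m n (cos \<theta>) * sqrt (sin \<theta>)))
         has_integral
           (2 * of_real pi * \<i> * (-1) ^ m * of_real (fact (n - m) / fact (n + m))
             * complex_of_real (sqrt (cosh \<sigma> * cosh \<sigma>' * sin \<theta>') * ferrersP m n (cos \<theta>'))
             * legendreP (of_nat m) (of_nat n) (\<i> * complex_of_real (sinh (min \<sigma> \<sigma>')))
             * legendreQ (of_nat m) (of_nat n) (\<i> * complex_of_real (sinh (max \<sigma> \<sigma>')))))
         {0..pi}"
proof (cases "\<sigma> \<le> \<sigma>'")
  case True
  then have mm: "min \<sigma> \<sigma>' = \<sigma>" "max \<sigma> \<sigma>' = \<sigma>'" by auto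
  interpret ring_kernel m n \<sigma>' \<theta>' by unfold_locales (use assms in auto)
  show ?thesis unfolding mm by (rule ring_kernel_integral[OF assms(2) True])
next
  case False
  then have mm: "min \<sigma> \<sigma>' = \<sigma>'" "max \<sigma> \<sigma>' = \<sigma>" by auto
  \<comment> \<open>The kernel is symmetric in the two radial variables, so the larger one may
    always be taken as the source.\<close>
  interpret ring_kernel m n \<sigma> \<theta>' by unfold_locales (use assms in auto)
  have sw: "(sinh \<sigma>)\<^sup>2 + (sinh \<sigma>')\<^sup>2 + (sin \<theta>)\<^sup>2 + (sin \<theta>')\<^sup>2 - 2 * sinh \<sigma> * sinh \<sigma>' * cos \<theta> * cos \<theta>'
     = (sinh \<sigma>')\<^sup>2 + (sinh \<sigma>)\<^sup>2 + (sin \<theta>)\<^sup>2 + (sin \<theta>')\<^sup>2 - 2 * sinh \<sigma>' * sinh \<sigma> * cos \<theta> * cos \<theta>'"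
    "2 * cosh \<sigma> * cosh \<sigma>' * sin \<theta> * sin \<theta>' = 2 * cosh \<sigma>' * cosh \<sigma> * sin \<theta> * sin \<theta>'"
    "cosh \<sigma> * cosh \<sigma>' * sin \<theta>' = cosh \<sigma>' * cosh \<sigma> * sin \<theta>'" for \<theta>
    by simp_all
  show ?thesis unfolding mm sw by (rule ring_kernel_integral) (use assms False in auto)
qed

end
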